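(* Let $G$ be a second countable locally compact Hausdorff groupoid with a Haar system, $H$ a closed wide subgroupoid of $G$ with Haar system $\{\lambda_H^u\}_{u\in G^0}$, and $\mu$ a full equivariant $r_{G^0}$-system on $G/H$. Suppose $\sigma$ is a continuous unitary representation of $H$. Then $$\overline{\left(\mathrm{ind}_H^G(\sigma),\mu\right)}=\left(\mathrm{ind}_H^G(\overline{\sigma}),\mu\right),$$ that is, the conjugate of the representation of $G$ induced by $\sigma$ is, up to unitary equivalence, the representation of $G$ induced by the conjugate $\overline\sigma$.
   Context: Groupoids. For a groupoid $G$: $r(x)=xx^{-1}$, $d(x)=x^{-1}x$, unit space $G^0$, $G^2=\{(x,y):d(x)=r(y)\}$, $G^u=r^{-1}(u)$. A Haar system on $G$ is a family $\{\lambda^u\}_{u\in G^0}$ of positive Radon measures on $G$ with $\mathrm{supp}\,\lambda^u=G^u$, $u\mapsto\int f\,d\lambda^u$ continuous for $f\in C_c(G)$, and $\int f(xy)\,d\lambda^{d(x)}(y)=\int f(y)\,d\lambda^{r(x)}(y)$. A subgroupoid is wide if its unit space is $G^0$. $G/H$ is the space of cosets $xH=\{xh:h\in H, r(h)=d(x)\}$ with quotient topology (locally compact Hausdorff), quotient map $q_H$, moment map $r_{G^0}(xH)=r(x)$ and left action $g\cdot xH=gxH$. A full equivariant $r_{G^0}$-system on $G/H$ is a family $\mu=\{\mu^u\}_{u\in G^0}$ of positive Radon measures on $G/H$ with $\mathrm{supp}\,\mu^u=r_{G^0}^{-1}(u)$, $u\mapsto\int f\,d\mu^u$ continuous for $f\in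 C_c(G/H)$, and $\int f(x\cdot y)\,d\mu^{d(x)}(y)=\int f(y)\,d\mu^{r(x)}(y)$ for $x\in G$. Hilbert bundles and representations. A continuous field of Hilbert spaces (continuous Hilbert bundle) over $G^0$ is a family $\{\mathcal H_u\}_{u\in G^0}$ with a linear subspace $\Gamma\subset\prod_u\mathcal H_u$ such that $\{\xi(u):\xi\in\Gamma\}$ is dense in $\mathcal H_u$, $u\mapsto\|\xi(u)\|$ is continuous for $\xi\in\Gamma$, and $\Gamma$ is closed under locally uniform approximation. The total space $\mathcal H=\bigsqcup_u\mathcal H_u$, with projection $p$, has the topology generated by the sets $\{h:\ p(h)\in V,\ \|h-\xi(p(h))\|<\epsilon\}$ ($V\subset G^0$ open, $\epsilon>0$, $\xi\in\Gamma$); $C_0(G^0,\mathcal H)$ is the space of continuous sections vanishing at infinity, with sup norm. A continuous unitary representation $(\mathcal H^\pi,\pi)$ of $G$ consists of a continuous Hilbert bundle $\mathcal H^\pi$ over $G^0$ and unitaries $\pi(x):\mathcal H^\pi_{d(x)}\to\mathcal H^\pi_{r(x)}$ with $\pi(u)=\mathrm{id}$ for $u\in G^0$, $\pi(x)\pi(y)=\pi(xy)$ on $G^2$, $\pi(x^{-1})=\pi(x)^{-1}$, and $x\mapsto\langle\pi(x)\xi(d(x)),\eta(r(x))\rangle$ continuous for $\xi,\eta\in C_0(G^0,\mathcal H^\pi)$. $\mathrm{Mor}(\pi,\pi')$ is the vector space of bundle morphisms (continuous, fibre-preserving, fibrewise bounded linear) $T:\mathcal H^\pi\to\mathcal H^{\pi'}$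 with $T_{r(x)}\pi(x)=\pi'(x)T_{d(x)}$ for all $x\in G$; $\pi,\pi'$ are (unitarily) equivalent if some $T\in \mathrm{Mor}(\pi,\pi')$ has every $T_u$ unitary. Conjugate representation. For a continuous unitary representation $(\mathcal H^\pi,\pi)$ of a groupoid, $(\mathcal H^{\overline\pi},\overline\pi)$ acts on the continuous field $\{\overline{\mathcal H^\pi_u}\}$ of dual Hilbert spaces $\overline{\mathcal H^\pi_u}=\mathcal H^{\pi*}_u=\{f_v:v\in\mathcal H^\pi_u\}$, where $f_v$ is the functional $w\mapsto\langle w,v\rangle$ and $\langle f_v,f_w\rangle=\overline{\langle v,w\rangle}$, with continuous sections $u\mapsto f_{\xi(u)}$ for $\xi$ a continuous section of $\mathcal H^\pi$, by $\overline\pi(x)f_v=f_{\pi(x)v}$, $v\in\mathcal H^\pi_{d(x)}$. Induced representation. Let $(\mathcal H^\sigma,\sigma)$ be a continuous unitary representation of $H$. $C(G,\mathcal H^\sigma)$ is the set of continuous $f:G\to\mathcal H^\sigma$ with $f(x)\in\mathcal H^\sigma_{d(x)}$, and $$\mathcal F_0^\sigma(G)=\{f\in C(G,\mathcal H^\sigma): q_H(\mathrm{supp} f)\text{ compact},\ f(x\xi)=\sigma(\xi^{-1})f(x)\ \text{for } (x,\xi)\in G^2,\ \xi\in H\}.$$ For $f,g\in\mathcal F_0^\sigma(G)$ put $\langle f,g\rangle(u)=\int_{G/H}\langle f(x),g(x)\rangle_{\mathcal H^\sigma_{d(x)}}d\mu^u(xH)$ and $\|f\|=\sup_u\sqrt{\langle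 f,f\rangle(u)}$; $\mathcal F^\sigma(G)=\mathcal F^\sigma(G,\mu)$ is the completion, a Hilbert $C_0(G^0)$-module with $(bf)(x)=b(r(x))f(x)$. It determines a continuous Hilbert bundle $\bar{\mathcal F}^\sigma_G$ over $G^0$ with fibres $\mathcal F^u=\mathcal F^\sigma(G)/\{f:\langle f,f\rangle(u)=0\}$, equivalently the completion of $\{f|_{G^u}:f\in\mathcal F_0^\sigma(G)\}$ in the norm $\sqrt{\langle f,f\rangle(u)}$, and with the topology determined by the sections $t_F(u)=F+\{f:\langle f,f\rangle(u)=0\}$, $F\in\mathcal F^\sigma(G)$. The induced representation $(\mathrm{ind}_H^G(\sigma),\mu)$ is the continuous unitary representation $L$ of $G$ on $\bar{\mathcal F}^\sigma_G$ with $L(x):\mathcal F^{d(x)}\to\mathcal F^{r(x)}$, $(L(x)f)(y)=f(x^{-1}y)$. *)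

theory Defs
  imports "HOL-Analysis.Analysis"
begin

section \<open>Topological groupoids\<close>

text \<open>The arrows are the points of \<^term>\<open>topspace (gtop G)\<close>; the values of \<open>gmult\<close> on
  non-composable pairs and of \<open>ginv\<close> off the carrier are irrelevant.\<close>

record 'g groupoid =
  gtop :: "'g topology"
  gmult :: "'g \<Rightarrow> 'g \<Rightarrow> 'g"
  ginv :: "'g \<Rightarrow> 'g"

definition garr :: "'g groupoid \<Rightarrow> 'g set" where
  "garr G = topspace (gtop G)"

definition grng :: "'g groupoid \<Rightarrow> 'g \<Rightarrow> 'g" where
  "grng G x = gmult G x (ginv G x)"

definition gdom :: "'g groupoid \<Rightarrow> 'g \<Rightarrow> 'g" where
  "gdom G x = gmult G (ginv G x) x"

definition gunits :: "'g groupoid \<Rightarrow> 'g set" where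
  "gunits G = grng G ` garr G"

definition gunit_top :: "'g groupoid \<Rightarrow> 'g topology" where
  "gunit_top G = subtopology (gtop G) (gunits G)"

definition gcomposable :: "'g groupoid \<Rightarrow> ('g \<times> 'g) set" where
  "gcomposable G = {(x, y). x \<in> garr G \<and> y \<in> garr G \<and> gdom G x = grng G y}"

definition grng_fibre :: "'g groupoid \<Rightarrow> 'g \<Rightarrow> 'g set" where
  "grng_fibre G u = {x \<in> garr G. grng G x = u}"

definition is_groupoid :: "'g groupoid \<Rightarrow> bool" where
  "is_groupoid G \<longleftrightarrow>
     (\<forall>x\<in>garr G. ginv G x \<in> garr G \<and> ginv G (ginv G x) = x) \<and>
     (\<forall>(x, y)\<in>gcomposable G. gmult G x y \<in> garr G) \<and>
     (\<forall>x y z. (x, y) \<in> gcomposable G \<and> (y, z) \<in> gcomposable G \<longrightarrow>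
        (gmult G x y, z) \<in> gcomposable G \<and> (x, gmult G y z) \<in> gcomposable G \<and>
        gmult G (gmult G x y) z = gmult G x (gmult G y z)) \<and>
     (\<forall>(x, y)\<in>gcomposable G.
        gmult G (ginv G x) (gmult G x y) = y \<and> gmult G (gmult G x y) (ginv G y) = x)"

definition topological_groupoid :: "'g groupoid \<Rightarrow> bool" where
  "topological_groupoid G \<longleftrightarrow> is_groupoid G \<and>
     continuous_map (gtop G) (gtop G) (ginv G) \<and>
     continuous_map (subtopology (prod_topology (gtop G) (gtop G)) (gcomposable G)) (gtop G)
       (\<lambda>(x, y). gmult G x y)"

definition grestrict :: "'g groupoid \<Rightarrow> 'g set \<Rightarrow> 'g groupoid" where
  "grestrict G H = G\<lparr>gtop := subtopology (gtop G) H\<rparr>"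

definition subgroupoid :: "'g groupoid \<Rightarrow> 'g set \<Rightarrow> bool" where
  "subgroupoid G H \<longleftrightarrow> H \<subseteq> garr G \<and> (\<forall>h\<in>H. ginv G h \<in> H) \<and>
     (\<forall>h\<in>H. \<forall>k\<in>H. gdom G h = grng G k \<longrightarrow> gmult G h k \<in> H)"

definition wide_subgroupoid :: "'g groupoid \<Rightarrow> 'g set \<Rightarrow> bool" where
  "wide_subgroupoid G H \<longleftrightarrow> subgroupoid G H \<and> gunits (grestrict G H) = gunits G"

section \<open>Radon measures, Haar systems, equivariant systems\<close>

definition Cc :: "'a topology \<Rightarrow> ('a \<Rightarrow> complex) set" where
  "Cc X = {f. continuous_map X euclidean f \<and>
              compactin X (X closure_of {x \<in> topspace X. f x \<noteq> 0})}"

definition radon_measure :: "'a topology \<Rightarrow> 'a measure \<Rightarrow> bool" where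
  "radon_measure X M \<longleftrightarrow>
     space M = topspace X \<and> sets M = sigma_sets (topspace X) {U. openin X U} \<and>
     (\<forall>K. compactin X K \<longrightarrow> emeasure M K < \<infinity>) \<and>
     (\<forall>A\<in>sets M. emeasure M A = (INF U\<in>{U. openin X U \<and> A \<subseteq> U}. emeasure M U)) \<and>
     (\<forall>U. openin X U \<longrightarrow> emeasure M U = (SUP K\<in>{K. compactin X K \<and> K \<subseteq> U}. emeasure M K))"

definition measure_support :: "'a topology \<Rightarrow> 'a measure \<Rightarrow> 'a set" where
  "measure_support X M = {x \<in> topspace X. \<forall>U. openin X U \<and> x \<in> U \<longrightarrow> emeasure M U \<noteq> 0}"

text \<open>In the invariance conditions below \<open>f (x y)\<close> is meaningful only on the fibre that
  supports the measure, hence the set integrals.\<close>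

definition haar_system :: "'g groupoid \<Rightarrow> ('g \<Rightarrow> 'g measure) \<Rightarrow> bool" where
  "haar_system G lam \<longleftrightarrow>
     (\<forall>u\<in>gunits G. radon_measure (gtop G) (lam u) \<and>
        measure_support (gtop G) (lam u) = grng_fibre G u) \<and>
     (\<forall>f\<in>Cc (gtop G). continuous_map (gunit_top G) euclidean (\<lambda>u. LINT y|lam u. f y)) \<and>
     (\<forall>x\<in>garr G. \<forall>f\<in>Cc (gtop G).
        (LINT y:grng_fibre G (gdom G x)|lam (gdom G x). f (gmult G x y)) =
        (LINT y|lam (grng G x). f y))"

definition coset :: "'g groupoid \<Rightarrow> 'g set \<Rightarrow> 'g \<Rightarrow> 'g set" where
  "coset G H x = {gmult G x h | h. h \<in> H \<and> grng G h = gdom G x}"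

definition coset_top :: "'g groupoid \<Rightarrow> 'g set \<Rightarrow> 'g set topology" where
  "coset_top G H = topology (\<lambda>U. U \<subseteq> coset G H ` garr G \<and>
     openin (gtop G) {x \<in> garr G. coset G H x \<in> U})"

definition coset_rng_fibre :: "'g groupoid \<Rightarrow> 'g set \<Rightarrow> 'g \<Rightarrow> 'g set set" where
  "coset_rng_fibre G H u = {coset G H x | x. x \<in> garr G \<and> grng G x = u}"

definition coset_act :: "'g groupoid \<Rightarrow> 'g \<Rightarrow> 'g set \<Rightarrow> 'g set" where
  "coset_act G g A = gmult G g ` A"

definition full_equivariant_system ::
    "'g groupoid \<Rightarrow> 'g set \<Rightarrow> ('g \<Rightarrow> 'g set measure) \<Rightarrow> bool" where
  "full_equivariant_system G H mu \<longleftrightarrow>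
     (\<forall>u\<in>gunits G. radon_measure (coset_top G H) (mu u) \<and>
        measure_support (coset_top G H) (mu u) = coset_rng_fibre G H u) \<and>
     (\<forall>f\<in>Cc (coset_top G H).
        continuous_map (gunit_top G) euclidean (\<lambda>u. LINT A|mu u. f A)) \<and>
     (\<forall>x\<in>garr G. \<forall>f\<in>Cc (coset_top G H).
        (LINT A:coset_rng_fibre G H (gdom G x)|mu (gdom G x). f (coset_act G x A)) =
        (LINT A|mu (grng G x). f A))"

section \<open>Hilbert spaces with explicit carrier\<close>

text \<open>The fibres of a Hilbert bundle vary with the base point and are therefore carried by
  subsets of a common type. Inner products are linear in the first argument.\<close>

record 'v hspace =
  hcar :: "'v set"
  hzero :: "'v"
  hadd :: "'v \<Rightarrow> 'v \<Rightarrow> 'v"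
  hscale :: "complex \<Rightarrow> 'v \<Rightarrow> 'v"
  hinner :: "'v \<Rightarrow> 'v \<Rightarrow> complex"

definition hnorm :: "'v hspace \<Rightarrow> 'v \<Rightarrow> real" where
  "hnorm V v = sqrt (Re (hinner V v v))"

definition hdiff :: "'v hspace \<Rightarrow> 'v \<Rightarrow> 'v \<Rightarrow> 'v" where
  "hdiff V v w = hadd V v (hscale V (-1) w)"

text \<open>The guard makes this an instance of \<^locale>\<open>Metric_space\<close>, whose nonnegativity and
  symmetry axioms are not relativised to the carrier.\<close>

definition hdist :: "'v hspace \<Rightarrow> 'v \<Rightarrow> 'v \<Rightarrow> real" where
  "hdist V v w = (if v \<in> hcar V \<and> w \<in> hcar V then hnorm V (hdiff V v w) else 0)"

definition complex_vector_space :: "'v hspace \<Rightarrow> bool" where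
  "complex_vector_space V \<longleftrightarrow>
     hzero V \<in> hcar V \<and>
     (\<forall>v\<in>hcar V. \<forall>w\<in>hcar V. hadd V v w \<in> hcar V \<and> hadd V v w = hadd V w v) \<and>
     (\<forall>v\<in>hcar V. \<forall>w\<in>hcar V. \<forall>z\<in>hcar V. hadd V (hadd V v w) z = hadd V v (hadd V w z)) \<and>
     (\<forall>v\<in>hcar V. hadd V v (hzero V) = v \<and> hdiff V v v = hzero V \<and> hscale V 1 v = v) \<and>
     (\<forall>a. \<forall>v\<in>hcar V. hscale V a v \<in> hcar V) \<and>
     (\<forall>a b. \<forall>v\<in>hcar V. hscale V (a * b) v = hscale V a (hscale V b v) \<and>
        hscale V (a + b) v = hadd V (hscale V a v) (hscale V b v)) \<and>
     (\<forall>a. \<forall>v\<in>hcar V. \<forall>w\<in>hcar V.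
        hscale V a (hadd V v w) = hadd V (hscale V a v) (hscale V a w))"

definition hilbert_space :: "'v hspace \<Rightarrow> bool" where
  "hilbert_space V \<longleftrightarrow> complex_vector_space V \<and>
     (\<forall>v\<in>hcar V. \<forall>w\<in>hcar V. \<forall>z\<in>hcar V.
        hinner V (hadd V v w) z = hinner V v z + hinner V w z) \<and>
     (\<forall>a. \<forall>v\<in>hcar V. \<forall>w\<in>hcar V. hinner V (hscale V a v) w = a * hinner V v w) \<and>
     (\<forall>v\<in>hcar V. \<forall>w\<in>hcar V. hinner V v w = cnj (hinner V w v)) \<and>
     (\<forall>v\<in>hcar V. 0 \<le> Re (hinner V v v) \<and> (hinner V v v = 0 \<longrightarrow> v = hzero V)) \<and>
     Metric_space.mcomplete (hcar V) (hdist V)"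

definition hlinear :: "'v hspace \<Rightarrow> 'w hspace \<Rightarrow> ('v \<Rightarrow> 'w) \<Rightarrow> bool" where
  "hlinear V W T \<longleftrightarrow> T \<in> hcar V \<rightarrow> hcar W \<and>
     (\<forall>v\<in>hcar V. \<forall>w\<in>hcar V. T (hadd V v w) = hadd W (T v) (T w)) \<and>
     (\<forall>a. \<forall>v\<in>hcar V. T (hscale V a v) = hscale W a (T v))"

definition hbounded :: "'v hspace \<Rightarrow> 'w hspace \<Rightarrow> ('v \<Rightarrow> 'w) \<Rightarrow> bool" where
  "hbounded V W T \<longleftrightarrow> hlinear V W T \<and> (\<exists>C. \<forall>v\<in>hcar V. hnorm W (T v) \<le> C * hnorm V v)"

definition hunitary :: "'v hspace \<Rightarrow> 'w hspace \<Rightarrow> ('v \<Rightarrow> 'w) \<Rightarrow> bool" where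
  "hunitary V W T \<longleftrightarrow> hlinear V W T \<and> bij_betw T (hcar V) (hcar W) \<and>
     (\<forall>v\<in>hcar V. \<forall>w\<in>hcar V. hinner W (T v) (T w) = hinner V v w)"

text \<open>\<open>hfun V v\<close> is the functional \<open>w \<mapsto> \<langle>w, v\<rangle>\<close>, and \<open>hriesz V\<close> inverts \<open>v \<mapsto> hfun V v\<close>.\<close>

definition hfun :: "'v hspace \<Rightarrow> 'v \<Rightarrow> 'v \<Rightarrow> complex" where
  "hfun V v = (\<lambda>w\<in>hcar V. hinner V w v)"

definition hriesz :: "'v hspace \<Rightarrow> ('v \<Rightarrow> complex) \<Rightarrow> 'v" where
  "hriesz V \<phi> = (THE v. v \<in> hcar V \<and> hfun V v = \<phi>)"

definition hdual :: "'v hspace \<Rightarrow> ('v \<Rightarrow> complex) hspace" where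
  "hdual V =
     \<lparr> hcar = hfun V ` hcar V,
       hzero = (\<lambda>w\<in>hcar V. 0),
       hadd = (\<lambda>\<phi> \<psi>. \<lambda>w\<in>hcar V. \<phi> w + \<psi> w),
       hscale = (\<lambda>a \<phi>. \<lambda>w\<in>hcar V. a * \<phi> w),
       hinner = (\<lambda>\<phi> \<psi>. cnj (hinner V (hriesz V \<phi>) (hriesz V \<psi>))) \<rparr>"

section \<open>Continuous Hilbert bundles\<close>

record ('g, 'v) hbundle =
  fib :: "'g \<Rightarrow> 'v hspace"
  sec :: "('g \<Rightarrow> 'v) set"

text \<open>Sections are extensional functions on the base. The closure of a set of sections under
  locally uniform approximation:\<close>

definition loc_unif_closure ::
    "'g topology \<Rightarrow> ('g \<Rightarrow> 'v hspace) \<Rightarrow> ('g \<Rightarrow> 'v) set \<Rightarrow> ('g \<Rightarrow> 'v) set" where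
  "loc_unif_closure X F S = {\<xi> \<in> (\<Pi>\<^sub>E u\<in>topspace X. hcar (F u)).
     \<forall>u\<in>topspace X. \<forall>\<epsilon>>0. \<exists>V \<eta>. openin X V \<and> u \<in> V \<and> \<eta> \<in> S \<and>
       (\<forall>v\<in>V. hnorm (F v) (hdiff (F v) (\<xi> v) (\<eta> v)) < \<epsilon>)}"

definition hilbert_bundle :: "'g topology \<Rightarrow> ('g, 'v) hbundle \<Rightarrow> bool" where
  "hilbert_bundle X E \<longleftrightarrow>
     (\<forall>u\<in>topspace X. hilbert_space (fib E u)) \<and>
     sec E \<subseteq> (\<Pi>\<^sub>E u\<in>topspace X. hcar (fib E u)) \<and>
     (\<lambda>u\<in>topspace X. hzero (fib E u)) \<in> sec E \<and>
     (\<forall>\<xi>\<in>sec E. \<forall>\<eta>\<in>sec E. (\<lambda>u\<in>topspace X. hadd (fib E u) (\<xi> u) (\<eta> u)) \<in> sec E) \<and>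
     (\<forall>a. \<forall>\<xi>\<in>sec E. (\<lambda>u\<in>topspace X. hscale (fib E u) a (\<xi> u)) \<in> sec E) \<and>
     (\<forall>u\<in>topspace X. \<forall>v\<in>hcar (fib E u). \<forall>\<epsilon>>0. \<exists>\<xi>\<in>sec E.
        hnorm (fib E u) (hdiff (fib E u) v (\<xi> u)) < \<epsilon>) \<and>
     (\<forall>\<xi>\<in>sec E. continuous_map X euclideanreal (\<lambda>u. hnorm (fib E u) (\<xi> u))) \<and>
     loc_unif_closure X (fib E) (sec E) \<subseteq> sec E"

definition tube ::
    "('g, 'v) hbundle \<Rightarrow> 'g set \<Rightarrow> ('g \<Rightarrow> 'v) \<Rightarrow> real \<Rightarrow> ('g \<times> 'v) set" where
  "tube E V \<xi> \<epsilon> = {(u, h). u \<in> V \<and> h \<in> hcar (fib E u) \<and>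
     hnorm (fib E u) (hdiff (fib E u) h (\<xi> u)) < \<epsilon>}"

definition total_top :: "'g topology \<Rightarrow> ('g, 'v) hbundle \<Rightarrow> ('g \<times> 'v) topology" where
  "total_top X E = topology_generated_by
     {tube E V \<xi> \<epsilon> | V \<xi> \<epsilon>. openin X V \<and> \<xi> \<in> sec E \<and> \<epsilon> > 0}"

definition C0_sections :: "'g topology \<Rightarrow> ('g, 'v) hbundle \<Rightarrow> ('g \<Rightarrow> 'v) set" where
  "C0_sections X E = {\<xi> \<in> (\<Pi>\<^sub>E u\<in>topspace X. hcar (fib E u)).
     continuous_map X (total_top X E) (\<lambda>u. (u, \<xi> u)) \<and>
     (\<forall>\<epsilon>>0. \<exists>K. compactin X K \<and> (\<forall>u\<in>topspace X - K. hnorm (fib E u) (\<xi> u) < \<epsilon>))}"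

section \<open>Representations\<close>

record ('g, 'v) grep =
  bun :: "('g, 'v) hbundle"
  act :: "'g \<Rightarrow> 'v \<Rightarrow> 'v"

abbreviation rfib :: "('g, 'v) grep \<Rightarrow> 'g \<Rightarrow> 'v hspace" where
  "rfib P \<equiv> fib (bun P)"

definition unitary_rep :: "'g groupoid \<Rightarrow> ('g, 'v) grep \<Rightarrow> bool" where
  "unitary_rep G P \<longleftrightarrow>
     hilbert_bundle (gunit_top G) (bun P) \<and>
     (\<forall>x\<in>garr G. hunitary (rfib P (gdom G x)) (rfib P (grng G x)) (act P x)) \<and>
     (\<forall>u\<in>gunits G. \<forall>v\<in>hcar (rfib P u). act P u v = v) \<and>
     (\<forall>(x, y)\<in>gcomposable G. \<forall>v\<in>hcar (rfib P (gdom G y)).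
        act P x (act P y v) = act P (gmult G x y) v) \<and>
     (\<forall>x\<in>garr G. \<forall>w\<in>hcar (rfib P (grng G x)).
        act P (ginv G x) w = inv_into (hcar (rfib P (gdom G x))) (act P x) w) \<and>
     (\<forall>\<xi>\<in>C0_sections (gunit_top G) (bun P). \<forall>\<eta>\<in>C0_sections (gunit_top G) (bun P).
        continuous_map (gtop G) euclidean
          (\<lambda>x. hinner (rfib P (grng G x)) (act P x (\<xi> (gdom G x))) (\<eta> (grng G x))))"

definition Mor ::
    "'g groupoid \<Rightarrow> ('g, 'v) grep \<Rightarrow> ('g, 'w) grep \<Rightarrow> ('g \<Rightarrow> 'v \<Rightarrow> 'w) set" where
  "Mor G P Q = {T.
     continuous_map (total_top (gunit_top G) (bun P)) (total_top (gunit_top G) (bun Q))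
       (\<lambda>(u, v). (u, T u v)) \<and>
     (\<forall>u\<in>gunits G. hbounded (rfib P u) (rfib Q u) (T u)) \<and>
     (\<forall>x\<in>garr G. \<forall>v\<in>hcar (rfib P (gdom G x)).
        T (grng G x) (act P x v) = act Q x (T (gdom G x) v))}"

definition unitarily_equivalent ::
    "'g groupoid \<Rightarrow> ('g, 'v) grep \<Rightarrow> ('g, 'w) grep \<Rightarrow> bool" where
  "unitarily_equivalent G P Q \<longleftrightarrow>
     (\<exists>T\<in>Mor G P Q. \<forall>u\<in>gunits G. hunitary (rfib P u) (rfib Q u) (T u))"

definition conj_rep :: "'g groupoid \<Rightarrow> ('g, 'v) grep \<Rightarrow> ('g, 'v \<Rightarrow> complex) grep" where
  "conj_rep G P =
     \<lparr> bun = \<lparr> fib = (\<lambda>u. hdual (rfib P u)),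
               sec = {(\<lambda>u\<in>gunits G. hfun (rfib P u) (\<xi> u)) | \<xi>. \<xi> \<in> sec (bun P)} \<rparr>,
       act = (\<lambda>x \<phi>. hfun (rfib P (grng G x)) (act P x (hriesz (rfib P (gdom G x)) \<phi>))) \<rparr>"

section \<open>Induced representations\<close>

text \<open>Completion of \<open>(M, d)\<close>: Cauchy sequences modulo null sequences.\<close>

definition cauchy_rel ::
    "'a set \<Rightarrow> ('a \<Rightarrow> 'a \<Rightarrow> real) \<Rightarrow> ((nat \<Rightarrow> 'a) \<times> (nat \<Rightarrow> 'a)) set" where
  "cauchy_rel M d = {(s, t). Metric_space.MCauchy M d s \<and> Metric_space.MCauchy M d t \<and>
     (\<lambda>n. d (s n) (t n)) \<longlonglongrightarrow> 0}"

definition metric_completion ::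
    "'a set \<Rightarrow> ('a \<Rightarrow> 'a \<Rightarrow> real) \<Rightarrow> (nat \<Rightarrow> 'a) set set" where
  "metric_completion M d = {s. Metric_space.MCauchy M d s} // cauchy_rel M d"

definition ind_F0 :: "'g groupoid \<Rightarrow> 'g set \<Rightarrow> ('g, 'v) grep \<Rightarrow> ('g \<Rightarrow> 'v) set" where
  "ind_F0 G H S = {f \<in> (\<Pi>\<^sub>E x\<in>garr G. hcar (rfib S (gdom G x))).
     continuous_map (gtop G) (total_top (gunit_top G) (bun S)) (\<lambda>x. (gdom G x, f x)) \<and>
     compactin (coset_top G H)
       (coset G H ` (gtop G closure_of {x \<in> garr G. f x \<noteq> hzero (rfib S (gdom G x))})) \<and>
     (\<forall>x\<in>garr G. \<forall>h\<in>H. (x, h) \<in> gcomposable G \<longrightarrow>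
        f (gmult G x h) = act S (ginv G h) (f x))}"

definition sec_add ::
    "'g groupoid \<Rightarrow> ('g, 'v) grep \<Rightarrow> ('g \<Rightarrow> 'v) \<Rightarrow> ('g \<Rightarrow> 'v) \<Rightarrow> 'g \<Rightarrow> 'v" where
  "sec_add G S f g = (\<lambda>x\<in>garr G. hadd (rfib S (gdom G x)) (f x) (g x))"

definition sec_scale ::
    "'g groupoid \<Rightarrow> ('g, 'v) grep \<Rightarrow> complex \<Rightarrow> ('g \<Rightarrow> 'v) \<Rightarrow> 'g \<Rightarrow> 'v" where
  "sec_scale G S a f = (\<lambda>x\<in>garr G. hscale (rfib S (gdom G x)) a (f x))"

text \<open>The integrand \<open>\<langle>f x, g x\<rangle>\<close> depends only on the coset of \<open>x\<close>, by equivariance of \<open>f\<close>, \<open>g\<close>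
  and unitarity of \<open>S\<close>; it is evaluated at an arbitrary representative.\<close>

definition ind_ip ::
    "'g groupoid \<Rightarrow> ('g \<Rightarrow> 'g set measure) \<Rightarrow> ('g, 'v) grep \<Rightarrow>
     ('g \<Rightarrow> 'v) \<Rightarrow> ('g \<Rightarrow> 'v) \<Rightarrow> 'g \<Rightarrow> complex" where
  "ind_ip G mu S f g u =
     (LINT A|mu u. (let x = some_elem A in hinner (rfib S (gdom G x)) (f x) (g x)))"

definition ind_norm ::
    "'g groupoid \<Rightarrow> ('g \<Rightarrow> 'g set measure) \<Rightarrow> ('g, 'v) grep \<Rightarrow> ('g \<Rightarrow> 'v) \<Rightarrow> real" where
  "ind_norm G mu S f = (SUP u\<in>gunits G. sqrt (Re (ind_ip G mu S f f u)))"

definition ind_dist ::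
    "'g groupoid \<Rightarrow> 'g set \<Rightarrow> ('g \<Rightarrow> 'g set measure) \<Rightarrow> ('g, 'v) grep \<Rightarrow>
     ('g \<Rightarrow> 'v) \<Rightarrow> ('g \<Rightarrow> 'v) \<Rightarrow> real" where
  "ind_dist G H mu S f g = (if f \<in> ind_F0 G H S \<and> g \<in> ind_F0 G H S
     then ind_norm G mu S (sec_add G S f (sec_scale G S (-1) g)) else 0)"

text \<open>The module \<open>\<F>\<^sup>\<sigma>(G, \<mu>)\<close>, with the operations extended from \<open>ind_F0\<close> by continuity.\<close>

definition ind_F ::
    "'g groupoid \<Rightarrow> 'g set \<Rightarrow> ('g \<Rightarrow> 'g set measure) \<Rightarrow> ('g, 'v) grep \<Rightarrow>
     (nat \<Rightarrow> 'g \<Rightarrow> 'v) set set" where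
  "ind_F G H mu S = metric_completion (ind_F0 G H S) (ind_dist G H mu S)"

definition ind_F_class ::
    "'g groupoid \<Rightarrow> 'g set \<Rightarrow> ('g \<Rightarrow> 'g set measure) \<Rightarrow> ('g, 'v) grep \<Rightarrow>
     (nat \<Rightarrow> 'g \<Rightarrow> 'v) \<Rightarrow> (nat \<Rightarrow> 'g \<Rightarrow> 'v) set" where
  "ind_F_class G H mu S s = cauchy_rel (ind_F0 G H S) (ind_dist G H mu S) `` {s}"

definition ind_F_add ::
    "'g groupoid \<Rightarrow> 'g set \<Rightarrow> ('g \<Rightarrow> 'g set measure) \<Rightarrow> ('g, 'v) grep \<Rightarrow>
     (nat \<Rightarrow> 'g \<Rightarrow> 'v) set \<Rightarrow> (nat \<Rightarrow> 'g \<Rightarrow> 'v) set \<Rightarrow> (nat \<Rightarrow> 'g \<Rightarrow> 'v) set" where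
  "ind_F_add G H mu S F F' =
     ind_F_class G H mu S (\<lambda>n. sec_add G S (some_elem F n) (some_elem F' n))"

definition ind_F_scale ::
    "'g groupoid \<Rightarrow> 'g set \<Rightarrow> ('g \<Rightarrow> 'g set measure) \<Rightarrow> ('g, 'v) grep \<Rightarrow>
     complex \<Rightarrow> (nat \<Rightarrow> 'g \<Rightarrow> 'v) set \<Rightarrow> (nat \<Rightarrow> 'g \<Rightarrow> 'v) set" where
  "ind_F_scale G H mu S a F = ind_F_class G H mu S (\<lambda>n. sec_scale G S a (some_elem F n))"

definition ind_F_ip ::
    "'g groupoid \<Rightarrow> ('g \<Rightarrow> 'g set measure) \<Rightarrow> ('g, 'v) grep \<Rightarrow>
     (nat \<Rightarrow> 'g \<Rightarrow> 'v) set \<Rightarrow> (nat \<Rightarrow> 'g \<Rightarrow> 'v) set \<Rightarrow> 'g \<Rightarrow> complex" where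
  "ind_F_ip G mu S F F' u = lim (\<lambda>n. ind_ip G mu S (some_elem F n) (some_elem F' n) u)"

definition ind_null ::
    "'g groupoid \<Rightarrow> 'g set \<Rightarrow> ('g \<Rightarrow> 'g set measure) \<Rightarrow> ('g, 'v) grep \<Rightarrow> 'g \<Rightarrow>
     (nat \<Rightarrow> 'g \<Rightarrow> 'v) set set" where
  "ind_null G H mu S u = {F \<in> ind_F G H mu S. ind_F_ip G mu S F F u = 0}"

text \<open>\<open>ind_t F u\<close> is the coset \<open>F + {F'. \<langle>F', F'\<rangle>(u) = 0}\<close>.\<close>

definition ind_t ::
    "'g groupoid \<Rightarrow> 'g set \<Rightarrow> ('g \<Rightarrow> 'g set measure) \<Rightarrow> ('g, 'v) grep \<Rightarrow>
     (nat \<Rightarrow> 'g \<Rightarrow> 'v) set \<Rightarrow> 'g \<Rightarrow> (nat \<Rightarrow> 'g \<Rightarrow> 'v) set set" where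
  "ind_t G H mu S F u = ind_F_add G H mu S F ` ind_null G H mu S u"

definition ind_fib ::
    "'g groupoid \<Rightarrow> 'g set \<Rightarrow> ('g \<Rightarrow> 'g set measure) \<Rightarrow> ('g, 'v) grep \<Rightarrow> 'g \<Rightarrow>
     (nat \<Rightarrow> 'g \<Rightarrow> 'v) set set hspace" where
  "ind_fib G H mu S u =
     \<lparr> hcar = (\<lambda>F. ind_t G H mu S F u) ` ind_F G H mu S,
       hzero = ind_null G H mu S u,
       hadd = (\<lambda>A B. ind_t G H mu S (ind_F_add G H mu S (some_elem A) (some_elem B)) u),
       hscale = (\<lambda>a A. ind_t G H mu S (ind_F_scale G H mu S a (some_elem A)) u),
       hinner = (\<lambda>A B. ind_F_ip G mu S (some_elem A) (some_elem B) u) \<rparr>"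

text \<open>The sections \<open>t\<^sub>F\<close> generate the continuous field: its space of sections is their closure
  under locally uniform approximation.\<close>

definition ind_bundle ::
    "'g groupoid \<Rightarrow> 'g set \<Rightarrow> ('g \<Rightarrow> 'g set measure) \<Rightarrow> ('g, 'v) grep \<Rightarrow>
     ('g, (nat \<Rightarrow> 'g \<Rightarrow> 'v) set set) hbundle" where
  "ind_bundle G H mu S =
     \<lparr> fib = ind_fib G H mu S,
       sec = loc_unif_closure (gunit_top G) (ind_fib G H mu S)
               {(\<lambda>u\<in>gunits G. ind_t G H mu S F u) | F. F \<in> ind_F G H mu S} \<rparr>"

text \<open>For \<open>A\<close> in the fibre at \<open>d(x)\<close> and \<open>B\<close> in the fibre at \<open>r(x)\<close>, each represented by a Cauchy
  sequence in \<open>ind_F0\<close>, \<open>ind_translates \<dots> x A B\<close> says that \<open>B\<close> is the class of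
  \<open>y \<mapsto> A(x\<^sup>-\<^sup>1 y)\<close> (\<open>y\<close> in the range fibre of \<open>r(x)\<close>): if \<open>s\<close> represents \<open>A\<close> and \<open>t\<close> represents \<open>B\<close>, then
  \<open>s n (x\<^sup>-\<^sup>1 y) - t n y\<close> tends to 0 in the norm given by \<open>\<mu>\<^bsup>r(x)\<^esup>\<close>.\<close>

definition ind_translates ::
    "'g groupoid \<Rightarrow> 'g set \<Rightarrow> ('g \<Rightarrow> 'g set measure) \<Rightarrow> ('g, 'v) grep \<Rightarrow> 'g \<Rightarrow>
     (nat \<Rightarrow> 'g \<Rightarrow> 'v) set set \<Rightarrow> (nat \<Rightarrow> 'g \<Rightarrow> 'v) set set \<Rightarrow> bool" where
  "ind_translates G H mu S x A B \<longleftrightarrow>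
     (\<exists>F\<in>A. \<exists>s\<in>F. \<exists>F'\<in>B. \<exists>t\<in>F'.
        (\<lambda>n. LINT C:coset_rng_fibre G H (grng G x)|mu (grng G x).
           (let y = some_elem C; V = rfib S (gdom G y)
            in (hnorm V (hdiff V (s n (gmult G (ginv G x) y)) (t n y)))\<^sup>2)) \<longlonglongrightarrow> 0)"

text \<open>\<open>ind_act\<close> is \<open>(L(x)f)(y) = f(x\<^sup>-\<^sup>1 y)\<close>, extended to the fibres \<open>\<F>\<^sup>u\<close>. Under the standing
  hypotheses (which make the restrictions of \<open>ind_F0\<close> to the range fibres translation invariant)
  the translate always exists and is unique; the zero vector is only a totalising default.\<close>

definition ind_act ::
    "'g groupoid \<Rightarrow> 'g set \<Rightarrow> ('g \<Rightarrow> 'g set measure) \<Rightarrow> ('g, 'v) grep \<Rightarrow> 'g \<Rightarrow>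
     (nat \<Rightarrow> 'g \<Rightarrow> 'v) set set \<Rightarrow> (nat \<Rightarrow> 'g \<Rightarrow> 'v) set set" where
  "ind_act G H mu S x A =
     (let V = ind_fib G H mu S (grng G x)
      in if \<exists>!B. B \<in> hcar V \<and> ind_translates G H mu S x A B
         then THE B. B \<in> hcar V \<and> ind_translates G H mu S x A B
         else hzero V)"

definition ind_rep ::
    "'g groupoid \<Rightarrow> 'g set \<Rightarrow> ('g \<Rightarrow> 'g set measure) \<Rightarrow> ('g, 'v) grep \<Rightarrow>
     ('g, (nat \<Rightarrow> 'g \<Rightarrow> 'v) set set) grep" where
  "ind_rep G H mu S = \<lparr> bun = ind_bundle G H mu S, act = ind_act G H mu S \<rparr>"

end

theory Submission
  imports Defs
begin

text \<open>Sending a vector \<open>v\<close> of a Hilbert space \<open>V\<close> to the functional \<open>f\<^sub>v = \<langle>\<cdot>, v\<rangle>\<close> is antiunitary, and composing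
  with its inverse turns antiunitary maps out of \<open>V\<close> into unitary maps out of the dual of \<open>V\<close>
  (\<open>antiunitary_imp_hunitary_hdual\<close>). So the theorem asks for antiunitary maps, one for each unit
  \<open>u\<close>, from the fibre of the bundle induced by \<open>\<sigma>\<close> to the fibre of the bundle induced by the conjugate
  of \<open>\<sigma>\<close>, that commute with translation and match the continuous sections.

  On the dense module \<open>\<F>\<^sub>0\<close> this map is \<open>(J f)(x) = f\<^bsub>f(x)\<^esub>\<close>. It is a conjugate-linear bijection, and
  integrating the pointwise identity over \<open>G/H\<close> gives \<open>\<langle>J f, J g\<rangle>(u)\<close> as the complex conjugate of
  \<open>\<langle>f, g\<rangle>(u)\<close> (\<open>conj_sec_antiunitary\<close>). Everything built afterwards is expressed by these inner
  products: the supremum norm, the completion, the fibres, the sections with their locally uniform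
  limits, and the translates, which are characterised by a limit of integrals of squared distances.
  Hence \<open>J\<close> passes through the whole construction.

  What needs proof is that the construction depends on its data only through those inner
  products. The operations on the completion and on its fibres use arbitrary representatives, and \<open>J\<close>
  need not send the chosen representative to the chosen one. They are independent of the choice as
  soon as \<open>\<F>\<^sub>0\<close> is, for every \<open>u\<close>, a semi-inner product space whose supremum norm is finite and
  separates points; the locale \<open>induced_module\<close> works from these properties alone. To establish them
  one needs that \<open>xH \<mapsto> \<langle>f(x), g(x)\<rangle>\<close> lies in \<open>C\<^sub>c(G/H)\<close> (\<open>coset_fun_Cc\<close>). Its support is compact
  because the image of the support of \<open>f\<close> in \<open>G/H\<close> is closed, which follows from the openness of
  right saturation by \<open>H\<close> and so from the openness of the range map of \<open>H\<close>, a consequence of the Haar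
  system of \<open>H\<close> (\<open>openin_grng_image\<close>). Finiteness of the norm is then continuity of the integrals
  against \<open>\<mu>\<^sup>u\<close> in \<open>u\<close>, and separation is the fullness of \<open>\<mu>\<close>.\<close>

section \<open>Semi-inner product spaces and antiunitary maps\<close>

text \<open>The fibres of \<open>\<sigma>\<close>, the module \<open>\<F>\<^sub>0\<close> at a unit, and the Cauchy sequences in it are all instances. Vector
  identities such as \<open>v - z = (v - w) + (w - z)\<close> are used in the form that the two sides have the
  same norm, which follows by expanding the sesquilinear form.\<close>

definition semi_inner_space :: "'v hspace \<Rightarrow> bool" where
  "semi_inner_space V \<longleftrightarrow>
     (\<forall>v\<in>hcar V. \<forall>w\<in>hcar V. hadd V v w \<in> hcar V) \<and>
     (\<forall>a. \<forall>v\<in>hcar V. hscale V a v \<in> hcar V) \<and>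
     (\<forall>v\<in>hcar V. \<forall>w\<in>hcar V. \<forall>z\<in>hcar V.
        hinner V (hadd V v w) z = hinner V v z + hinner V w z) \<and>
     (\<forall>a. \<forall>v\<in>hcar V. \<forall>w\<in>hcar V. hinner V (hscale V a v) w = a * hinner V v w) \<and>
     (\<forall>v\<in>hcar V. \<forall>w\<in>hcar V. hinner V v w = cnj (hinner V w v)) \<and>
     (\<forall>v\<in>hcar V. 0 \<le> Re (hinner V v v))"

definition inner_space :: "'v hspace \<Rightarrow> bool" where
  "inner_space V \<longleftrightarrow> semi_inner_space V \<and>
     (\<forall>v\<in>hcar V. \<forall>w\<in>hcar V. hinner V (hdiff V v w) (hdiff V v w) = 0 \<longrightarrow> v = w)"

lemma semi_inner_spaceD:
  assumes "semi_inner_space V"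
  shows "v \<in> hcar V \<Longrightarrow> w \<in> hcar V \<Longrightarrow> hadd V v w \<in> hcar V"
    and "v \<in> hcar V \<Longrightarrow> hscale V a v \<in> hcar V"
    and "v \<in> hcar V \<Longrightarrow> w \<in> hcar V \<Longrightarrow> z \<in> hcar V \<Longrightarrow>
           hinner V (hadd V v w) z = hinner V v z + hinner V w z"
    and "v \<in> hcar V \<Longrightarrow> w \<in> hcar V \<Longrightarrow> hinner V (hscale V a v) w = a * hinner V v w"
    and "v \<in> hcar V \<Longrightarrow> w \<in> hcar V \<Longrightarrow> hinner V v w = cnj (hinner V w v)"
    and "v \<in> hcar V \<Longrightarrow> 0 \<le> Re (hinner V v v)"
  using assms unfolding semi_inner_space_def by blast+

context
  fixes V :: "'v hspace"
  assumes V: "semi_inner_space V"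
begin

lemmas V_D = semi_inner_spaceD[OF V]

lemma hinner_hadd_right:
  assumes "v \<in> hcar V" "w \<in> hcar V" "z \<in> hcar V"
  shows "hinner V v (hadd V w z) = hinner V v w + hinner V v z"
  using assms V_D by (metis complex_cnj_add)

lemma hinner_hscale_right:
  assumes "v \<in> hcar V" "w \<in> hcar V"
  shows "hinner V v (hscale V a w) = cnj a * hinner V v w"
  using assms V_D by (metis complex_cnj_mult)

lemma hdiff_in_hcar: "v \<in> hcar V \<Longrightarrow> w \<in> hcar V \<Longrightarrow> hdiff V v w \<in> hcar V"
  by (simp add: hdiff_def V_D)

lemma hinner_hdiff_left:
  "v \<in> hcar V \<Longrightarrow> w \<in> hcar V \<Longrightarrow> z \<in> hcar V \<Longrightarrow>
     hinner V (hdiff V v w) z = hinner V v z - hinner V w z"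
  by (simp add: hdiff_def V_D(1-4))

lemma hinner_hdiff_right:
  "v \<in> hcar V \<Longrightarrow> w \<in> hcar V \<Longrightarrow> z \<in> hcar V \<Longrightarrow>
     hinner V v (hdiff V w z) = hinner V v w - hinner V v z"
  by (simp add: hdiff_def V_D(1-4) hinner_hadd_right hinner_hscale_right)

lemmas semi_inner_expand =
  V_D(1-4) hinner_hadd_right hinner_hscale_right hdiff_in_hcar
  hinner_hdiff_left hinner_hdiff_right

lemma hinner_self: "v \<in> hcar V \<Longrightarrow> hinner V v v = complex_of_real ((hnorm V v)\<^sup>2)"
proof -
  assume v: "v \<in> hcar V"
  have "hinner V v v = cnj (hinner V v v)" using V_D(5)[OF v v] .
  then have "Im (hinner V v v) = 0" by (simp add: complex_eq_iff)
  then show ?thesis using V_D(6)[OF v] by (simp add: hnorm_def complex_eq_iff)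
qed

lemma hnorm_nonneg: "v \<in> hcar V \<Longrightarrow> 0 \<le> hnorm V v"
  by (simp add: hnorm_def V_D(6))

lemma hnorm_eq_0_iff: "v \<in> hcar V \<Longrightarrow> hnorm V v = 0 \<longleftrightarrow> hinner V v v = 0"
  by (simp add: hinner_self)

text \<open>Without definiteness the case \<open>\<parallel>w\<parallel> = 0\<close> is separate. The form is nonnegative at
  \<open>v - t \<langle>v, w\<rangle> w\<close> for real \<open>t\<close>: take \<open>t = \<parallel>w\<parallel>\<^sup>-\<^sup>2\<close>, and for \<open>\<parallel>w\<parallel> = 0\<close> a \<open>t\<close> so large that
  \<open>\<langle>v, w\<rangle> \<noteq> 0\<close> would make the value negative.\<close>

lemma hinner_Cauchy_Schwarz:
  assumes v: "v \<in> hcar V" and w: "w \<in> hcar V"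
  shows "cmod (hinner V v w) \<le> hnorm V v * hnorm V w"
proof -
  define c where "c = hinner V v w"
  define A where "A = (hnorm V v)\<^sup>2"
  define B where "B = (hnorm V w)\<^sup>2"
  have wv: "hinner V w v = cnj c" using V_D(5) v w c_def by blast
  have quad: "0 \<le> A - 2 * t * (cmod c)\<^sup>2 + t\<^sup>2 * (cmod c)\<^sup>2 * B" for t :: real
  proof -
    let ?z = "hdiff V v (hscale V (of_real t * c) w)"
    have "hinner V ?z ?z = of_real A - of_real t * cnj c * c - of_real t * c * cnj c
        + of_real t * c * (of_real t * cnj c) * of_real B"
      using v w by (simp add: semi_inner_expand wv c_def[symmetric] hinner_self[OF v, folded A_def]
          hinner_self[OF w, folded B_def] algebra_simps)
    also have "\<dots> = of_real A - 2 * of_real t * (c * cnj c) + (of_real t)\<^sup>2 * (c * cnj c) * of_real B"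
      by (simp add: power2_eq_square algebra_simps)
    also have "\<dots> = of_real (A - 2 * t * (cmod c)\<^sup>2 + t\<^sup>2 * (cmod c)\<^sup>2 * B)"
      by (simp flip: complex_norm_square)
    finally have "Re (hinner V ?z ?z) = A - 2 * t * (cmod c)\<^sup>2 + t\<^sup>2 * (cmod c)\<^sup>2 * B"
      by simp
    moreover have "?z \<in> hcar V" using v w by (simp add: hdiff_in_hcar V_D(2))
    ultimately show ?thesis using V_D(6)[of ?z] by simp
  qed
  have "(cmod c)\<^sup>2 \<le> A * B"
  proof (cases "B = 0")
    case False
    then have B: "B > 0" by (simp add: B_def)
    have "0 \<le> A - 2 * (1/B) * (cmod c)\<^sup>2 + (1/B)\<^sup>2 * (cmod c)\<^sup>2 * B" by (rule quad)
    also have "\<dots> = A - (cmod c)\<^sup>2 / B" using B by (simp add: power2_eq_square field_simps)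
    finally show ?thesis using B by (simp add: field_simps)
  next
    case True
    show ?thesis
    proof (rule ccontr)
      assume "\<not> ?thesis"
      then have c: "(cmod c)\<^sup>2 > 0" using True by simp
      have "0 \<le> A - 2 * ((A + 1) / (cmod c)\<^sup>2) * (cmod c)\<^sup>2" using quad[of "(A+1)/(cmod c)\<^sup>2"] True by simp
      then have "0 \<le> A - 2 * (A + 1)" using c by simp
      moreover have "A \<ge> 0" by (simp add: A_def)
      ultimately show False by simp
    qed
  qed
  then have "(cmod c)\<^sup>2 \<le> (hnorm V v * hnorm V w)\<^sup>2"
    by (simp add: A_def B_def power_mult_distrib)
  then show ?thesis
    unfolding c_def by (rule power2_le_imp_le) (simp add: hnorm_nonneg v w)
qed

lemma hnorm_hadd_le:
  assumes v: "v \<in> hcar V" and w: "w \<in> hcar V"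
  shows "hnorm V (hadd V v w) \<le> hnorm V v + hnorm V w"
proof -
  have wv: "hinner V w v = cnj (hinner V v w)" using V_D(5) v w by blast
  have "(hnorm V (hadd V v w))\<^sup>2 = Re (hinner V (hadd V v w) (hadd V v w))"
    using v w by (simp add: hinner_self V_D(1))
  also have "\<dots> = (hnorm V v)\<^sup>2 + 2 * Re (hinner V v w) + (hnorm V w)\<^sup>2"
    using v w by (simp add: semi_inner_expand wv hinner_self[OF v] hinner_self[OF w])
  also have "\<dots> \<le> (hnorm V v)\<^sup>2 + 2 * (hnorm V v * hnorm V w) + (hnorm V w)\<^sup>2"
    using hinner_Cauchy_Schwarz[OF v w] complex_Re_le_cmod[of "hinner V v w"] by simp
  also have "\<dots> = (hnorm V v + hnorm V w)\<^sup>2" by (simp add: power2_sum)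
  finally show ?thesis
    by (rule power2_le_imp_le) (simp add: hnorm_nonneg v w)
qed

lemma hnorm_hscale: "v \<in> hcar V \<Longrightarrow> hnorm V (hscale V a v) = cmod a * hnorm V v"
proof -
  assume v: "v \<in> hcar V"
  have "hinner V (hscale V a v) (hscale V a v) = (a * cnj a) * hinner V v v"
    using v by (simp add: semi_inner_expand)
  also have "\<dots> = complex_of_real ((cmod a * hnorm V v)\<^sup>2)"
    using v by (simp add: complex_norm_square hinner_self power_mult_distrib flip: of_real_power)
  finally show ?thesis using v by (simp add: hnorm_def[of V "hscale V a v"] hnorm_nonneg)
qed

lemma hnorm_eqI:
  assumes "v \<in> hcar V" "w \<in> hcar V" "hinner V v v = hinner V w w"
  shows "hnorm V v = hnorm V w"
  using assms by (simp add: hnorm_def)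

lemma hnorm_hdiff_triangle:
  assumes "v \<in> hcar V" "w \<in> hcar V" "z \<in> hcar V"
  shows "hnorm V (hdiff V v z) \<le> hnorm V (hdiff V v w) + hnorm V (hdiff V w z)"
proof -
  have "hnorm V (hdiff V v z) = hnorm V (hadd V (hdiff V v w) (hdiff V w z))"
    by (rule hnorm_eqI) (use assms in \<open>simp_all add: semi_inner_expand algebra_simps\<close>)
  then show ?thesis using hnorm_hadd_le assms by (simp add: hdiff_in_hcar)
qed

lemma hnorm_hdiff_commute:
  assumes "v \<in> hcar V" "w \<in> hcar V"
  shows "hnorm V (hdiff V v w) = hnorm V (hdiff V w v)"
  by (rule hnorm_eqI) (use assms in \<open>simp_all add: semi_inner_expand algebra_simps\<close>)

lemma hnorm_hdiff_self: "v \<in> hcar V \<Longrightarrow> hnorm V (hdiff V v v) = 0"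
  by (simp add: hnorm_def semi_inner_expand)

lemma hnorm_le_hdiff:
  assumes "v \<in> hcar V" "w \<in> hcar V"
  shows "hnorm V v \<le> hnorm V w + hnorm V (hdiff V v w)"
proof -
  have "hnorm V v = hnorm V (hadd V w (hdiff V v w))"
    by (rule hnorm_eqI) (use assms in \<open>simp_all add: semi_inner_expand algebra_simps\<close>)
  then show ?thesis using hnorm_hadd_le assms by (simp add: hdiff_in_hcar)
qed

lemma hnorm_hdiff_hadd_le:
  assumes "v \<in> hcar V" "w \<in> hcar V" "v' \<in> hcar V" "w' \<in> hcar V"
  shows "hnorm V (hdiff V (hadd V v w) (hadd V v' w')) \<le> hnorm V (hdiff V v v') + hnorm V (hdiff V w w')"
proof -
  have "hnorm V (hdiff V (hadd V v w) (hadd V v' w')) = hnorm V (hadd V (hdiff V v v') (hdiff V w w'))"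
    by (rule hnorm_eqI) (use assms in \<open>simp_all add: semi_inner_expand algebra_simps\<close>)
  then show ?thesis using hnorm_hadd_le assms by (simp add: hdiff_in_hcar)
qed

lemma hnorm_hdiff_hscale:
  assumes "v \<in> hcar V" "w \<in> hcar V"
  shows "hnorm V (hdiff V (hscale V a v) (hscale V a w)) = cmod a * hnorm V (hdiff V v w)"
proof -
  have "hnorm V (hdiff V (hscale V a v) (hscale V a w)) = hnorm V (hscale V a (hdiff V v w))"
    by (rule hnorm_eqI) (use assms in \<open>simp_all add: semi_inner_expand algebra_simps\<close>)
  then show ?thesis using hnorm_hscale assms by (simp add: hdiff_in_hcar)
qed

lemma hinner_diff_le:
  assumes "v \<in> hcar V" "w \<in> hcar V" "v' \<in> hcar V" "w' \<in> hcar V"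
  shows "cmod (hinner V v w - hinner V v' w')
    \<le> hnorm V (hdiff V v v') * hnorm V w + hnorm V v' * hnorm V (hdiff V w w')"
proof -
  have "hinner V v w - hinner V v' w' = hinner V (hdiff V v v') w + hinner V v' (hdiff V w w')"
    using assms by (simp add: semi_inner_expand)
  also have "cmod \<dots> \<le> cmod (hinner V (hdiff V v v') w) + cmod (hinner V v' (hdiff V w w'))"
    by (rule norm_triangle_ineq)
  also have "\<dots> \<le> hnorm V (hdiff V v v') * hnorm V w + hnorm V v' * hnorm V (hdiff V w w')"
    by (intro add_mono hinner_Cauchy_Schwarz) (use assms in \<open>simp_all add: hdiff_in_hcar\<close>)
  finally show ?thesis .
qed

end

lemma hilbert_space_imp_semi_inner:
  assumes "hilbert_space V" shows "semi_inner_space V"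
  using assms
  unfolding hilbert_space_def complex_vector_space_def semi_inner_space_def ball_conj_distrib
  by (elim conjE, intro conjI) assumption+

lemma hilbert_space_hdiff_eq_zero:
  assumes V: "hilbert_space V" and v: "v \<in> hcar V" and w: "w \<in> hcar V"
    and "hdiff V v w = hzero V"
  shows "v = w"
proof -
  let ?n = "hscale V (-1) w" and ?z = "hzero V"
  have cvs: "complex_vector_space V" using V by (simp add: hilbert_space_def)
  then have n: "?n \<in> hcar V" and z: "?z \<in> hcar V"
    and comm: "\<And>a b. a \<in> hcar V \<Longrightarrow> b \<in> hcar V \<Longrightarrow> hadd V a b = hadd V b a"
    and assoc: "\<And>a b c. a \<in> hcar V \<Longrightarrow> b \<in> hcar V \<Longrightarrow> c \<in> hcar V \<Longrightarrow>
      hadd V (hadd V a b) c = hadd V a (hadd V b c)"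
    and zero: "\<And>a. a \<in> hcar V \<Longrightarrow> hadd V a ?z = a"
    and neg: "hadd V w ?n = ?z"
    using w unfolding complex_vector_space_def hdiff_def by blast+
  have "v = hadd V v (hadd V ?n w)" using zero[OF v] neg comm[OF w n] by simp
  also have "\<dots> = hadd V (hadd V v ?n) w" using assoc[OF v n w] by simp
  also have "hadd V v ?n = ?z" using assms(4) by (simp add: hdiff_def)
  also have "hadd V ?z w = w" using zero[OF w] comm[OF z w] by simp
  finally show ?thesis .
qed

lemma hilbert_space_imp_inner_space:
  assumes V: "hilbert_space V" shows "inner_space V"
  unfolding inner_space_def
proof (intro conjI ballI impI)
  show S: "semi_inner_space V" by (rule hilbert_space_imp_semi_inner[OF V])
  fix v w assume v: "v \<in> hcar V" and w: "w \<in> hcar V" and "hinner V (hdiff V v w) (hdiff V v w) = 0"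
  moreover have "\<forall>v\<in>hcar V. hinner V v v = 0 \<longrightarrow> v = hzero V"
    using V unfolding hilbert_space_def by blast
  ultimately have "hdiff V v w = hzero V" using hdiff_in_hcar[OF S v w] by simp
  then show "v = w" by (rule hilbert_space_hdiff_eq_zero[OF V v w])
qed

lemma hilbert_space_hzero:
  assumes V: "hilbert_space V"
  shows "hzero V \<in> hcar V" and "hnorm V (hzero V) = 0"
    and "w \<in> hcar V \<Longrightarrow> hinner V w (hzero V) = 0"
    and "w \<in> hcar V \<Longrightarrow> hdiff V w (hzero V) = w"
proof -
  note S = hilbert_space_imp_semi_inner[OF V]
  have cvs: "complex_vector_space V" using V by (simp add: hilbert_space_def)
  show z: "hzero V \<in> hcar V" using cvs by (simp add: complex_vector_space_def)
  have "hzero V = hdiff V (hzero V) (hzero V)" using cvs z by (simp add: complex_vector_space_def)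
  then show "hnorm V (hzero V) = 0" using hnorm_hdiff_self[OF S z] by simp
  show w0: "hinner V w (hzero V) = 0" if "w \<in> hcar V" for w
    using hinner_Cauchy_Schwarz[OF S that z] \<open>hnorm V (hzero V) = 0\<close> by simp
  show "hdiff V w (hzero V) = w" if w: "w \<in> hcar V"
  proof (rule conjunct2[OF hilbert_space_imp_inner_space[OF V, unfolded inner_space_def], rule_format])
    show "hdiff V w (hzero V) \<in> hcar V" "w \<in> hcar V" using w z S by (simp_all add: hdiff_in_hcar)
    show "hinner V (hdiff V (hdiff V w (hzero V)) w) (hdiff V (hdiff V w (hzero V)) w) = 0"
      using w z w0 semi_inner_spaceD(5)[OF S z w] w0[OF w] w0[OF z] by (simp add: semi_inner_expand[OF S])
  qed
qed

definition antiunitary :: "'v hspace \<Rightarrow> 'w hspace \<Rightarrow> ('v \<Rightarrow> 'w) \<Rightarrow> bool" where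
  "antiunitary V W J \<longleftrightarrow> bij_betw J (hcar V) (hcar W) \<and>
     (\<forall>v\<in>hcar V. \<forall>w\<in>hcar V. J (hadd V v w) = hadd W (J v) (J w)) \<and>
     (\<forall>a. \<forall>v\<in>hcar V. J (hscale V a v) = hscale W (cnj a) (J v)) \<and>
     (\<forall>v\<in>hcar V. \<forall>w\<in>hcar V. hinner W (J v) (J w) = cnj (hinner V v w))"

lemma antiunitaryD:
  assumes "antiunitary V W J"
  shows "bij_betw J (hcar V) (hcar W)"
    and "J ` hcar V = hcar W"
    and "inj_on J (hcar V)"
    and "v \<in> hcar V \<Longrightarrow> J v \<in> hcar W"
    and "v \<in> hcar V \<Longrightarrow> w \<in> hcar V \<Longrightarrow> J (hadd V v w) = hadd W (J v) (J w)"
    and "v \<in> hcar V \<Longrightarrow> J (hscale V a v) = hscale W (cnj a) (J v)"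
    and "v \<in> hcar V \<Longrightarrow> w \<in> hcar V \<Longrightarrow> hinner W (J v) (J w) = cnj (hinner V v w)"
  using assms unfolding antiunitary_def bij_betw_def by auto

text \<open>This lets the module of the conjugate representation inherit its properties from that of \<open>\<sigma>\<close>.\<close>

lemma antiunitary_semi_inner_space:
  assumes J: "antiunitary V W J" and V: "semi_inner_space V"
  shows "semi_inner_space W"
proof -
  note JD = antiunitaryD[OF J]
  have sc: "hscale W a (J v) = J (hscale V (cnj a) v)" if "v \<in> hcar V" for a v
    using JD(6)[OF that, of "cnj a"] by simp
  have ad: "hadd W (J v) (J w) = J (hadd V v w)" if "v \<in> hcar V" "w \<in> hcar V" for v w
    using JD(5)[OF that] by simp
  have herm: "hinner V v w = cnj (hinner V w v)" if "v \<in> hcar V" "w \<in> hcar V" for v w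
    using semi_inner_spaceD(5)[OF V that] .
  have "hinner W (J v) (J w) = cnj (hinner W (J w) (J v))" if "v \<in> hcar V" "w \<in> hcar V" for v w
    using arg_cong[OF herm[OF that], of cnj] that by (simp add: JD(7))
  note herm' = this
  show ?thesis
    unfolding semi_inner_space_def JD(2)[symmetric] ball_simps
    by (intro conjI ballI allI)
      (rule herm', assumption, assumption |
       simp add: sc ad JD(7) semi_inner_expand[OF V] semi_inner_spaceD(6)[OF V])+
qed

lemma antiunitary_hdiff:
  assumes J: "antiunitary V W J" and V: "semi_inner_space V"
    and "v \<in> hcar V" "w \<in> hcar V"
  shows "J (hdiff V v w) = hdiff W (J v) (J w)"
  using assms by (simp add: hdiff_def antiunitaryD[OF J] semi_inner_spaceD[OF V])

lemma antiunitary_hnorm: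
  assumes J: "antiunitary V W J" and "v \<in> hcar V"
  shows "hnorm W (J v) = hnorm V v"
  using assms by (simp add: hnorm_def antiunitaryD[OF J])

lemma antiunitary_hnorm_hdiff:
  assumes J: "antiunitary V W J" and V: "semi_inner_space V"
    and "v \<in> hcar V" "w \<in> hcar V"
  shows "hnorm W (hdiff W (J v) (J w)) = hnorm V (hdiff V v w)"
  using assms by (simp add: antiunitary_hnorm[OF J] hdiff_in_hcar flip: antiunitary_hdiff[OF J V])

lemma inner_space_hfun_inj:
  assumes V: "inner_space V" shows "inj_on (hfun V) (hcar V)"
proof (rule inj_onI)
  have S: "semi_inner_space V" using V by (simp add: inner_space_def)
  fix v w assume v: "v \<in> hcar V" and w: "w \<in> hcar V" and eq: "hfun V v = hfun V w"
  have "hinner V z v = hinner V z w" if "z \<in> hcar V" for z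
    using fun_cong[OF eq, of z] that by (simp add: hfun_def)
  then have "hinner V (hdiff V v w) (hdiff V v w) = 0"
    using v w S by (simp add: semi_inner_expand)
  then show "v = w" using V v w by (simp add: inner_space_def)
qed

lemma hriesz_hfun:
  assumes V: "inner_space V" and v: "v \<in> hcar V"
  shows "hriesz V (hfun V v) = v"
  unfolding hriesz_def
  using inner_space_hfun_inj[OF V] v by (intro the_equality) (auto dest: inj_onD)

text \<open>The Riesz map \<open>v \<mapsto> \<langle>\<cdot>, v\<rangle>\<close> onto the dual is the model antiunitary map.\<close>

lemma antiunitary_hfun:
  assumes V: "inner_space V" shows "antiunitary V (hdual V) (hfun V)"
  unfolding antiunitary_def
proof (intro conjI ballI allI)
  have S: "semi_inner_space V" using V by (simp add: inner_space_def)
  show "bij_betw (hfun V) (hcar V) (hcar (hdual V))"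
    using inner_space_hfun_inj[OF V] by (simp add: bij_betw_def hdual_def)
  fix v assume v: "v \<in> hcar V"
  show "hfun V (hscale V a v) = hscale (hdual V) (cnj a) (hfun V v)" for a
    using v by (auto simp: hfun_def hdual_def semi_inner_expand[OF S] fun_eq_iff)
  fix w assume w: "w \<in> hcar V"
  show "hfun V (hadd V v w) = hadd (hdual V) (hfun V v) (hfun V w)"
    using v w by (auto simp: hfun_def hdual_def semi_inner_expand[OF S] fun_eq_iff)
  show "hinner (hdual V) (hfun V v) (hfun V w) = cnj (hinner V v w)"
    using v w by (simp add: hdual_def hriesz_hfun[OF V])
qed

text \<open>An antiunitary map out of \<open>V\<close> is the same thing as a unitary map out of the dual of \<open>V\<close>;
  this turns every antiunitary below into the unitary that the theorem asks for.\<close>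

lemma antiunitary_imp_hunitary_hdual:
  assumes V: "inner_space V" and J: "antiunitary V W J"
  shows "hunitary (hdual V) W (J \<circ> hriesz V)"
proof -
  note R = antiunitaryD[OF antiunitary_hfun[OF V]] and JD = antiunitaryD[OF J]
  have S: "semi_inner_space V" using V by (simp add: inner_space_def)
  have JR: "(J \<circ> hriesz V) (hfun V v) = J v" if "v \<in> hcar V" for v
    using that by (simp add: hriesz_hfun[OF V])
  have sc: "hscale (hdual V) a (hfun V v) = hfun V (hscale V (cnj a) v)" if "v \<in> hcar V" for a v
    using R(6)[OF that, of "cnj a"] by simp
  have ad: "hadd (hdual V) (hfun V v) (hfun V w) = hfun V (hadd V v w)"
    if "v \<in> hcar V" "w \<in> hcar V" for v w
    using R(5)[OF that] by simp
  have "bij_betw (J \<circ> hriesz V) (hcar (hdual V)) (hcar W)"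
  proof (rule bij_betw_trans[OF _ JD(1)])
    show "bij_betw (hriesz V) (hcar (hdual V)) (hcar V)"
      by (rule bij_betw_byWitness[where f' = "hfun V"])
         (auto simp: R(2)[symmetric] hriesz_hfun[OF V])
  qed
  moreover have "hlinear (hdual V) W (J \<circ> hriesz V)"
    unfolding hlinear_def R(2)[symmetric]
    by (auto simp: sc ad hriesz_hfun[OF V] semi_inner_spaceD[OF S] JD)
  moreover have "hinner W ((J \<circ> hriesz V) \<phi>) ((J \<circ> hriesz V) \<psi>) = hinner (hdual V) \<phi> \<psi>"
    if "\<phi> \<in> hcar (hdual V)" "\<psi> \<in> hcar (hdual V)" for \<phi> \<psi>
    using that unfolding R(2)[symmetric] by (auto simp: hriesz_hfun[OF V] JD R(7))
  ultimately show ?thesis unfolding hunitary_def by blast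
qed

lemma hfun_eq_hzero_iff:
  assumes V: "hilbert_space V" and v: "v \<in> hcar V"
  shows "hfun V v = hzero (hdual V) \<longleftrightarrow> v = hzero V"
proof -
  have "hzero (hdual V) = hfun V (hzero V)"
    by (auto simp: hdual_def hfun_def hilbert_space_hzero[OF V] fun_eq_iff)
  then show ?thesis
    using inner_space_hfun_inj[OF hilbert_space_imp_inner_space[OF V]] v hilbert_space_hzero(1)[OF V]
    by (metis inj_onD)
qed

section \<open>The completed module and its fibres\<close>

text \<open>The module \<open>\<F>\<^sub>0\<close> and the Cauchy sequences in it, each with the form at the unit \<open>u\<close>. The fibre at
  \<open>u\<close> will be the quotient of the second by its null vectors.\<close>

definition ind_F0_space ::
    "'g groupoid \<Rightarrow> 'g set \<Rightarrow> ('g \<Rightarrow> 'g set measure) \<Rightarrow> ('g, 'v) grep \<Rightarrow> 'g \<Rightarrow>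
     ('g \<Rightarrow> 'v) hspace" where
  "ind_F0_space G H mu S u =
     \<lparr> hcar = ind_F0 G H S,
       hzero = (\<lambda>x\<in>garr G. hzero (rfib S (gdom G x))),
       hadd = sec_add G S,
       hscale = sec_scale G S,
       hinner = (\<lambda>f g. ind_ip G mu S f g u) \<rparr>"

definition cauchy_seqs ::
    "'g groupoid \<Rightarrow> 'g set \<Rightarrow> ('g \<Rightarrow> 'g set measure) \<Rightarrow> ('g, 'v) grep \<Rightarrow>
     (nat \<Rightarrow> 'g \<Rightarrow> 'v) set" where
  "cauchy_seqs G H mu S = {s. Metric_space.MCauchy (ind_F0 G H S) (ind_dist G H mu S) s}"

definition cauchy_space ::
    "'g groupoid \<Rightarrow> 'g set \<Rightarrow> ('g \<Rightarrow> 'g set measure) \<Rightarrow> ('g, 'v) grep \<Rightarrow> 'g \<Rightarrow>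
     (nat \<Rightarrow> 'g \<Rightarrow> 'v) hspace" where
  "cauchy_space G H mu S u =
     \<lparr> hcar = cauchy_seqs G H mu S,
       hzero = (\<lambda>n. \<lambda>x\<in>garr G. hzero (rfib S (gdom G x))),
       hadd = (\<lambda>s t n. sec_add G S (s n) (t n)),
       hscale = (\<lambda>a s n. sec_scale G S a (s n)),
       hinner = (\<lambda>s t. lim (\<lambda>n. ind_ip G mu S (s n) (t n) u)) \<rparr>"

text \<open>What the completion, its fibres and their operations need in order to be independent of the
  representatives by which they are defined.\<close>

locale induced_module =
  fixes G :: "'g groupoid" and H :: "'g set" and mu :: "'g \<Rightarrow> 'g set measure"
    and S :: "('g, 'v) grep"
  assumes units_nonempty: "gunits G \<noteq> {}"
    and F0_nonempty: "ind_F0 G H S \<noteq> {}"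
    and F0_semi_inner: "u \<in> gunits G \<Longrightarrow> semi_inner_space (ind_F0_space G H mu S u)"
    and F0_bounded: "f \<in> ind_F0 G H S \<Longrightarrow>
      \<exists>B. \<forall>u\<in>gunits G. hnorm (ind_F0_space G H mu S u) f \<le> B"
    and F0_separated: "f \<in> ind_F0 G H S \<Longrightarrow> g \<in> ind_F0 G H S \<Longrightarrow>
      (\<And>u. u \<in> gunits G \<Longrightarrow>
         hnorm (ind_F0_space G H mu S u) (hdiff (ind_F0_space G H mu S u) f g) = 0) \<Longrightarrow> f = g"
begin

abbreviation "F0 \<equiv> ind_F0 G H S"
abbreviation "d \<equiv> ind_dist G H mu S"
abbreviation "padd \<equiv> sec_add G S"
abbreviation "pscale \<equiv> sec_scale G S"
abbreviation "V0 \<equiv> ind_F0_space G H mu S"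
abbreviation "C \<equiv> cauchy_space G H mu S"
abbreviation "ip \<equiv> ind_ip G mu S"
abbreviation "V \<equiv> ind_fib G H mu S"
abbreviation "dC u s t \<equiv> hnorm (C u) (hdiff (C u) s t)"
abbreviation "Cs \<equiv> cauchy_seqs G H mu S"
abbreviation "cls \<equiv> ind_F_class G H mu S"
abbreviation "pt u s \<equiv> ind_t G H mu S (cls s) u"

lemma V0_simps [simp]:
  "hcar (V0 u) = F0" "hadd (V0 u) = padd" "hscale (V0 u) = pscale"
  "hinner (V0 u) f g = ip f g u"
  by (simp_all add: ind_F0_space_def)

lemma C_simps [simp]:
  "hcar (C u) = Cs" "hadd (C u) = (\<lambda>s t n. padd (s n) (t n))"
  "hscale (C u) = (\<lambda>a s n. pscale a (s n))"
  by (simp_all add: cauchy_space_def)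

abbreviation "nu u \<equiv> hnorm (V0 u)"
abbreviation "dif \<equiv> (\<lambda>f g. padd f (pscale (-1) g))"

lemma hdiff_V0 [simp]: "hdiff (V0 u) f g = dif f g"
  by (simp add: hdiff_def)

lemma add_F0: "f \<in> F0 \<Longrightarrow> g \<in> F0 \<Longrightarrow> padd f g \<in> F0"
  and scale_F0: "f \<in> F0 \<Longrightarrow> pscale a f \<in> F0"
proof -
  obtain u where u: "u \<in> gunits G" using units_nonempty by blast
  show "f \<in> F0 \<Longrightarrow> g \<in> F0 \<Longrightarrow> padd f g \<in> F0" "f \<in> F0 \<Longrightarrow> pscale a f \<in> F0"
    using semi_inner_spaceD(1,2)[OF F0_semi_inner[OF u]] by simp_all
qed

lemma d_eq_SUP:
  assumes "f \<in> F0" "g \<in> F0"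
  shows "d f g = (SUP u\<in>gunits G. nu u (dif f g))"
  using assms by (simp add: ind_dist_def ind_norm_def hnorm_def)

lemma nu_le_d:
  assumes "f \<in> F0" "g \<in> F0" "u \<in> gunits G"
  shows "nu u (dif f g) \<le> d f g"
proof -
  obtain B where "\<forall>u\<in>gunits G. nu u (dif f g) \<le> B"
    using F0_bounded[of "dif f g"] assms add_F0 scale_F0 by blast
  then have "bdd_above ((\<lambda>u. nu u (dif f g)) ` gunits G)" by (auto intro!: bdd_aboveI)
  then show ?thesis unfolding d_eq_SUP[OF assms(1,2)] by (rule cSUP_upper[OF assms(3)])
qed

lemma d_le:
  assumes "f \<in> F0" "g \<in> F0" and "\<And>u. u \<in> gunits G \<Longrightarrow> nu u (dif f g) \<le> c"
  shows "d f g \<le> c"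
  unfolding d_eq_SUP[OF assms(1,2)] using units_nonempty assms(3) by (rule cSUP_least)

lemma nu_nonneg: "u \<in> gunits G \<Longrightarrow> f \<in> F0 \<Longrightarrow> 0 \<le> nu u f"
  using hnorm_nonneg[OF F0_semi_inner] by simp

lemma d_nonneg: "0 \<le> d f g"
proof (cases "f \<in> F0 \<and> g \<in> F0")
  case True
  obtain u where u: "u \<in> gunits G" using units_nonempty by blast
  then have "0 \<le> nu u (dif f g)" using True by (simp add: nu_nonneg add_F0 scale_F0)
  also have "\<dots> \<le> d f g" using True u by (simp add: nu_le_d)
  finally show ?thesis .
qed (auto simp: ind_dist_def)

lemma d_commute: "d f g = d g f"
proof (cases "f \<in> F0 \<and> g \<in> F0")
  case True
  have "nu u (dif f g) = nu u (dif g f)" if "u \<in> gunits G" for u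
    using hnorm_hdiff_commute[OF F0_semi_inner[OF that], of f g] True by simp
  then show ?thesis using True by (simp add: d_eq_SUP)
qed (auto simp: ind_dist_def)

lemma d_triangle:
  assumes "f \<in> F0" "g \<in> F0" "h \<in> F0"
  shows "d f h \<le> d f g + d g h"
proof (rule d_le[OF assms(1,3)])
  fix u assume u: "u \<in> gunits G"
  have "nu u (dif f h) \<le> nu u (dif f g) + nu u (dif g h)"
    using hnorm_hdiff_triangle[OF F0_semi_inner[OF u], of f g h] assms by simp
  then show "nu u (dif f h) \<le> d f g + d g h"
    using nu_le_d[OF assms(1,2) u] nu_le_d[OF assms(2,3) u] by simp
qed

text \<open>The supremum distance is a metric and not just a pseudometric by separation; only for metrics do
  the Cauchy sequences of the construction have their usual description.\<close>

lemma Metric_space_F0: "Metric_space F0 d"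
proof
  show "0 \<le> d f g" for f g by (rule d_nonneg)
  show "d f g = d g f" for f g by (rule d_commute)
  show "d f g = 0 \<longleftrightarrow> f = g" if f: "f \<in> F0" and g: "g \<in> F0" for f g
  proof
    assume "d f g = 0"
    then have "nu u (dif f g) = 0" if "u \<in> gunits G" for u
      using nu_le_d[OF f g that] nu_nonneg[OF that add_F0[OF f scale_F0[OF g, of "-1"]]] by simp
    then show "f = g" by (intro F0_separated f g) simp
  next
    assume "f = g"
    then have "nu u (dif f g) = 0" if "u \<in> gunits G" for u
      using hnorm_hdiff_self[OF F0_semi_inner[OF that], of g] g by simp
    then have "d f g \<le> 0" by (intro d_le f g) simp
    then show "d f g = 0" using d_nonneg[of f g] by simp
  qed
  show "d f h \<le> d f g + d g h" if "f \<in> F0" "g \<in> F0" "h \<in> F0" for f g h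
    using that by (rule d_triangle)
qed

lemma d_self: "f \<in> F0 \<Longrightarrow> d f f = 0"
  using Metric_space.zero[OF Metric_space_F0] by blast

lemma Cs_iff:
  "s \<in> Cs \<longleftrightarrow> (\<forall>n. s n \<in> F0) \<and> (\<forall>e>0. \<exists>N. \<forall>n\<ge>N. \<forall>m\<ge>N. d (s n) (s m) < e)"
  by (auto simp: cauchy_seqs_def Metric_space.MCauchy_def[OF Metric_space_F0] image_subset_iff)

lemma Cs_nth: "s \<in> Cs \<Longrightarrow> s n \<in> F0"
  by (simp only: Cs_iff)

lemma Cs_Cauchy: "s \<in> Cs \<Longrightarrow> 0 < e \<Longrightarrow> \<exists>N. \<forall>n\<ge>N. \<forall>m\<ge>N. d (s n) (s m) < e"
  by (simp only: Cs_iff)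

lemma d_add_le:
  assumes "f \<in> F0" "g \<in> F0" "f' \<in> F0" "g' \<in> F0"
  shows "d (padd f g) (padd f' g') \<le> d f f' + d g g'"
proof (rule d_le)
  fix u assume u: "u \<in> gunits G"
  have "nu u (dif (padd f g) (padd f' g')) \<le> nu u (dif f f') + nu u (dif g g')"
    using hnorm_hdiff_hadd_le[OF F0_semi_inner[OF u], of f g f' g'] assms by simp
  then show "nu u (dif (padd f g) (padd f' g')) \<le> d f f' + d g g'"
    using nu_le_d[OF assms(1,3) u] nu_le_d[OF assms(2,4) u] by simp
qed (use assms add_F0 in auto)

lemma d_scale_le:
  assumes "f \<in> F0" "g \<in> F0"
  shows "d (pscale a f) (pscale a g) \<le> cmod a * d f g"
proof (rule d_le)
  fix u assume u: "u \<in> gunits G"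
  have "nu u (dif (pscale a f) (pscale a g)) = cmod a * nu u (dif f g)"
    using hnorm_hdiff_hscale[OF F0_semi_inner[OF u], of f g a] assms by simp
  also have "\<dots> \<le> cmod a * d f g"
    using nu_le_d[OF assms u] by (simp add: mult_left_mono)
  finally show "nu u (dif (pscale a f) (pscale a g)) \<le> cmod a * d f g" .
qed (use assms scale_F0 in auto)

lemma const_Cs: "f \<in> F0 \<Longrightarrow> (\<lambda>n. f) \<in> Cs"
  unfolding Cs_iff by (simp add: d_self)

lemma add_Cs:
  assumes s: "s \<in> Cs" and t: "t \<in> Cs"
  shows "(\<lambda>n. padd (s n) (t n)) \<in> Cs"
  unfolding Cs_iff
proof (intro conjI allI impI)
  show "padd (s n) (t n) \<in> F0" for n by (intro add_F0 Cs_nth s t)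
  fix e :: real assume "e > 0"
  then have e: "e / 2 > 0" by simp
  obtain N where N: "\<And>n m. n \<ge> N \<Longrightarrow> m \<ge> N \<Longrightarrow> d (s n) (s m) < e / 2"
    using Cs_Cauchy[OF s e] by blast
  obtain M where M: "\<And>n m. n \<ge> M \<Longrightarrow> m \<ge> M \<Longrightarrow> d (t n) (t m) < e / 2"
    using Cs_Cauchy[OF t e] by blast
  have "d (padd (s n) (t n)) (padd (s m) (t m)) < e" if "n \<ge> max N M" "m \<ge> max N M" for n m
    using d_add_le[of "s n" "t n" "s m" "t m"] Cs_nth s t N[of n m] M[of n m] that by fastforce
  then show "\<exists>N. \<forall>n\<ge>N. \<forall>m\<ge>N. d (padd (s n) (t n)) (padd (s m) (t m)) < e" by blast
qed

lemma scale_Cs: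
  assumes s: "s \<in> Cs"
  shows "(\<lambda>n. pscale a (s n)) \<in> Cs"
  unfolding Cs_iff
proof (intro conjI allI impI)
  show "pscale a (s n) \<in> F0" for n by (intro scale_F0 Cs_nth s)
  fix e :: real assume "e > 0"
  \<comment> \<open>Adding 1 keeps the divisor positive for \<open>a = 0\<close>.\<close>
  then have e: "e / (cmod a + 1) > 0" by (simp add: add_nonneg_pos)
  obtain N where N: "\<And>n m. n \<ge> N \<Longrightarrow> m \<ge> N \<Longrightarrow> d (s n) (s m) < e / (cmod a + 1)"
    using Cs_Cauchy[OF s e] by blast
  have "d (pscale a (s n)) (pscale a (s m)) < e" if "n \<ge> N" "m \<ge> N" for n m
  proof -
    have "d (pscale a (s n)) (pscale a (s m)) \<le> cmod a * d (s n) (s m)"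
      by (intro d_scale_le Cs_nth s)
    also have "\<dots> \<le> (cmod a + 1) * d (s n) (s m)"
      by (simp add: mult_right_mono d_nonneg)
    also have "\<dots> < e" using N[OF that]
      by (simp add: pos_less_divide_eq add_nonneg_pos mult.commute)
    finally show ?thesis .
  qed
  then show "\<exists>N. \<forall>n\<ge>N. \<forall>m\<ge>N. d (pscale a (s n)) (pscale a (s m)) < e" by blast
qed

lemma nu_Bseq:
  assumes s: "s \<in> Cs" and u: "u \<in> gunits G"
  obtains B where "B > 0" "\<And>n. nu u (s n) \<le> B"
proof -
  have "Cauchy (\<lambda>n. nu u (s n))"
  proof (rule metric_CauchyI)
    fix e :: real assume "e > 0"
    then obtain N where N: "\<And>n m. n \<ge> N \<Longrightarrow> m \<ge> N \<Longrightarrow> d (s n) (s m) < e"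
      using Cs_Cauchy[OF s] by blast
    have le: "nu u (s n) \<le> nu u (s m) + d (s n) (s m)" for n m
      using hnorm_le_hdiff[OF F0_semi_inner[OF u], of "s n" "s m"] Cs_nth[OF s]
        nu_le_d[OF Cs_nth[OF s] Cs_nth[OF s] u, of n m] by simp
    have "dist (nu u (s n)) (nu u (s m)) < e" if "n \<ge> N" "m \<ge> N" for n m
      using le[of n m] le[of m n] N[OF that] d_commute[of "s n" "s m"] by (simp add: dist_real_def)
    then show "\<exists>N. \<forall>m\<ge>N. \<forall>n\<ge>N. dist (nu u (s m)) (nu u (s n)) < e" by blast
  qed
  then have "Bseq (\<lambda>n. nu u (s n))" by (rule Cauchy_Bseq)
  then obtain B where "B > 0" "\<And>n. norm (nu u (s n)) \<le> B" by (auto simp: Bseq_def)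
  then show thesis by (intro that[of B]) (auto intro: order_trans[OF abs_ge_self])
qed

lemma ip_diff_le:
  assumes "f \<in> F0" "g \<in> F0" "f' \<in> F0" "g' \<in> F0" and u: "u \<in> gunits G"
    and "nu u g \<le> B" "nu u f' \<le> B" "0 \<le> B"
  shows "cmod (ip f g u - ip f' g' u) \<le> B * (d f f' + d g g')"
proof -
  have "cmod (ip f g u - ip f' g' u)
      \<le> nu u (dif f f') * nu u g + nu u f' * nu u (dif g g')"
    using hinner_diff_le[OF F0_semi_inner[OF u], of f g f' g'] assms(1-4) by simp
  also have "\<dots> \<le> d f f' * B + B * d g g'"
    by (intro add_mono mult_mono nu_le_d u assms d_nonneg nu_nonneg add_F0 scale_F0)
  finally show ?thesis by (simp add: algebra_simps)
qed

text \<open>By Cauchy--Schwarz the form at \<open>u\<close> is Lipschitz in each argument on bounded sets, with respect to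
  the supremum distance; so it converges along Cauchy sequences.\<close>

lemma ip_tendsto:
  assumes s: "s \<in> Cs" and t: "t \<in> Cs" and u: "u \<in> gunits G"
  shows "(\<lambda>n. ip (s n) (t n) u) \<longlonglongrightarrow> hinner (C u) s t"
proof -
  obtain A where A: "A > 0" "\<And>n. nu u (s n) \<le> A" using nu_Bseq[OF s u] by blast
  obtain A' where A': "A' > 0" "\<And>n. nu u (t n) \<le> A'" using nu_Bseq[OF t u] by blast
  define B where "B = max A A'"
  have B: "B > 0" "\<And>n. nu u (s n) \<le> B" "\<And>n. nu u (t n) \<le> B"
    using A A' by (auto simp: B_def le_max_iff_disj)
  have "Cauchy (\<lambda>n. ip (s n) (t n) u)"
  proof (rule metric_CauchyI)
    fix e :: real assume "e > 0"
    then have e: "e / (2 * B) > 0" using B by simp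
    obtain N where N: "\<And>n m. n \<ge> N \<Longrightarrow> m \<ge> N \<Longrightarrow> d (s n) (s m) < e / (2 * B)"
      using Cs_Cauchy[OF s e] by blast
    obtain M where M: "\<And>n m. n \<ge> M \<Longrightarrow> m \<ge> M \<Longrightarrow> d (t n) (t m) < e / (2 * B)"
      using Cs_Cauchy[OF t e] by blast
    have "dist (ip (s n) (t n) u) (ip (s m) (t m) u) < e"
      if "n \<ge> max N M" "m \<ge> max N M" for n m
    proof -
      have "cmod (ip (s n) (t n) u - ip (s m) (t m) u)
          \<le> B * (d (s n) (s m) + d (t n) (t m))"
        by (intro ip_diff_le Cs_nth s t u B) (use B in simp)
      also have "\<dots> < B * (e / (2 * B) + e / (2 * B))"
        using B N[of n m] M[of n m] that by (intro mult_strict_left_mono add_strict_mono) auto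
      also have "\<dots> = e" using B by simp
      finally show ?thesis by (simp add: dist_norm)
    qed
    then show "\<exists>N. \<forall>n\<ge>N. \<forall>m\<ge>N.
      dist (ip (s n) (t n) u) (ip (s m) (t m) u) < e" by blast
  qed
  then show ?thesis
    using Cauchy_convergent convergent_LIMSEQ_iff by (fastforce simp: cauchy_space_def)
qed

lemma C_semi_inner:
  assumes u: "u \<in> gunits G"
  shows "semi_inner_space (C u)"
proof -
  note V0u = F0_semi_inner[OF u]
  have add_eq: "hinner (C u) (\<lambda>n. padd (s n) (t n)) r = hinner (C u) s r + hinner (C u) t r"
    if "s \<in> Cs" "t \<in> Cs" "r \<in> Cs" for s t r
  proof (rule LIMSEQ_unique)
    show "(\<lambda>n. ip (padd (s n) (t n)) (r n) u) \<longlonglongrightarrow> hinner (C u) (\<lambda>n. padd (s n) (t n)) r"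
      using ip_tendsto[OF add_Cs[OF that(1,2)] that(3) u] .
    have "ip (padd (s n) (t n)) (r n) u
        = ip (s n) (r n) u + ip (t n) (r n) u" for n
      using semi_inner_spaceD(3)[OF V0u, of "s n" "t n" "r n"] that Cs_nth by simp
    then show "(\<lambda>n. ip (padd (s n) (t n)) (r n) u) \<longlonglongrightarrow> hinner (C u) s r + hinner (C u) t r"
      using tendsto_add[OF ip_tendsto[OF that(1,3) u] ip_tendsto[OF that(2,3) u]] by simp
  qed
  have scale_eq: "hinner (C u) (\<lambda>n. pscale a (s n)) t = a * hinner (C u) s t"
    if "s \<in> Cs" "t \<in> Cs" for a s t
  proof (rule LIMSEQ_unique)
    show "(\<lambda>n. ip (pscale a (s n)) (t n) u) \<longlonglongrightarrow> hinner (C u) (\<lambda>n. pscale a (s n)) t"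
      using ip_tendsto[OF scale_Cs[OF that(1)] that(2) u] .
    have "ip (pscale a (s n)) (t n) u = a * ip (s n) (t n) u" for n
      using semi_inner_spaceD(4)[OF V0u, of "s n" "t n"] that Cs_nth by simp
    then show "(\<lambda>n. ip (pscale a (s n)) (t n) u) \<longlonglongrightarrow> a * hinner (C u) s t"
      using tendsto_mult_left[OF ip_tendsto[OF that u]] by simp
  qed
  have herm: "hinner (C u) s t = cnj (hinner (C u) t s)" if "s \<in> Cs" "t \<in> Cs" for s t
  proof (rule LIMSEQ_unique[OF ip_tendsto[OF that u]])
    have "ip (s n) (t n) u = cnj (ip (t n) (s n) u)" for n
      using semi_inner_spaceD(5)[OF V0u, of "s n" "t n"] that Cs_nth by simp
    then show "(\<lambda>n. ip (s n) (t n) u) \<longlonglongrightarrow> cnj (hinner (C u) t s)"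
      using tendsto_cnj[OF ip_tendsto[OF that(2,1) u]] by presburger
  qed
  have pos: "0 \<le> Re (hinner (C u) s s)" if "s \<in> Cs" for s
  proof (rule LIMSEQ_le_const[OF tendsto_Re[OF ip_tendsto[OF that that u]]])
    show "\<exists>N. \<forall>n\<ge>N. 0 \<le> Re (ip (s n) (s n) u)"
      using semi_inner_spaceD(6)[OF V0u] Cs_nth[OF that] by simp
  qed
  show ?thesis
    unfolding semi_inner_space_def C_simps
    by (intro conjI ballI allI add_eq scale_eq herm pos add_Cs scale_Cs)
qed

lemma ind_F_eq: "ind_F G H mu S = cls ` Cs"
  by (auto simp: ind_F_def metric_completion_def quotient_def ind_F_class_def cauchy_seqs_def)

lemma cls_eq:
  assumes "s \<in> Cs" shows "cls s = {t \<in> Cs. (\<lambda>n. d (s n) (t n)) \<longlonglongrightarrow> 0}"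
  using assms by (auto simp: ind_F_class_def cauchy_rel_def cauchy_seqs_def)

lemma self_in_cls: "s \<in> Cs \<Longrightarrow> s \<in> cls s"
  using Cs_nth[of s] by (simp add: cls_eq d_self)

lemma d_squeeze:
  assumes "\<And>n. d (f n) (g n) \<le> a n" "a \<longlonglongrightarrow> 0"
  shows "(\<lambda>n. d (f n) (g n)) \<longlonglongrightarrow> 0"
  by (rule tendsto_sandwich[of "\<lambda>_. 0" _ _ a]) (simp_all add: assms d_nonneg)

lemma cls_cong:
  assumes s: "s \<in> Cs" and t: "t \<in> Cs" and st: "(\<lambda>n. d (s n) (t n)) \<longlonglongrightarrow> 0"
  shows "cls s = cls t"
proof -
  have "(\<lambda>n. d (s n) (r n)) \<longlonglongrightarrow> 0 \<longleftrightarrow> (\<lambda>n. d (t n) (r n)) \<longlonglongrightarrow> 0" if r: "r \<in> Cs" for r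
  proof
    assume "(\<lambda>n. d (s n) (r n)) \<longlonglongrightarrow> 0"
    with st have "(\<lambda>n. d (s n) (t n) + d (s n) (r n)) \<longlonglongrightarrow> 0"
      using tendsto_add by fastforce
    then show "(\<lambda>n. d (t n) (r n)) \<longlonglongrightarrow> 0"
      by (rule d_squeeze[rotated]) (metis d_triangle d_commute Cs_nth s t r)
  next
    assume "(\<lambda>n. d (t n) (r n)) \<longlonglongrightarrow> 0"
    with st have "(\<lambda>n. d (s n) (t n) + d (t n) (r n)) \<longlonglongrightarrow> 0"
      using tendsto_add by fastforce
    then show "(\<lambda>n. d (s n) (r n)) \<longlonglongrightarrow> 0"
      by (rule d_squeeze[rotated]) (intro d_triangle Cs_nth s t r)
  qed
  then show ?thesis using s t by (auto simp: cls_eq)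
qed

lemma cls_eqD:
  assumes "s \<in> Cs" "t \<in> Cs" "cls s = cls t"
  shows "(\<lambda>n. d (s n) (t n)) \<longlonglongrightarrow> 0"
  using self_in_cls[OF assms(2)] unfolding assms(3)[symmetric] cls_eq[OF assms(1)] by simp

lemma some_elem_cls:
  assumes "s \<in> Cs"
  shows "some_elem (cls s) \<in> Cs" "(\<lambda>n. d (s n) (some_elem (cls s) n)) \<longlonglongrightarrow> 0"
  using some_elem_nonempty[of "cls s"] self_in_cls[OF assms] assms by (auto simp: cls_eq)

lemma hinner_C_cong:
  assumes s: "s \<in> Cs" "s' \<in> Cs" and t: "t \<in> Cs" "t' \<in> Cs" and u: "u \<in> gunits G"
    and ss: "(\<lambda>n. d (s n) (s' n)) \<longlonglongrightarrow> 0" and tt: "(\<lambda>n. d (t n) (t' n)) \<longlonglongrightarrow> 0"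
  shows "hinner (C u) s t = hinner (C u) s' t'"
proof -
  obtain A where A: "A > 0" "\<And>n. nu u (s' n) \<le> A" using nu_Bseq[OF s(2) u] by blast
  obtain A' where A': "A' > 0" "\<And>n. nu u (t n) \<le> A'" using nu_Bseq[OF t(1) u] by blast
  define B where "B = max A A'"
  have B: "B \<ge> 0" "\<And>n. nu u (s' n) \<le> B" "\<And>n. nu u (t n) \<le> B"
    using A A' by (auto simp: B_def le_max_iff_disj)
  have "(\<lambda>n. B * (d (s n) (s' n) + d (t n) (t' n))) \<longlonglongrightarrow> B * (0 + 0)"
    by (intro tendsto_intros ss tt)
  then have lim: "(\<lambda>n. B * (d (s n) (s' n) + d (t n) (t' n))) \<longlonglongrightarrow> 0" by simp
  have "cmod (ip (s n) (t n) u - ip (s' n) (t' n) u)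
      \<le> B * (d (s n) (s' n) + d (t n) (t' n))" for n
    by (intro ip_diff_le B u Cs_nth s t)
  then have "(\<lambda>n. ip (s n) (t n) u - ip (s' n) (t' n) u) \<longlonglongrightarrow> 0"
    by (intro Lim_null_comparison[OF _ lim] always_eventually) blast
  moreover have "(\<lambda>n. ip (s n) (t n) u - ip (s' n) (t' n) u)
      \<longlonglongrightarrow> hinner (C u) s t - hinner (C u) s' t'"
    by (intro tendsto_diff ip_tendsto s t u)
  ultimately show ?thesis using LIMSEQ_unique by fastforce
qed

text \<open>The operations on classes are computed on whatever representatives are at hand.\<close>

lemma ind_F_add_cls:
  assumes s: "s \<in> Cs" and t: "t \<in> Cs"
  shows "ind_F_add G H mu S (cls s) (cls t) = cls (\<lambda>n. padd (s n) (t n))"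
  unfolding ind_F_add_def
proof (rule cls_cong[symmetric])
  let ?s = "some_elem (cls s)" and ?t = "some_elem (cls t)"
  note S = some_elem_cls[OF s] and T = some_elem_cls[OF t]
  show "(\<lambda>n. padd (s n) (t n)) \<in> Cs" "(\<lambda>n. padd (?s n) (?t n)) \<in> Cs"
    by (intro add_Cs s t S T)+
  have "(\<lambda>n. d (s n) (?s n) + d (t n) (?t n)) \<longlonglongrightarrow> 0"
    using tendsto_add[OF S(2) T(2)] by simp
  then show "(\<lambda>n. d (padd (s n) (t n)) (padd (?s n) (?t n))) \<longlonglongrightarrow> 0"
    by (rule d_squeeze[rotated]) (intro d_add_le Cs_nth s t S T)
qed

lemma ind_F_scale_cls:
  assumes s: "s \<in> Cs"
  shows "ind_F_scale G H mu S a (cls s) = cls (\<lambda>n. pscale a (s n))"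
  unfolding ind_F_scale_def
proof (rule cls_cong[symmetric])
  let ?s = "some_elem (cls s)"
  note S = some_elem_cls[OF s]
  show "(\<lambda>n. pscale a (s n)) \<in> Cs" "(\<lambda>n. pscale a (?s n)) \<in> Cs"
    by (intro scale_Cs s S)+
  have "(\<lambda>n. cmod a * d (s n) (?s n)) \<longlonglongrightarrow> 0"
    using tendsto_mult_left[OF S(2), of "cmod a"] by simp
  then show "(\<lambda>n. d (pscale a (s n)) (pscale a (?s n))) \<longlonglongrightarrow> 0"
    by (rule d_squeeze[rotated]) (intro d_scale_le Cs_nth s S)
qed

lemma ind_F_ip_cls:
  assumes s: "s \<in> Cs" and t: "t \<in> Cs" and u: "u \<in> gunits G"
  shows "ind_F_ip G mu S (cls s) (cls t) u = hinner (C u) s t"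
  using hinner_C_cong[OF s some_elem_cls(1)[OF s] t some_elem_cls(1)[OF t] u
      some_elem_cls(2)[OF s] some_elem_cls(2)[OF t]]
  by (simp add: ind_F_ip_def cauchy_space_def)

context
  fixes u assumes u: "u \<in> gunits G"
begin

lemmas Cu = C_semi_inner[OF u]
lemmas C_expand = semi_inner_expand[OF Cu, unfolded C_simps(1)]

lemma ind_null_eq: "ind_null G H mu S u = cls ` {r \<in> Cs. hnorm (C u) r = 0}"
  using hnorm_eq_0_iff[OF Cu] by (auto simp: ind_null_def ind_F_eq ind_F_ip_cls[OF _ _ u])

lemma hnorm_hdiff_cls_eq:
  assumes s: "s \<in> Cs" and t: "t \<in> Cs" and "cls s = cls t"
  shows "dC u s t = 0"
proof -
  have z: "(\<lambda>n. d (r n) (r n)) \<longlonglongrightarrow> 0" if "r \<in> Cs" for r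
    using cls_eqD[OF that that] by simp
  note st = cls_eqD[OF assms]
  have "hinner (C u) s r = hinner (C u) t r" "hinner (C u) r s = hinner (C u) r t" if "r \<in> Cs" for r
    by (intro hinner_C_cong s t u that z st)+
  then show ?thesis using s t C_expand by (simp add: hnorm_def)
qed

text \<open>Adding null classes to \<open>s\<close> reaches every \<open>t\<close> at distance zero from \<open>s\<close>, because
  \<open>s + (t - s)\<close> and \<open>t\<close> have the same class. So the fibre is the Hausdorff quotient of the
  Cauchy sequences under the limit seminorm at \<open>u\<close>.\<close>

lemma pt_eq:
  assumes s: "s \<in> Cs"
  shows "pt u s = cls ` {t \<in> Cs. dC u t s = 0}"
proof -
  have "pt u s = (\<lambda>r. cls (\<lambda>n. padd (s n) (r n))) ` {r \<in> Cs. hnorm (C u) r = 0}"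
    unfolding ind_t_def ind_null_eq image_image
    by (intro image_cong refl) (simp add: ind_F_add_cls s)
  also have "\<dots> = cls ` {t \<in> Cs. dC u t s = 0}"
  proof (intro Set.equalityI subsetI)
    fix F assume "F \<in> (\<lambda>r. cls (\<lambda>n. padd (s n) (r n))) ` {r \<in> Cs. hnorm (C u) r = 0}"
    then obtain r where r: "r \<in> Cs" "hnorm (C u) r = 0" and F: "F = cls (hadd (C u) s r)"
      by auto
    have "dC u (hadd (C u) s r) s = hnorm (C u) r"
      by (rule hnorm_eqI[OF Cu]) (use s r C_expand in \<open>simp_all add: add_Cs del: C_simps(2,3)\<close>)
    then show "F \<in> cls ` {t \<in> Cs. dC u t s = 0}"
      using F r add_Cs[OF s r(1)] by auto
  next
    fix F assume "F \<in> cls ` {t \<in> Cs. dC u t s = 0}"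
    then obtain t where t: "t \<in> Cs" "dC u t s = 0" and F: "F = cls t"
      by auto
    let ?r = "hdiff (C u) t s"
    have r: "?r \<in> Cs" using hdiff_in_hcar[OF Cu, of t s] s t by simp
    have r_eq: "?r = (\<lambda>n. dif (t n) (s n))" by (simp add: hdiff_def)
    have "cls (\<lambda>n. padd (s n) (?r n)) = cls t"
    proof (rule cls_cong)
      show "(\<lambda>n. padd (s n) (?r n)) \<in> Cs" "t \<in> Cs" by (intro add_Cs s r t)+
      have "d (padd (s n) (?r n)) (t n) = 0" for n
      proof -
        have F0: "s n \<in> F0" "t n \<in> F0" using s t Cs_nth by blast+
        have "nu v (dif (padd (s n) (dif (t n) (s n))) (t n)) = nu v (dif (t n) (t n))"
          if v: "v \<in> gunits G" for v
        proof -
          note V0u = F0_semi_inner[OF v]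
          have "hnorm (V0 v) (hdiff (V0 v) (hadd (V0 v) (s n) (hdiff (V0 v) (t n) (s n))) (t n))
              = hnorm (V0 v) (hdiff (V0 v) (t n) (t n))"
            by (rule hnorm_eqI[OF V0u])
               (use F0 semi_inner_expand[OF V0u] in \<open>simp_all del: V0_simps(2-4) hdiff_V0\<close>)
          then show ?thesis by simp
        qed
        moreover have "nu v (dif (t n) (t n)) = 0" if v: "v \<in> gunits G" for v
          using hnorm_hdiff_self[OF F0_semi_inner[OF v], of "t n"] F0 by simp
        ultimately have "d (padd (s n) (?r n)) (t n) \<le> 0"
          unfolding r_eq using F0 by (intro d_le) (simp_all add: add_F0 scale_F0)
        then show ?thesis using d_nonneg[of "padd (s n) (?r n)" "t n"] by simp
      qed
      then show "(\<lambda>n. d (padd (s n) (?r n)) (t n)) \<longlonglongrightarrow> 0" by simp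
    qed
    then show "F \<in> (\<lambda>r. cls (\<lambda>n. padd (s n) (r n))) ` {r \<in> Cs. hnorm (C u) r = 0}"
      unfolding F using r t(2) by (intro image_eqI[of _ _ ?r]) simp_all
  qed
  finally show ?thesis .
qed

lemma pt_eq_iff:
  assumes s: "s \<in> Cs" and t: "t \<in> Cs"
  shows "pt u s = pt u t \<longleftrightarrow> dC u s t = 0"
proof
  assume eq: "pt u s = pt u t"
  have "cls s \<in> pt u s" unfolding pt_eq[OF s] using s hnorm_hdiff_self[OF Cu] by auto
  then obtain r where r: "r \<in> Cs" "dC u r t = 0" "cls s = cls r"
    unfolding eq pt_eq[OF t] by auto
  have "dC u s t
      \<le> dC u s r + dC u r t"
    using hnorm_hdiff_triangle[OF Cu, of s r t] s r(1) t by simp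
  then show "dC u s t = 0"
    using hnorm_hdiff_cls_eq[OF s r(1,3)] r(2) hnorm_nonneg[OF Cu, of "hdiff (C u) s t"]
      hdiff_in_hcar[OF Cu, of s t] s t by simp
next
  assume st: "dC u s t = 0"
  have "dC u r s = 0 \<longleftrightarrow> dC u r t = 0" if r: "r \<in> Cs" for r
    using hnorm_hdiff_triangle[OF Cu, of r s t] hnorm_hdiff_triangle[OF Cu, of r t s]
      hnorm_hdiff_commute[OF Cu, of s t] st r s t
      hnorm_nonneg[OF Cu, of "hdiff (C u) r t"] hnorm_nonneg[OF Cu, of "hdiff (C u) r s"]
      hdiff_in_hcar[OF Cu, of r t] hdiff_in_hcar[OF Cu, of r s]
    by auto
  then show "pt u s = pt u t"
    unfolding pt_eq[OF s] pt_eq[OF t] by (intro arg_cong[where f = "\<lambda>A. cls ` A"] Collect_cong) blast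
qed

lemma some_elem_pt:
  assumes s: "s \<in> Cs"
  obtains t where "t \<in> Cs" "some_elem (pt u s) = cls t" "dC u t s = 0"
proof -
  have "cls s \<in> pt u s" unfolding pt_eq[OF s] using s hnorm_hdiff_self[OF Cu] by auto
  then have "some_elem (pt u s) \<in> pt u s" using some_elem_nonempty by blast
  then show thesis unfolding pt_eq[OF s] using that pt_eq[OF s] by auto
qed

lemma hcar_ind_fib: "hcar (V u) = pt u ` Cs"
  by (auto simp: ind_fib_def ind_F_eq)

lemma hadd_ind_fib:
  assumes s: "s \<in> Cs" and t: "t \<in> Cs"
  shows "hadd (V u) (pt u s) (pt u t) = pt u (\<lambda>n. padd (s n) (t n))"
proof -
  obtain s' where s': "s' \<in> Cs" "some_elem (pt u s) = cls s'" "dC u s' s = 0"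
    using some_elem_pt[OF s] by blast
  obtain t' where t': "t' \<in> Cs" "some_elem (pt u t) = cls t'" "dC u t' t = 0"
    using some_elem_pt[OF t] by blast
  have "pt u (\<lambda>n. padd (s' n) (t' n)) = pt u (\<lambda>n. padd (s n) (t n))"
    using hnorm_hdiff_hadd_le[OF Cu, of s' t' s t] s t s' t'
      hnorm_nonneg[OF Cu hdiff_in_hcar[OF Cu], of "hadd (C u) s' t'" "hadd (C u) s t"]
    by (simp add: pt_eq_iff add_Cs)
  then show ?thesis using s' t' by (simp add: ind_fib_def ind_F_add_cls)
qed

lemma hscale_ind_fib:
  assumes s: "s \<in> Cs"
  shows "hscale (V u) a (pt u s) = pt u (\<lambda>n. pscale a (s n))"
proof -
  obtain s' where s': "s' \<in> Cs" "some_elem (pt u s) = cls s'" "dC u s' s = 0"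
    using some_elem_pt[OF s] by blast
  have "pt u (\<lambda>n. pscale a (s' n)) = pt u (\<lambda>n. pscale a (s n))"
    using hnorm_hdiff_hscale[OF Cu, of s' s a] s s' by (simp add: pt_eq_iff scale_Cs)
  then show ?thesis using s' by (simp add: ind_fib_def ind_F_scale_cls)
qed

lemma hinner_ind_fib:
  assumes s: "s \<in> Cs" and t: "t \<in> Cs"
  shows "hinner (V u) (pt u s) (pt u t) = hinner (C u) s t"
proof -
  obtain s' where s': "s' \<in> Cs" "some_elem (pt u s) = cls s'" "dC u s' s = 0"
    using some_elem_pt[OF s] by blast
  obtain t' where t': "t' \<in> Cs" "some_elem (pt u t) = cls t'" "dC u t' t = 0"
    using some_elem_pt[OF t] by blast
  have "hinner (C u) s' t' = hinner (C u) s t"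
    using hinner_diff_le[OF Cu, of s' t' s t] s t s' t' by simp
  then show ?thesis using s' t' by (simp add: ind_fib_def ind_F_ip_cls u)
qed

text \<open>Quotienting by the null vectors restores definiteness, which makes the Riesz map of the fibre
  injective.\<close>

lemma inner_space_ind_fib: "inner_space (V u)"
proof -
  have diff: "hdiff (V u) (pt u s) (pt u t) = pt u (hdiff (C u) s t)" if "s \<in> Cs" "t \<in> Cs" for s t
    using that by (simp add: hdiff_def hadd_ind_fib hscale_ind_fib scale_Cs)
  have "semi_inner_space (V u)"
    unfolding semi_inner_space_def hcar_ind_fib ball_simps
  proof (intro conjI ballI allI)
    fix s t assume st: "s \<in> Cs" "t \<in> Cs"
    show "hinner (V u) (pt u s) (pt u t) = cnj (hinner (V u) (pt u t) (pt u s))"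
      unfolding hinner_ind_fib[OF st] hinner_ind_fib[OF st(2,1)]
      using semi_inner_spaceD(5)[OF Cu, of s t] st by simp
  qed (use semi_inner_spaceD(3,4,6)[OF Cu] in
      \<open>simp_all add: hadd_ind_fib hscale_ind_fib hinner_ind_fib add_Cs scale_Cs\<close>)
  moreover have "pt u s = pt u t"
    if st: "s \<in> Cs" "t \<in> Cs" and "hinner (V u) (hdiff (V u) (pt u s) (pt u t)) (hdiff (V u) (pt u s) (pt u t)) = 0"
    for s t
  proof -
    have r: "hdiff (C u) s t \<in> Cs" using hdiff_in_hcar[OF Cu, of s t] st by simp
    then have "dC u s t = 0"
      using that(3) hnorm_eq_0_iff[OF Cu, of "hdiff (C u) s t"]
      by (simp add: diff[OF st] hinner_ind_fib)
    then show ?thesis by (simp add: pt_eq_iff[OF st])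
  qed
  ultimately show ?thesis
    unfolding inner_space_def hcar_ind_fib ball_simps by blast
qed

lemma hzero_ind_fib: "hzero (V u) = ind_null G H mu S u"
  by (simp add: ind_fib_def)

lemma ind_null_in_fib: "ind_null G H mu S u \<in> hcar (V u)"
proof -
  obtain f where f: "f \<in> F0" using F0_nonempty by blast
  let ?s = "hdiff (C u) (\<lambda>n. f) (\<lambda>n. f)"
  have s: "?s \<in> Cs" using hdiff_in_hcar[OF Cu, of "\<lambda>n. f" "\<lambda>n. f"] const_Cs[OF f] by simp
  have "dC u t ?s = hnorm (C u) t" if t: "t \<in> Cs" for t
    by (rule hnorm_eqI[OF Cu]) (use s t const_Cs[OF f] C_expand in simp_all)
  then have "pt u ?s = ind_null G H mu S u"
    unfolding pt_eq[OF s] ind_null_eq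
    by (intro arg_cong[where f = "\<lambda>A. cls ` A"] Collect_cong) auto
  then show ?thesis using s unfolding hcar_ind_fib by blast
qed

end

end

section \<open>Radon measures and their supports\<close>

lemma radon_sets_open: "radon_measure X M \<Longrightarrow> openin X U \<Longrightarrow> U \<in> sets M"
  by (simp add: radon_measure_def sigma_sets.Basic)

lemma radon_space: "radon_measure X M \<Longrightarrow> space M = topspace X"
  by (simp add: radon_measure_def)

lemma radon_sets_closed:
  assumes M: "radon_measure X M" and C: "closedin X C" shows "C \<in> sets M"
proof -
  have "topspace X - C \<in> sets M" using radon_sets_open[OF M] C by (simp add: closedin_def)
  then have "space M - (topspace X - C) \<in> sets M" by (rule sets.compl_sets)
  moreover have "space M - (topspace X - C) = C"
    using closedin_subset[OF C] by (auto simp: radon_space[OF M])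
  ultimately show ?thesis by simp
qed

lemma radon_borel_measurable:
  fixes f :: "'a \<Rightarrow> 'b::topological_space"
  assumes M: "radon_measure X M" and f: "continuous_map X euclidean f"
  shows "f \<in> borel_measurable M"
proof (rule borel_measurableI)
  fix U :: "'b set" assume "open U"
  then have "openin X {x \<in> topspace X. f x \<in> U}"
    by (intro openin_continuous_map_preimage[OF f]) simp
  moreover have "f -` U \<inter> space M = {x \<in> topspace X. f x \<in> U}" by (auto simp: radon_space[OF M])
  ultimately show "f -` U \<inter> space M \<in> sets M" using radon_sets_open[OF M] by simp
qed

text \<open>The complement of the support is a union of open null sets; inner regularity reduces its
  measure to that of compact subsets, each covered by finitely many of them.\<close>

lemma radon_null_off_support:
  assumes M: "radon_measure X M"
  shows "topspace X - measure_support X M \<in> null_sets M"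
proof -
  let ?N = "topspace X - measure_support X M"
  let ?\<U> = "{U. openin X U \<and> emeasure M U = 0}"
  have N: "?N = \<Union>?\<U>"
    using openin_subset by (fastforce simp: measure_support_def)
  have op: "openin X ?N" unfolding N by blast
  have null: "emeasure M K \<le> 0" if K: "compactin X K" "K \<subseteq> ?N" for K
  proof -
    obtain \<F> where \<F>: "finite \<F>" "\<F> \<subseteq> ?\<U>" "K \<subseteq> \<Union>\<F>"
      using compactinD[OF K(1), of ?\<U>] K(2) unfolding N by blast
    have sets: "\<F> \<subseteq> sets M" using \<F>(2) radon_sets_open[OF M] by blast
    have "\<Union>\<F> \<in> null_sets M"
    proof -
      have "(\<Union>U\<in>\<F>. U) \<in> null_sets M"
        using \<F>(1,2) sets by (intro null_sets_UN' countable_finite) auto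
      then show ?thesis by simp
    qed
    then have "emeasure M (\<Union>\<F>) = 0" "\<Union>\<F> \<in> sets M" by auto
    then show ?thesis using emeasure_mono[OF \<F>(3), of M] by simp
  qed
  have inner: "emeasure M ?N = (SUP K\<in>{K. compactin X K \<and> K \<subseteq> ?N}. emeasure M K)"
    using M op unfolding radon_measure_def by blast
  have "emeasure M ?N \<le> 0" unfolding inner by (rule SUP_least) (use null in blast)
  then show ?thesis using radon_sets_open[OF M op] by (simp add: null_setsI)
qed

lemma radon_integral_zero:
  fixes f :: "'a \<Rightarrow> complex"
  assumes M: "radon_measure X M" and f: "continuous_map X euclidean f"
    and 0: "\<And>x. x \<in> measure_support X M \<Longrightarrow> f x = 0"
  shows "(LINT x|M. f x) = 0"
proof -
  have "AE x in M. f x = 0"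
    by (rule AE_I'[OF radon_null_off_support[OF M]]) (auto simp: radon_space[OF M] 0)
  then have "(LINT x|M. f x) = (LINT x|M. 0)"
    by (intro integral_cong_AE radon_borel_measurable[OF M f]) auto
  then show ?thesis by simp
qed

lemma radon_integrable_Cc:
  assumes M: "radon_measure X M" and f: "f \<in> Cc X"
  shows "integrable M f"
proof -
  let ?K = "X closure_of {x \<in> topspace X. f x \<noteq> 0}"
  have cont: "continuous_map X euclidean f" and K: "compactin X ?K" using f by (auto simp: Cc_def)
  have "compact (f ` ?K)" using image_compactin[OF K cont] by simp
  then obtain B where B: "\<And>x. x \<in> ?K \<Longrightarrow> cmod (f x) \<le> B"
    using compact_imp_bounded bounded_iff by (metis imageI)
  have "f x = 0" if "x \<in> space M" "x \<notin> ?K" for x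
    using that closure_of_subset[of "{x \<in> topspace X. f x \<noteq> 0}" X] by (auto simp: radon_space[OF M])
  moreover have "emeasure M ?K < \<infinity>" using M K unfolding radon_measure_def by blast
  ultimately show ?thesis
    using B radon_sets_closed[OF M closedin_closure_of]
    by (intro integrableI_bounded_set[of ?K _ _ B] radon_borel_measurable[OF M cont]) auto
qed

text \<open>A nonnegative function with integral zero vanishes almost everywhere, whereas every
  neighbourhood of a point of the support has positive measure.\<close>

lemma radon_integral_nonzero:
  assumes M: "radon_measure X M" and f: "f \<in> Cc X"
    and nonneg: "\<And>x. x \<in> topspace X \<Longrightarrow> 0 \<le> Re (f x)"
    and x: "x \<in> measure_support X M" "Re (f x) \<noteq> 0"
  shows "(LINT x|M. f x) \<noteq> 0"
proof
  assume 0: "(LINT x|M. f x) = 0"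
  have int: "integrable M f" by (rule radon_integrable_Cc[OF M f])
  have cont: "continuous_map X euclidean f" using f by (simp add: Cc_def)
  have "(LINT x|M. Re (f x)) = 0" using integral_Re[OF int] 0 by simp
  moreover have "integrable M (\<lambda>x. Re (f x))" using int by (rule integrable_Re)
  moreover have "AE x in M. 0 \<le> Re (f x)" by (rule AE_I2) (simp add: nonneg radon_space[OF M])
  ultimately have AE: "AE x in M. Re (f x) = 0" using integral_nonneg_eq_0_iff_AE by blast
  let ?U = "{x \<in> topspace X. Re (f x) \<noteq> 0}"
  have "open {z. Re z \<noteq> 0}" by (intro open_Collect_neq continuous_intros)
  then have op: "openin X ?U"
    using openin_continuous_map_preimage[OF cont, of "{z. Re z \<noteq> 0}"] by simp
  have "{x \<in> space M. \<not> Re (f x) = 0} = ?U" by (auto simp: radon_space[OF M])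
  then have "emeasure M ?U = 0"
    using AE radon_sets_open[OF M op] by (simp add: AE_iff_measurable)
  moreover have "emeasure M ?U \<noteq> 0" using x op by (auto simp: measure_support_def)
  ultimately show False by simp
qed

lemma Cc_if_vanishing_off_compact:
  assumes f: "continuous_map X euclidean f" and K: "compactin X K" "closedin X K"
    and 0: "\<And>x. x \<in> topspace X \<Longrightarrow> x \<notin> K \<Longrightarrow> f x = 0"
  shows "f \<in> Cc X"
proof -
  have "X closure_of {x \<in> topspace X. f x \<noteq> 0} \<subseteq> K"
    by (rule closure_of_minimal) (use 0 K in auto)
  then show ?thesis using f closed_compactin[OF K(1)] by (simp add: Cc_def)
qed

section \<open>Groupoids\<close>

context
  fixes G :: "'g groupoid"
  assumes G: "is_groupoid G"
begin

lemma ginv_arr: "x \<in> garr G \<Longrightarrow> ginv G x \<in> garr G"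
  and ginv_ginv: "x \<in> garr G \<Longrightarrow> ginv G (ginv G x) = x"
  using G by (auto simp: is_groupoid_def)

lemma gmult_arr: "(x, y) \<in> gcomposable G \<Longrightarrow> gmult G x y \<in> garr G"
  using G by (auto simp: is_groupoid_def)

lemma gcomposableI: "x \<in> garr G \<Longrightarrow> y \<in> garr G \<Longrightarrow> gdom G x = grng G y \<Longrightarrow> (x, y) \<in> gcomposable G"
  by (simp add: gcomposable_def)

lemma gassoc:
  assumes "(x, y) \<in> gcomposable G" "(y, z) \<in> gcomposable G"
  shows "(gmult G x y, z) \<in> gcomposable G" "(x, gmult G y z) \<in> gcomposable G"
    "gmult G (gmult G x y) z = gmult G x (gmult G y z)"
proof -
  have "\<forall>x y z. (x, y) \<in> gcomposable G \<and> (y, z) \<in> gcomposable G \<longrightarrow>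
        (gmult G x y, z) \<in> gcomposable G \<and> (x, gmult G y z) \<in> gcomposable G \<and>
        gmult G (gmult G x y) z = gmult G x (gmult G y z)"
    using G by (simp add: is_groupoid_def)
  with assms show "(gmult G x y, z) \<in> gcomposable G" "(x, gmult G y z) \<in> gcomposable G"
    "gmult G (gmult G x y) z = gmult G x (gmult G y z)" by blast+
qed

lemma gcancel:
  assumes "(x, y) \<in> gcomposable G"
  shows "gmult G (ginv G x) (gmult G x y) = y" "gmult G (gmult G x y) (ginv G y) = x"
  using G assms by (auto simp: is_groupoid_def)

lemma grng_ginv: "x \<in> garr G \<Longrightarrow> grng G (ginv G x) = gdom G x"
  and gdom_ginv: "x \<in> garr G \<Longrightarrow> gdom G (ginv G x) = grng G x"
  by (simp_all add: grng_def gdom_def ginv_ginv)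

lemma ginv_composable:
  assumes "x \<in> garr G"
  shows "(x, ginv G x) \<in> gcomposable G" "(ginv G x, x) \<in> gcomposable G"
  using assms by (auto intro!: gcomposableI simp: ginv_arr grng_ginv gdom_ginv)

lemma gdom_gmult:
  assumes "(x, y) \<in> gcomposable G" shows "gdom G (gmult G x y) = gdom G y"
proof -
  have y: "y \<in> garr G" using assms by (simp add: gcomposable_def)
  have "(gmult G x y, ginv G y) \<in> gcomposable G"
    using gassoc(1)[OF assms ginv_composable(1)[OF y]] .
  then show ?thesis using grng_ginv[OF y] by (simp add: gcomposable_def)
qed

lemma grng_gmult:
  assumes "(x, y) \<in> gcomposable G" shows "grng G (gmult G x y) = grng G x"
proof -
  have x: "x \<in> garr G" using assms by (simp add: gcomposable_def)
  have "(ginv G x, gmult G x y) \<in> gcomposable G"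
    using gassoc(2)[OF ginv_composable(2)[OF x] assms] .
  then show ?thesis using gdom_ginv[OF x] by (simp add: gcomposable_def)
qed

lemma grng_arr: "x \<in> garr G \<Longrightarrow> grng G x \<in> garr G"
  and gdom_arr: "x \<in> garr G \<Longrightarrow> gdom G x \<in> garr G"
  using gmult_arr ginv_composable by (auto simp: grng_def gdom_def)

lemma grng_gdom: "x \<in> garr G \<Longrightarrow> grng G (gdom G x) = gdom G x"
proof -
  assume x: "x \<in> garr G"
  show "grng G (gdom G x) = gdom G x"
    using grng_gmult[OF ginv_composable(2)[OF x]] grng_ginv[OF x] by (simp add: gdom_def[of G x])
qed

lemma gmult_gdom: "x \<in> garr G \<Longrightarrow> gmult G x (gdom G x) = x"
  using gcancel(1)[OF ginv_composable(2)] by (simp add: gdom_def ginv_ginv)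

lemma grng_unit: "x \<in> garr G \<Longrightarrow> grng G x \<in> gunits G"
  and gdom_unit: "x \<in> garr G \<Longrightarrow> gdom G x \<in> gunits G"
  by (auto simp: gunits_def) (metis gdom_arr grng_gdom image_eqI)

lemma gunits_arr: "gunits G \<subseteq> garr G"
  using grng_arr by (auto simp: gunits_def)

lemma topspace_gunit_top: "topspace (gunit_top G) = gunits G"
  using gunits_arr by (auto simp: gunit_top_def garr_def)

end

lemma topological_groupoid_is_groupoid: "topological_groupoid G \<Longrightarrow> is_groupoid G"
  by (simp add: topological_groupoid_def)

lemma continuous_map_grng:
  assumes G: "topological_groupoid G"
  shows "continuous_map (gtop G) (gunit_top G) (grng G)"
    and "continuous_map (gtop G) (gunit_top G) (gdom G)"
proof -
  note Gg = topological_groupoid_is_groupoid[OF G]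
  let ?P = "subtopology (prod_topology (gtop G) (gtop G)) (gcomposable G)"
  have inv: "continuous_map (gtop G) (gtop G) (ginv G)"
    and mult: "continuous_map ?P (gtop G) (\<lambda>(x, y). gmult G x y)"
    using G by (auto simp: topological_groupoid_def)
  have arr: "garr G = topspace (gtop G)" by (simp add: garr_def)
  have 1: "continuous_map (gtop G) ?P (\<lambda>x. (x, ginv G x))"
    by (intro continuous_map_into_subtopology continuous_map_pairedI inv continuous_map_id[unfolded id_def])
       (use ginv_composable[OF Gg] arr in auto)
  have 2: "continuous_map (gtop G) ?P (\<lambda>x. (ginv G x, x))"
    by (intro continuous_map_into_subtopology continuous_map_pairedI inv continuous_map_id[unfolded id_def])
       (use ginv_composable[OF Gg] arr in auto)
  have "continuous_map (gtop G) (gtop G) (grng G)" "continuous_map (gtop G) (gtop G) (gdom G)"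
    using continuous_map_compose[OF 1 mult] continuous_map_compose[OF 2 mult]
    by (simp_all add: o_def grng_def[abs_def] gdom_def[abs_def])
  then show "continuous_map (gtop G) (gunit_top G) (grng G)"
    "continuous_map (gtop G) (gunit_top G) (gdom G)"
    unfolding gunit_top_def
    using grng_unit[OF Gg] gdom_unit[OF Gg] arr by (auto intro!: continuous_map_into_subtopology)
qed

section \<open>Continuous sections of Hilbert bundles\<close>

abbreviation fdist :: "('g, 'v) hbundle \<Rightarrow> 'g \<Rightarrow> 'v \<Rightarrow> 'v \<Rightarrow> real" where
  "fdist E u v w \<equiv> hnorm (fib E u) (hdiff (fib E u) v w)"

text \<open>The map \<open>y \<mapsto> f y\<close> into the fibres over \<open>p y\<close> is locally a uniform limit of sections of the bundle
  pulled back along \<open>p\<close>. This is continuity of \<open>y \<mapsto> (p y, f y)\<close> into the total space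
  (\<open>continuous_map_total_top_iff\<close>).\<close>

definition continuous_along ::
    "'y topology \<Rightarrow> ('g, 'v) hbundle \<Rightarrow> ('y \<Rightarrow> 'g) \<Rightarrow> ('y \<Rightarrow> 'v) \<Rightarrow> bool" where
  "continuous_along Y E p f \<longleftrightarrow>
     (\<forall>y\<in>topspace Y. f y \<in> hcar (fib E (p y))) \<and>
     (\<forall>y\<in>topspace Y. \<forall>\<delta>>0. \<exists>\<xi>\<in>sec E. \<exists>O'. openin Y O' \<and> y \<in> O' \<and>
        (\<forall>z\<in>O'. fdist E (p z) (f z) (\<xi> (p z)) < \<delta>))"

lemma continuous_along_approx:
  assumes f: "continuous_along Y E p f" and y: "y \<in> topspace Y" and \<delta>: "\<delta> > 0"
  obtains \<xi> O' where "\<xi> \<in> sec E" "openin Y O'" "y \<in> O'"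
    "\<And>z. z \<in> O' \<Longrightarrow> fdist E (p z) (f z) (\<xi> (p z)) < \<delta>"
proof -
  have "\<exists>\<xi>\<in>sec E. \<exists>O'. openin Y O' \<and> y \<in> O' \<and>
        (\<forall>z\<in>O'. fdist E (p z) (f z) (\<xi> (p z)) < \<delta>)"
    using f y \<delta> by (simp add: continuous_along_def)
  then obtain \<xi> O' where \<xi>: "\<xi> \<in> sec E" and O': "openin Y O'" "y \<in> O'"
    and less: "\<forall>z\<in>O'. fdist E (p z) (f z) (\<xi> (p z)) < \<delta>"
    by (elim bexE exE conjE)
  show thesis by (rule that[OF \<xi> O']) (use less in simp)
qed

lemma continuous_along_cong:
  assumes "continuous_along Y E p f" "\<And>y. y \<in> topspace Y \<Longrightarrow> f y = g y"
  shows "continuous_along Y E p g"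
proof -
  have "(\<forall>z\<in>O'. fdist E (p z) (g z) (\<xi> (p z)) < \<delta>) \<longleftrightarrow>
        (\<forall>z\<in>O'. fdist E (p z) (f z) (\<xi> (p z)) < \<delta>)"
    if "openin Y O'" for O' \<xi> \<delta>
    using assms(2) openin_subset[OF that] by (intro ball_cong refl) (simp add: subset_iff)
  note eq = this
  show ?thesis
    unfolding continuous_along_def
  proof (intro conjI ballI allI impI)
    show "g y \<in> hcar (fib E (p y))" if "y \<in> topspace Y" for y
      using assms that by (simp add: continuous_along_def)
    fix y and \<delta> :: real assume "y \<in> topspace Y" "\<delta> > 0"
    then obtain \<xi> O' where "\<xi> \<in> sec E" "openin Y O'" "y \<in> O'"
      "\<And>z. z \<in> O' \<Longrightarrow> fdist E (p z) (f z) (\<xi> (p z)) < \<delta>"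
      by (rule continuous_along_approx[OF assms(1)]) blast
    then show "\<exists>\<xi>\<in>sec E. \<exists>O'. openin Y O' \<and> y \<in> O' \<and>
        (\<forall>z\<in>O'. fdist E (p z) (g z) (\<xi> (p z)) < \<delta>)"
      by (intro bexI[of _ \<xi>] exI[of _ O']) (simp_all add: eq)
  qed
qed


context
  fixes X :: "'g topology" and E :: "('g, 'v) hbundle" and Y :: "'y topology" and p :: "'y \<Rightarrow> 'g"
  assumes E: "hilbert_bundle X E" and p: "continuous_map Y X p"
begin

lemma fib_hilbert: "u \<in> topspace X \<Longrightarrow> hilbert_space (fib E u)"
  using E by (simp add: hilbert_bundle_def)

lemma fib_semi: "u \<in> topspace X \<Longrightarrow> semi_inner_space (fib E u)"
  using fib_hilbert hilbert_space_imp_semi_inner by blast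

lemma p_top: "y \<in> topspace Y \<Longrightarrow> p y \<in> topspace X"
  using p by (auto simp: continuous_map_def)

lemma sec_hcar: "\<xi> \<in> sec E \<Longrightarrow> u \<in> topspace X \<Longrightarrow> \<xi> u \<in> hcar (fib E u)"
  using E by (auto simp: hilbert_bundle_def)

lemma sec_zero: "(\<lambda>u\<in>topspace X. hzero (fib E u)) \<in> sec E"
  and sec_hadd: "\<xi> \<in> sec E \<Longrightarrow> \<eta> \<in> sec E \<Longrightarrow> (\<lambda>u\<in>topspace X. hadd (fib E u) (\<xi> u) (\<eta> u)) \<in> sec E"
  and sec_hscale: "\<xi> \<in> sec E \<Longrightarrow> (\<lambda>u\<in>topspace X. hscale (fib E u) a (\<xi> u)) \<in> sec E"
  using E by (simp_all add: hilbert_bundle_def)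

lemma sec_dense:
  "u \<in> topspace X \<Longrightarrow> v \<in> hcar (fib E u) \<Longrightarrow> \<epsilon> > 0 \<Longrightarrow>
    \<exists>\<xi>\<in>sec E. fdist E u v (\<xi> u) < \<epsilon>"
  using E by (simp add: hilbert_bundle_def)

lemma sec_hnorm_continuous:
  "\<xi> \<in> sec E \<Longrightarrow> continuous_map Y euclideanreal (\<lambda>y. hnorm (fib E (p y)) (\<xi> (p y)))"
  using E continuous_map_compose[OF p, of euclideanreal "\<lambda>u. hnorm (fib E u) (\<xi> u)"]
  by (simp add: hilbert_bundle_def o_def)

lemma sec_hdiff_hnorm_continuous:
  assumes "\<xi> \<in> sec E" "\<eta> \<in> sec E"
  shows "continuous_map Y euclideanreal (\<lambda>y. fdist E (p y) (\<xi> (p y)) (\<eta> (p y)))"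
  by (rule continuous_map_eq[OF sec_hnorm_continuous[OF sec_hadd[OF assms(1) sec_hscale[OF assms(2), of "-1"]]]])
     (simp add: p_top hdiff_def)

text \<open>Near \<open>y\<close> replace \<open>f\<close> by a section \<open>\<xi>\<close>: the distance between the sections \<open>\<xi>\<close> and \<open>\<eta>\<close> is continuous.\<close>

lemma openin_hnorm_hdiff_less:
  assumes f: "continuous_along Y E p f" and \<eta>: "\<eta> \<in> sec E"
  shows "openin Y {y \<in> topspace Y. fdist E (p y) (f y) (\<eta> (p y)) < \<epsilon>}"
    (is "openin Y ?U")
proof (subst openin_subopen, intro ballI)
  fix y assume "y \<in> ?U"
  then have y: "y \<in> topspace Y" and less: "fdist E (p y) (f y) (\<eta> (p y)) < \<epsilon>"
    by auto
  \<comment> \<open>One \<open>\<delta>\<close> is spent on replacing \<open>f\<close> by \<open>\<xi>\<close> at \<open>y\<close>, one on undoing it nearby.\<close>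
  define \<delta> where "\<delta> = (\<epsilon> - fdist E (p y) (f y) (\<eta> (p y))) / 2"
  have \<delta>: "\<delta> > 0" using less by (simp add: \<delta>_def)
  obtain \<xi> O' where \<xi>: "\<xi> \<in> sec E" and O': "openin Y O'" "y \<in> O'"
    "\<And>z. z \<in> O' \<Longrightarrow> fdist E (p z) (f z) (\<xi> (p z)) < \<delta>"
    by (rule continuous_along_approx[OF f y \<delta>]) blast
  have tri: "fdist E (p z) a c
      \<le> fdist E (p z) a b + fdist E (p z) b c"
    if "z \<in> topspace Y" "a \<in> hcar (fib E (p z))" "b \<in> hcar (fib E (p z))" "c \<in> hcar (fib E (p z))"
    for z a b c
    using hnorm_hdiff_triangle[OF fib_semi[OF p_top[OF that(1)]] that(2-4)] .
  have car: "f z \<in> hcar (fib E (p z))" "\<xi> (p z) \<in> hcar (fib E (p z))" "\<eta> (p z) \<in> hcar (fib E (p z))"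
    if "z \<in> topspace Y" for z
    using f that \<xi> \<eta> sec_hcar p_top by (auto simp: continuous_along_def)
  let ?W = "{z \<in> topspace Y. fdist E (p z) (\<xi> (p z)) (\<eta> (p z)) \<in> {..<\<epsilon> - \<delta>}}"
  have W: "openin Y ?W"
    by (intro openin_continuous_map_preimage[OF sec_hdiff_hnorm_continuous[OF \<xi> \<eta>]]) simp
  have "fdist E (p y) (\<xi> (p y)) (f y) < \<delta>"
    using O'(2,3) hnorm_hdiff_commute[OF fib_semi[OF p_top[OF y]]] car[OF y] by metis
  then have "y \<in> ?W"
    using tri[OF y car(2)[OF y] car(1)[OF y] car(3)[OF y]] y \<delta> by (simp add: \<delta>_def field_simps)
  moreover have "O' \<inter> ?W \<subseteq> ?U"
  proof
    fix z assume z: "z \<in> O' \<inter> ?W"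
    then have zY: "z \<in> topspace Y" by simp
    show "z \<in> ?U" using tri[OF zY car(1)[OF zY] car(2)[OF zY] car(3)[OF zY]] O'(3)[of z] z by auto
  qed
  ultimately show "\<exists>T. openin Y T \<and> y \<in> T \<and> T \<subseteq> ?U"
    using O'(1,2) W by (intro exI[of _ "O' \<inter> ?W"]) (auto intro: openin_Int)
qed

text \<open>Tubes around sections pull back to open sets exactly if sections approximate \<open>f\<close> locally uniformly,
  because sections are fibrewise dense and have continuous norms. The approximation form is the one
  that passes to sums.\<close>

lemma continuous_map_total_top_iff:
  "continuous_map Y (total_top X E) (\<lambda>y. (p y, f y)) \<longleftrightarrow> continuous_along Y E p f"
proof
  assume cont: "continuous_map Y (total_top X E) (\<lambda>y. (p y, f y))"
  have f: "f y \<in> hcar (fib E (p y))" if "y \<in> topspace Y" for y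
  proof -
    have "(p y, f y) \<in> topspace (total_top X E)"
      using cont that by (auto simp: continuous_map_def)
    then show ?thesis by (auto simp: total_top_def tube_def)
  qed
  show "continuous_along Y E p f"
    unfolding continuous_along_def
  proof (intro conjI ballI allI impI f)
    fix y and \<delta> :: real assume y: "y \<in> topspace Y" and \<delta>: "\<delta> > 0"
    obtain \<xi> where \<xi>: "\<xi> \<in> sec E" "fdist E (p y) (f y) (\<xi> (p y)) < \<delta>"
      using sec_dense[OF p_top[OF y] f[OF y] \<delta>] by blast
    have "openin (total_top X E) (tube E (topspace X) \<xi> \<delta>)"
      unfolding total_top_def using \<xi>(1) \<delta> by (intro topology_generated_by_Basis) blast
    then have "openin Y {z \<in> topspace Y. (p z, f z) \<in> tube E (topspace X) \<xi> \<delta>}"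
      by (rule openin_continuous_map_preimage[OF cont])
    then show "\<exists>\<xi>\<in>sec E. \<exists>O'. openin Y O' \<and> y \<in> O' \<and>
        (\<forall>z\<in>O'. fdist E (p z) (f z) (\<xi> (p z)) < \<delta>)"
      using \<xi> y p_top[OF y] f[OF y]
      by (intro bexI[of _ \<xi>] exI[of _ "{z \<in> topspace Y. (p z, f z) \<in> tube E (topspace X) \<xi> \<delta>}"])
         (auto simp: tube_def)
  qed
next
  assume f: "continuous_along Y E p f"
  then have car: "f y \<in> hcar (fib E (p y))" if "y \<in> topspace Y" for y
    using that by (simp add: continuous_along_def)
  show "continuous_map Y (total_top X E) (\<lambda>y. (p y, f y))"
    unfolding total_top_def
  proof (rule continuous_on_generated_topo)
    fix U assume "U \<in> {tube E V \<xi> \<epsilon> | V \<xi> \<epsilon>. openin X V \<and> \<xi> \<in> sec E \<and> \<epsilon> > 0}"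
    then obtain V \<xi> \<epsilon> where V: "openin X V" and \<xi>: "\<xi> \<in> sec E" and U: "U = tube E V \<xi> \<epsilon>" by blast
    have "(\<lambda>y. (p y, f y)) -` U \<inter> topspace Y = {y \<in> topspace Y. p y \<in> V} \<inter>
        {y \<in> topspace Y. fdist E (p y) (f y) (\<xi> (p y)) < \<epsilon>}"
      using car by (auto simp: U tube_def)
    then show "openin Y ((\<lambda>y. (p y, f y)) -` U \<inter> topspace Y)"
      using openin_continuous_map_preimage[OF p V] openin_hnorm_hdiff_less[OF f \<xi>] by (simp add: openin_Int)
  next
    show "(\<lambda>y. (p y, f y)) ` topspace Y \<subseteq> \<Union>{tube E V \<xi> \<epsilon> | V \<xi> \<epsilon>. openin X V \<and> \<xi> \<in> sec E \<and> \<epsilon> > 0}"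
    proof (rule image_subsetI)
      fix y assume y: "y \<in> topspace Y"
      obtain \<xi> where "\<xi> \<in> sec E" "fdist E (p y) (f y) (\<xi> (p y)) < 1"
        using sec_dense[OF p_top[OF y] car[OF y], of 1] by auto
      then have "(p y, f y) \<in> tube E (topspace X) \<xi> 1"
        using p_top[OF y] car[OF y] by (simp add: tube_def)
      moreover have "tube E (topspace X) \<xi> 1 \<in> {tube E V \<xi> \<epsilon> | V \<xi> \<epsilon>. openin X V \<and> \<xi> \<in> sec E \<and> \<epsilon> > 0}"
        using \<open>\<xi> \<in> sec E\<close> zero_less_one by blast
      ultimately show "(p y, f y) \<in> \<Union>{tube E V \<xi> \<epsilon> | V \<xi> \<epsilon>. openin X V \<and> \<xi> \<in> sec E \<and> \<epsilon> > 0}" by blast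
    qed
  qed
qed

lemma continuous_along_zero: "continuous_along Y E p (\<lambda>y. hzero (fib E (p y)))"
  unfolding continuous_along_def
proof (intro conjI ballI allI impI)
  show "hzero (fib E (p y)) \<in> hcar (fib E (p y))" if "y \<in> topspace Y" for y
    using hilbert_space_hzero(1)[OF fib_hilbert[OF p_top[OF that]]] .
  show "\<exists>\<xi>\<in>sec E. \<exists>O'. openin Y O' \<and> y \<in> O' \<and>
      (\<forall>z\<in>O'. fdist E (p z) (hzero (fib E (p z))) (\<xi> (p z)) < \<delta>)"
    if "y \<in> topspace Y" "\<delta> > 0" for y \<delta>
  proof (intro bexI[OF _ sec_zero] exI[of _ "topspace Y"] conjI ballI)
    fix z assume "z \<in> topspace Y"
    note z = p_top[OF this]
    show "fdist E (p z) (hzero (fib E (p z)))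
        ((\<lambda>u\<in>topspace X. hzero (fib E u)) (p z)) < \<delta>"
      using hnorm_hdiff_self[OF fib_semi[OF z] hilbert_space_hzero(1)[OF fib_hilbert[OF z]]] z that
      by simp
  qed (use that in auto)
qed

lemma continuous_along_hadd:
  assumes f: "continuous_along Y E p f" and g: "continuous_along Y E p g"
  shows "continuous_along Y E p (\<lambda>y. hadd (fib E (p y)) (f y) (g y))"
  unfolding continuous_along_def
proof (intro conjI ballI allI impI)
  have car: "f y \<in> hcar (fib E (p y))" "g y \<in> hcar (fib E (p y))" if "y \<in> topspace Y" for y
    using f g that by (simp_all add: continuous_along_def)
  show "hadd (fib E (p y)) (f y) (g y) \<in> hcar (fib E (p y))" if "y \<in> topspace Y" for y
    using car[OF that] semi_inner_spaceD(1)[OF fib_semi[OF p_top[OF that]]] by blast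
  fix y and \<delta> :: real assume y: "y \<in> topspace Y" and "\<delta> > 0"
  then have \<delta>: "\<delta> / 2 > 0" by simp
  obtain \<xi> O1 where \<xi>: "\<xi> \<in> sec E" and O1: "openin Y O1" "y \<in> O1"
    "\<And>z. z \<in> O1 \<Longrightarrow> fdist E (p z) (f z) (\<xi> (p z)) < \<delta> / 2"
    by (rule continuous_along_approx[OF f y \<delta>]) blast
  obtain \<eta> O2 where \<eta>: "\<eta> \<in> sec E" and O2: "openin Y O2" "y \<in> O2"
    "\<And>z. z \<in> O2 \<Longrightarrow> fdist E (p z) (g z) (\<eta> (p z)) < \<delta> / 2"
    by (rule continuous_along_approx[OF g y \<delta>]) blast
  show "\<exists>\<xi>\<in>sec E. \<exists>O'. openin Y O' \<and> y \<in> O' \<and>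
      (\<forall>z\<in>O'. fdist E (p z) (hadd (fib E (p z)) (f z) (g z)) (\<xi> (p z)) < \<delta>)"
  proof (intro bexI[OF _ sec_hadd[OF \<xi> \<eta>]] exI[of _ "O1 \<inter> O2"] conjI ballI)
    fix z assume z: "z \<in> O1 \<inter> O2"
    then have zY: "z \<in> topspace Y" using O1(1) openin_subset by blast
    note zX = p_top[OF zY]
    show "fdist E (p z) (hadd (fib E (p z)) (f z) (g z))
        ((\<lambda>u\<in>topspace X. hadd (fib E u) (\<xi> u) (\<eta> u)) (p z)) < \<delta>"
      using hnorm_hdiff_hadd_le[OF fib_semi[OF zX] car(1)[OF zY] car(2)[OF zY]
          sec_hcar[OF \<xi> zX] sec_hcar[OF \<eta> zX]] O1(3)[of z] O2(3)[of z] z zX by simp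
  qed (use O1 O2 in auto)
qed

lemma continuous_along_hscale:
  assumes f: "continuous_along Y E p f"
  shows "continuous_along Y E p (\<lambda>y. hscale (fib E (p y)) a (f y))"
  unfolding continuous_along_def
proof (intro conjI ballI allI impI)
  have car: "f y \<in> hcar (fib E (p y))" if "y \<in> topspace Y" for y
    using f that by (simp add: continuous_along_def)
  show "hscale (fib E (p y)) a (f y) \<in> hcar (fib E (p y))" if "y \<in> topspace Y" for y
    using car[OF that] semi_inner_spaceD(2)[OF fib_semi[OF p_top[OF that]]] by blast
  fix y and \<delta> :: real assume y: "y \<in> topspace Y" and "\<delta> > 0"
  then have \<delta>: "\<delta> / (cmod a + 1) > 0" by (simp add: add_nonneg_pos)
  obtain \<xi> O1 where \<xi>: "\<xi> \<in> sec E" and O1: "openin Y O1" "y \<in> O1"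
    "\<And>z. z \<in> O1 \<Longrightarrow> fdist E (p z) (f z) (\<xi> (p z)) < \<delta> / (cmod a + 1)"
    by (rule continuous_along_approx[OF f y \<delta>]) blast
  show "\<exists>\<xi>\<in>sec E. \<exists>O'. openin Y O' \<and> y \<in> O' \<and>
      (\<forall>z\<in>O'. fdist E (p z) (hscale (fib E (p z)) a (f z)) (\<xi> (p z)) < \<delta>)"
  proof (intro bexI[OF _ sec_hscale[OF \<xi>, of a]] exI[of _ O1] conjI ballI)
    fix z assume z: "z \<in> O1"
    then have zY: "z \<in> topspace Y" using O1(1) openin_subset by blast
    note zX = p_top[OF zY]
    let ?n = "fdist E (p z) (f z) (\<xi> (p z))"
    have "cmod a * ?n \<le> (cmod a + 1) * ?n"
      using hnorm_nonneg[OF fib_semi[OF zX] hdiff_in_hcar[OF fib_semi[OF zX] car[OF zY] sec_hcar[OF \<xi> zX]]]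
      by (simp add: mult_right_mono)
    also have "\<dots> < \<delta>" using O1(3)[OF z] by (simp add: pos_less_divide_eq add_nonneg_pos mult.commute)
    finally show "fdist E (p z) (hscale (fib E (p z)) a (f z))
        ((\<lambda>u\<in>topspace X. hscale (fib E u) a (\<xi> u)) (p z)) < \<delta>"
      using hnorm_hdiff_hscale[OF fib_semi[OF zX] car[OF zY] sec_hcar[OF \<xi> zX], of a] zX by simp
  qed (use O1 in auto)
qed

lemma continuous_along_hnorm:
  assumes f: "continuous_along Y E p f"
  shows "continuous_map Y euclideanreal (\<lambda>y. hnorm (fib E (p y)) (f y))"
  unfolding continuous_map_upper_lower_semicontinuous_lt
proof (intro conjI allI)
  have car: "f y \<in> hcar (fib E (p y))" if "y \<in> topspace Y" for y
    using f that by (simp add: continuous_along_def)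
  show "openin Y {y \<in> topspace Y. hnorm (fib E (p y)) (f y) < a}" for a
  proof -
    have "hdiff (fib E (p y)) (f y) ((\<lambda>u\<in>topspace X. hzero (fib E u)) (p y)) = f y"
      if "y \<in> topspace Y" for y
      using hilbert_space_hzero(4)[OF fib_hilbert[OF p_top[OF that]] car[OF that]] p_top[OF that] by simp
    then have "{y \<in> topspace Y. hnorm (fib E (p y)) (f y) < a} = {y \<in> topspace Y.
        fdist E (p y) (f y) ((\<lambda>u\<in>topspace X. hzero (fib E u)) (p y)) < a}"
      by (intro Collect_cong conj_cong refl) (simp only:)
    then show ?thesis using openin_hnorm_hdiff_less[OF f sec_zero, of a] by simp
  qed
  show "openin Y {y \<in> topspace Y. a < hnorm (fib E (p y)) (f y)}" (is "openin Y ?U") for a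
  proof (subst openin_subopen, intro ballI)
    fix y assume "y \<in> ?U"
    then have y: "y \<in> topspace Y" and less: "a < hnorm (fib E (p y)) (f y)" by auto
    define \<delta> where "\<delta> = (hnorm (fib E (p y)) (f y) - a) / 2"
    have \<delta>: "\<delta> > 0" using less by (simp add: \<delta>_def)
    obtain \<xi> O' where \<xi>: "\<xi> \<in> sec E" and O': "openin Y O'" "y \<in> O'"
      "\<And>z. z \<in> O' \<Longrightarrow> fdist E (p z) (f z) (\<xi> (p z)) < \<delta>"
      by (rule continuous_along_approx[OF f y \<delta>]) blast
    let ?W = "{z \<in> topspace Y. hnorm (fib E (p z)) (\<xi> (p z)) \<in> {a + \<delta><..}}"
    have W: "openin Y ?W"
      by (intro openin_continuous_map_preimage[OF sec_hnorm_continuous[OF \<xi>]]) simp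
    have "y \<in> ?W"
      using hnorm_le_hdiff[OF fib_semi[OF p_top[OF y]] car[OF y] sec_hcar[OF \<xi> p_top[OF y]]] y
        O'(3)[OF O'(2)] by (simp add: \<delta>_def field_simps)
    moreover have "O' \<inter> ?W \<subseteq> ?U"
    proof
      fix z assume z: "z \<in> O' \<inter> ?W"
      then have zY: "z \<in> topspace Y" by simp
      note zX = p_top[OF zY]
      have "hnorm (fib E (p z)) (\<xi> (p z)) \<le> hnorm (fib E (p z)) (f z)
          + fdist E (p z) (f z) (\<xi> (p z))"
        using hnorm_le_hdiff[OF fib_semi[OF zX] sec_hcar[OF \<xi> zX] car[OF zY]]
          hnorm_hdiff_commute[OF fib_semi[OF zX] sec_hcar[OF \<xi> zX] car[OF zY]] by simp
      then show "z \<in> ?U" using z O'(3)[of z] by auto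
    qed
    ultimately show "\<exists>T. openin Y T \<and> y \<in> T \<and> T \<subseteq> ?U"
      using O'(1,2) W by (intro exI[of _ "O' \<inter> ?W"]) (auto intro: openin_Int)
  qed
qed

text \<open>By polarisation, continuity of inner products follows from that of norms.\<close>

lemma continuous_along_hinner:
  assumes f: "continuous_along Y E p f" and g: "continuous_along Y E p g"
  shows "continuous_map Y euclidean (\<lambda>y. hinner (fib E (p y)) (f y) (g y))"
proof -
  let ?N = "\<lambda>h y. (hnorm (fib E (p y)) (h y))\<^sup>2"
  let ?P = "\<lambda>a y. (?N (\<lambda>y. hadd (fib E (p y)) (f y) (hscale (fib E (p y)) a (g y))) y - ?N f y - ?N g y) / 2"
  have N: "continuous_map Y euclideanreal (?N h)" if "continuous_along Y E p h" for h
    using continuous_along_hnorm[OF that] by (simp add: continuous_map_real_pow)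
  have P: "continuous_map Y euclideanreal (?P a)" for a
    by (intro continuous_map_real_divide continuous_map_diff N f g continuous_along_hadd
        continuous_along_hscale continuous_map_const[THEN iffD2]) auto
  have C: "continuous_map Y euclidean (\<lambda>y. complex_of_real (?P a y))" for a
    using continuous_map_compose[OF P, of euclidean complex_of_real a]
    by (simp add: o_def continuous_on_of_real_id)
  have "continuous_map Y euclidean (\<lambda>y. complex_of_real (?P 1 y) + \<i> * complex_of_real (?P \<i> y))"
    using continuous_map_compose[OF C, of euclidean "\<lambda>z. \<i> * z" \<i>]
    by (intro continuous_map_add C) (simp add: o_def continuous_on_mult_left)
  then show ?thesis
  proof (rule continuous_map_eq)
    fix y assume y: "y \<in> topspace Y"
    let ?V = "fib E (p y)"
    note V = fib_semi[OF p_top[OF y]]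
    have car: "f y \<in> hcar ?V" "g y \<in> hcar ?V"
      using f g y by (simp_all add: continuous_along_def)
    have gf: "hinner ?V (g y) (f y) = cnj (hinner ?V (f y) (g y))"
      using semi_inner_spaceD(5)[OF V car(2,1)] .
    have sq: "(hnorm ?V v)\<^sup>2 = Re (hinner ?V v v)" if "v \<in> hcar ?V" for v
      using hinner_self[OF V that] by simp
    have "?P a y = Re (cnj a * hinner ?V (f y) (g y))" if "cmod a = 1" for a
    proof -
      have a1: "a * cnj a = 1" using that by (simp add: complex_norm_square[symmetric])
      have "hinner ?V (hadd ?V (f y) (hscale ?V a (g y))) (hadd ?V (f y) (hscale ?V a (g y)))
          = hinner ?V (f y) (f y) + cnj a * hinner ?V (f y) (g y)
            + cnj (cnj a * hinner ?V (f y) (g y)) + (a * cnj a) * hinner ?V (g y) (g y)"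
        using car by (simp add: semi_inner_expand[OF V] gf algebra_simps)
      then show ?thesis using car by (simp add: sq semi_inner_spaceD(1,2)[OF V] a1)
    qed
    from this[of 1] this[of \<i>]
    show "complex_of_real (?P 1 y) + \<i> * complex_of_real (?P \<i> y) = hinner ?V (f y) (g y)"
      by (simp add: complex_eq_iff)
  qed
qed

end

section \<open>The coset space\<close>

lemma openin_coset_top:
  "openin (coset_top G H) U \<longleftrightarrow>
     U \<subseteq> coset G H ` garr G \<and> openin (gtop G) {x \<in> garr G. coset G H x \<in> U}"
proof -
  have "istopology (\<lambda>U. U \<subseteq> coset G H ` garr G \<and> openin (gtop G) {x \<in> garr G. coset G H x \<in> U})"
    unfolding istopology_def
  proof (intro conjI allI impI)
    fix U V assume U: "U \<subseteq> coset G H ` garr G \<and> openin (gtop G) {x \<in> garr G. coset G H x \<in> U}"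
      and V: "V \<subseteq> coset G H ` garr G \<and> openin (gtop G) {x \<in> garr G. coset G H x \<in> V}"
    have "{x \<in> garr G. coset G H x \<in> U \<inter> V} = {x \<in> garr G. coset G H x \<in> U} \<inter> {x \<in> garr G. coset G H x \<in> V}"
      by blast
    then show "openin (gtop G) {x \<in> garr G. coset G H x \<in> U \<inter> V}" using U V by (simp add: openin_Int)
    show "U \<inter> V \<subseteq> coset G H ` garr G" using U by blast
  next
    fix \<K> assume K: "\<forall>U\<in>\<K>. U \<subseteq> coset G H ` garr G \<and> openin (gtop G) {x \<in> garr G. coset G H x \<in> U}"
    have "{x \<in> garr G. coset G H x \<in> \<Union>\<K>} = (\<Union>U\<in>\<K>. {x \<in> garr G. coset G H x \<in> U})" by blast
    then show "openin (gtop G) {x \<in> garr G. coset G H x \<in> \<Union>\<K>}" using K by auto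
    show "\<Union>\<K> \<subseteq> coset G H ` garr G" using K by blast
  qed
  then show ?thesis by (simp add: coset_top_def topology_inverse')
qed

lemma topspace_coset_top: "topspace (coset_top G H) = coset G H ` garr G"
proof -
  have "{x \<in> garr G. coset G H x \<in> coset G H ` garr G} = topspace (gtop G)" by (auto simp: garr_def)
  then have "openin (coset_top G H) (coset G H ` garr G)" by (simp add: openin_coset_top)
  then show ?thesis using openin_subset openin_topspace openin_coset_top by (metis subset_antisym)
qed

lemma quotient_map_coset: "quotient_map (gtop G) (coset_top G H) (coset G H)"
  by (auto simp: quotient_map_def topspace_coset_top openin_coset_top garr_def)

locale inducing_data =
  fixes G :: "'g groupoid" and H :: "'g set" and lamH :: "'g \<Rightarrow> 'g measure"
    and mu :: "'g \<Rightarrow> 'g set measure" and S :: "('g, 'v) grep"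
  assumes top_groupoid: "topological_groupoid G"
    and locally_compact: "locally_compact_space (gtop G)" and Hausdorff: "Hausdorff_space (gtop G)"
    and wide_H: "wide_subgroupoid G H" and closed_H: "closedin (gtop G) H"
    and haar: "haar_system (grestrict G H) lamH"
    and equivariant: "full_equivariant_system G H mu"
    and rep: "unitary_rep (grestrict G H) S"
begin

abbreviation "q \<equiv> coset G H"
abbreviation "Q \<equiv> coset_top G H"
abbreviation "X \<equiv> gunit_top G"

lemma grpd: "is_groupoid G"
  by (rule topological_groupoid_is_groupoid[OF top_groupoid])

lemma topspace_X: "topspace X = gunits G"
  by (rule topspace_gunit_top[OF grpd])

lemma topspace_gtop: "topspace (gtop G) = garr G"
  by (simp add: garr_def)

lemma subgrp: "subgroupoid G H"
  using wide_H by (simp add: wide_subgroupoid_def)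

lemma H_arr: "h \<in> H \<Longrightarrow> h \<in> garr G"
  and H_inv: "h \<in> H \<Longrightarrow> ginv G h \<in> H"
  and H_mult: "h \<in> H \<Longrightarrow> k \<in> H \<Longrightarrow> gdom G h = grng G k \<Longrightarrow> gmult G h k \<in> H"
  using subgrp by (auto simp: subgroupoid_def)

lemma gtop_restrict: "gtop (grestrict G H) = subtopology (gtop G) H"
  by (simp add: grestrict_def)

lemma garr_restrict: "garr (grestrict G H) = H"
  using H_arr by (auto simp: garr_def grestrict_def)

lemma grng_restrict: "grng (grestrict G H) = grng G" "gdom (grestrict G H) = gdom G"
  "ginv (grestrict G H) = ginv G"
  by (auto simp: grestrict_def grng_def gdom_def fun_eq_iff)

lemma gunits_restrict: "gunits (grestrict G H) = gunits G"
  using wide_H by (simp add: wide_subgroupoid_def)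

lemma units_H: "u \<in> gunits G \<Longrightarrow> u \<in> H"
proof -
  assume "u \<in> gunits G"
  then obtain h where h: "h \<in> H" and u: "u = gmult G h (ginv G h)"
    unfolding gunits_restrict[symmetric] by (auto simp: gunits_def garr_restrict grng_restrict grng_def)
  show "u \<in> H"
    unfolding u using h by (intro H_mult) (simp_all add: H_inv grng_ginv[OF grpd] H_arr)
qed

lemma gunit_top_restrict: "gunit_top (grestrict G H) = X"
proof -
  have "H \<inter> gunits G = gunits G" using units_H by blast
  then show ?thesis
    by (simp add: gunit_top_def gunits_restrict gtop_restrict subtopology_subtopology)
qed

lemma bundle_S: "hilbert_bundle X (bun S)"
  using rep by (simp add: unitary_rep_def gunit_top_restrict)

lemma act_unitary: "h \<in> H \<Longrightarrow> hunitary (rfib S (gdom G h)) (rfib S (grng G h)) (act S h)"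
  using rep by (simp add: unitary_rep_def garr_restrict grng_restrict)

lemma fib_S: "u \<in> gunits G \<Longrightarrow> hilbert_space (rfib S u)"
  using bundle_S by (simp add: hilbert_bundle_def topspace_X)

lemma fib_S_semi: "u \<in> gunits G \<Longrightarrow> semi_inner_space (rfib S u)"
  by (rule hilbert_space_imp_semi_inner[OF fib_S])

lemma cont_dom: "continuous_map (gtop G) X (gdom G)"
  by (rule continuous_map_grng(2)[OF top_groupoid])

text \<open>The range map of \<open>H\<close> is open: a bump function at an arrow has, by continuity of the Haar
  system, nonzero integral over all fibres near its range, and these fibres must then meet the
  set where the bump lives.\<close>

lemma openin_grng_image:
  assumes U: "openin (subtopology (gtop G) H) U"
  shows "openin X (grng G ` U)"
proof (subst openin_subopen, intro ballI)
  let ?Y = "subtopology (gtop G) H"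
  have topY: "topspace ?Y = H" using H_arr by (auto simp: garr_def)
  fix u0 assume "u0 \<in> grng G ` U"
  then obtain h0 where h0: "h0 \<in> U" and u0: "u0 = grng G h0" by blast
  have h0H: "h0 \<in> H" using h0 openin_subset[OF U] topY by blast
  have lcY: "locally_compact_space ?Y"
    by (rule locally_compact_space_closed_subset[OF locally_compact closed_H])
  have hausY: "Hausdorff_space ?Y" by (rule Hausdorff_space_subtopology[OF Hausdorff])
  obtain U0 K where U0: "openin ?Y U0" "h0 \<in> U0" "U0 \<subseteq> K" and K: "compactin ?Y K"
    using lcY h0H topY unfolding locally_compact_space_def by metis
  have W: "openin ?Y (U \<inter> U0)" using U U0 by (simp add: openin_Int)
  have "completely_regular_space ?Y"
    using locally_compact_regular_imp_completely_regular_space lcY hausY by blast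
  moreover have "closedin ?Y (topspace ?Y - U \<inter> U0)" using W by (rule closedin_diff[OF closedin_topspace])
  moreover have "h0 \<in> topspace ?Y - (topspace ?Y - U \<inter> U0)" using h0 h0H U0 topY by simp
  ultimately obtain f :: "'g \<Rightarrow> real" where f: "continuous_map ?Y (top_of_set {0..1}) f" "f h0 = 0"
    "f ` (topspace ?Y - U \<inter> U0) \<subseteq> {1}"
    unfolding completely_regular_space_def by meson
  define g where "g = (\<lambda>h. complex_of_real (1 - f h))"
  have f01: "0 \<le> f h \<and> f h \<le> 1" if "h \<in> H" for h
    using f(1) that topY by (auto simp: continuous_map_def)
  have "continuous_map ?Y euclideanreal f" using f(1) continuous_map_into_fulltopology by blast
  then have "continuous_map ?Y euclidean ((\<lambda>r. complex_of_real (1 - r)) \<circ> f)"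
    by (rule continuous_map_compose) (simp add: continuous_intros)
  then have g_cont: "continuous_map ?Y euclidean g" by (simp add: g_def o_def)
  have g0: "g h = 0" if "h \<in> H" "h \<notin> U \<inter> U0" for h
    using f(3) that topY by (auto simp: g_def)
  have g_Cc: "g \<in> Cc ?Y"
    by (rule Cc_if_vanishing_off_compact[OF g_cont K compactin_imp_closedin[OF hausY K]])
       (use g0 U0 topY in auto)
  define I where "I = (\<lambda>u. LINT y|lamH u. g y)"
  have radon: "radon_measure ?Y (lamH u)" "measure_support ?Y (lamH u) = {h \<in> H. grng G h = u}"
    if "u \<in> gunits G" for u
    using haar that
    by (auto simp: haar_system_def gtop_restrict gunits_restrict grng_fibre_def garr_restrict grng_restrict)
  have I_cont: "continuous_map X euclidean I"
    using haar g_Cc unfolding I_def by (simp add: haar_system_def gtop_restrict gunit_top_restrict)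
  have u0U: "u0 \<in> gunits G" unfolding u0 by (rule grng_unit[OF grpd H_arr[OF h0H]])
  have "I u0 \<noteq> 0" unfolding I_def
    by (rule radon_integral_nonzero[OF radon(1)[OF u0U] g_Cc, of h0])
       (use f01 f(2) radon(2)[OF u0U] h0H u0 topY in \<open>auto simp: g_def\<close>)
  moreover have "openin X {u \<in> topspace X. I u \<in> - {0}}"
    by (rule openin_continuous_map_preimage[OF I_cont]) (simp add: open_Compl)
  moreover have "{u \<in> topspace X. I u \<in> - {0}} \<subseteq> grng G ` U"
  proof
    fix u assume "u \<in> {u \<in> topspace X. I u \<in> - {0}}"
    then have u: "u \<in> gunits G" and "I u \<noteq> 0" by (auto simp: topspace_X)
    then obtain h where "h \<in> measure_support ?Y (lamH u)" "g h \<noteq> 0"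
      using radon_integral_zero[OF radon(1)[OF u] g_cont] unfolding I_def by blast
    then have "h \<in> H" "grng G h = u" "h \<in> U" using g0 radon(2)[OF u] by auto
    then show "u \<in> grng G ` U" by blast
  qed
  ultimately show "\<exists>T. openin X T \<and> u0 \<in> T \<and> T \<subseteq> grng G ` U"
    using u0U topspace_X by (intro exI[of _ "{u \<in> topspace X. I u \<in> - {0}}"]) auto
qed

text \<open>If \<open>x\<^sub>0 h\<^sub>0\<close> lies in \<open>W\<close>, then so does \<open>x h\<close> for composable \<open>x\<close>, \<open>h\<close> near \<open>x\<^sub>0\<close>, \<open>h\<^sub>0\<close>; openness of the
  range map of \<open>H\<close> supplies such an \<open>h\<close> for every \<open>x\<close> near \<open>x\<^sub>0\<close>.\<close>

lemma openin_right_saturation: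
  assumes W: "openin (gtop G) W"
  shows "openin (gtop G) {x \<in> garr G. \<exists>h\<in>H. (x, h) \<in> gcomposable G \<and> gmult G x h \<in> W}" (is "openin _ ?R")
proof (subst openin_subopen, intro ballI)
  let ?P = "subtopology (prod_topology (gtop G) (gtop G)) (gcomposable G)"
  fix x0 assume "x0 \<in> ?R"
  then obtain h0 where h0: "h0 \<in> H" "(x0, h0) \<in> gcomposable G" "gmult G x0 h0 \<in> W" by blast
  have mult: "continuous_map ?P (gtop G) (\<lambda>(x, y). gmult G x y)"
    using top_groupoid by (simp add: topological_groupoid_def)
  have "openin ?P {p \<in> topspace ?P. (\<lambda>(x, y). gmult G x y) p \<in> W}"
    by (rule openin_continuous_map_preimage[OF mult W])
  then obtain T where T: "openin (prod_topology (gtop G) (gtop G)) T"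
    and TP: "{p \<in> topspace ?P. (\<lambda>(x, y). gmult G x y) p \<in> W} = T \<inter> gcomposable G"
    unfolding openin_subtopology by blast
  have topP: "topspace ?P = gcomposable G" by (auto simp: garr_def gcomposable_def)
  have "(x0, h0) \<in> T \<inter> gcomposable G" unfolding TP[symmetric] topP using h0 by simp
  then have "(x0, h0) \<in> T" by blast
  then obtain U V where U: "openin (gtop G) U" "x0 \<in> U" and V: "openin (gtop G) V" "h0 \<in> V"
    and UV: "U \<times> V \<subseteq> T"
    using T unfolding openin_prod_topology_alt by blast
  have "openin (subtopology (gtop G) H) (H \<inter> V)" using V by (simp add: openin_subtopology_Int2)
  then have rV: "openin X (grng G ` (H \<inter> V))" by (rule openin_grng_image)
  let ?O = "U \<inter> {x \<in> topspace (gtop G). gdom G x \<in> grng G ` (H \<inter> V)}"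
  have "openin (gtop G) ?O"
    using U openin_continuous_map_preimage[OF cont_dom rV] by (simp add: openin_Int)
  moreover have "x0 \<in> ?O"
    using U V h0 by (auto simp: gcomposable_def garr_def)
  moreover have "?O \<subseteq> ?R"
  proof
    fix x assume x: "x \<in> ?O"
    then obtain h where h: "h \<in> H" "h \<in> V" "gdom G x = grng G h" by auto
    have xh: "(x, h) \<in> gcomposable G"
      using x h H_arr by (auto simp: gcomposable_def garr_def)
    then have "(x, h) \<in> T \<inter> gcomposable G" using UV x h by blast
    then have "gmult G x h \<in> W" unfolding TP[symmetric] by simp
    then show "x \<in> ?R" using h xh x by (auto simp: garr_def)
  qed
  ultimately show "\<exists>T. openin (gtop G) T \<and> x0 \<in> T \<and> T \<subseteq> ?R" by blast
qed

lemma self_in_coset: "x \<in> garr G \<Longrightarrow> x \<in> q x"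
  unfolding coset_def
  by (intro CollectI exI[of _ "gdom G x"])
     (simp add: gmult_gdom[OF grpd] units_H[OF gdom_unit[OF grpd]] grng_gdom[OF grpd])

lemma coset_memE:
  assumes "x \<in> garr G" "y \<in> q x"
  obtains h where "h \<in> H" "(x, h) \<in> gcomposable G" "y = gmult G x h"
  using assms H_arr by (fastforce simp: coset_def gcomposable_def)

lemma coset_mem_arr: "x \<in> garr G \<Longrightarrow> y \<in> q x \<Longrightarrow> y \<in> garr G"
  using coset_memE gmult_arr[OF grpd] by metis

lemma coset_mem_grng: "x \<in> garr G \<Longrightarrow> y \<in> q x \<Longrightarrow> grng G y = grng G x"
  using coset_memE grng_gmult[OF grpd] by metis

text \<open>The closure of an \<open>H\<close>-invariant set is again \<open>H\<close>-invariant: if \<open>x\<close> has a neighbourhood missing the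
  set, then the right saturation of that neighbourhood misses it too, and is open.\<close>

lemma closedin_coset_image:
  assumes A: "A \<subseteq> garr G"
    and inv: "\<And>x h. x \<in> A \<Longrightarrow> h \<in> H \<Longrightarrow> (x, h) \<in> gcomposable G \<Longrightarrow> gmult G x h \<in> A"
  shows "closedin Q (q ` (gtop G closure_of A))"
proof -
  let ?cl = "gtop G closure_of A"
  have cl_arr: "?cl \<subseteq> garr G" using closure_of_subset_topspace by (fastforce simp: garr_def)
  have sat: "x \<in> ?cl" if x: "x \<in> garr G" and qx: "q x \<in> q ` ?cl" for x
  proof (rule ccontr)
    obtain y where y: "y \<in> ?cl" "q x = q y" using qx by blast
    assume "x \<notin> ?cl"
    let ?W = "garr G - ?cl"
    let ?R = "{z \<in> garr G. \<exists>h\<in>H. (z, h) \<in> gcomposable G \<and> gmult G z h \<in> ?W}"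
    have W: "openin (gtop G) ?W" by (simp add: garr_def openin_diff)
    have yarr: "y \<in> garr G" using y cl_arr by blast
    have "x \<in> q y" using self_in_coset[OF x] y(2) by simp
    then obtain h where "h \<in> H" "(y, h) \<in> gcomposable G" "x = gmult G y h"
      using coset_memE[OF yarr] by metis
    then have "y \<in> ?R" using \<open>x \<notin> ?cl\<close> x yarr by blast
    moreover have "openin (gtop G) ?R" by (rule openin_right_saturation[OF W])
    moreover have "\<forall>T. y \<in> T \<and> openin (gtop G) T \<longrightarrow> (\<exists>a. a \<in> A \<and> a \<in> T)"
      using y(1) by (simp add: in_closure_of)
    ultimately have "\<exists>a. a \<in> A \<and> a \<in> ?R" by (metis (no_types, lifting))
    then obtain a h where a: "a \<in> A" and "h \<in> H" "(a, h) \<in> gcomposable G" "gmult G a h \<in> ?W"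
      by (elim exE conjE CollectE bexE)
    then show False
      using inv[OF a] closure_of_subset[of A "gtop G"] A by (auto simp: garr_def)
  qed
  have "openin Q (topspace Q - q ` ?cl)"
    unfolding openin_coset_top
  proof
    have "{x \<in> garr G. q x \<in> topspace Q - q ` ?cl} = topspace (gtop G) - ?cl"
      using sat by (auto simp: topspace_coset_top garr_def)
    then show "openin (gtop G) {x \<in> garr G. q x \<in> topspace Q - q ` ?cl}" by (simp add: openin_diff)
  qed (simp add: topspace_coset_top)
  moreover have "q ` ?cl \<subseteq> topspace Q" using cl_arr by (auto simp: topspace_coset_top)
  ultimately show ?thesis by (simp add: closedin_def)
qed

end

section \<open>The pre-Hilbert module of equivariant sections\<close>

context inducing_data
begin

abbreviation "\<H> x \<equiv> rfib S (gdom G x)"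
abbreviation "\<F> \<equiv> ind_F0 G H S"

text \<open>The integrand of \<open>\<langle>f, g\<rangle>\<close>; for equivariant sections the choice of \<open>x\<close> in the coset is immaterial.\<close>

definition coset_fun :: "('g \<Rightarrow> 'v) \<Rightarrow> ('g \<Rightarrow> 'v) \<Rightarrow> 'g set \<Rightarrow> complex" where
  "coset_fun f g A = (let x = some_elem A in hinner (\<H> x) (f x) (g x))"

definition equivariant_section :: "('g \<Rightarrow> 'v) \<Rightarrow> bool" where
  "equivariant_section f \<longleftrightarrow>
     (\<forall>x\<in>garr G. f x \<in> hcar (\<H> x)) \<and>
     (\<forall>x\<in>garr G. \<forall>h\<in>H. (x, h) \<in> gcomposable G \<longrightarrow> f (gmult G x h) = act S (ginv G h) (f x))"

abbreviation "nonzero_set f \<equiv> {x \<in> garr G. f x \<noteq> hzero (\<H> x)}"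
abbreviation "coset_supp f \<equiv> q ` (gtop G closure_of nonzero_set f)"

lemma ind_ip_eq: "ind_ip G mu S f g u = (LINT A|mu u. coset_fun f g A)"
  by (simp add: ind_ip_def coset_fun_def)

lemma fibS: "x \<in> garr G \<Longrightarrow> hilbert_space (\<H> x)"
  and fibS_semi: "x \<in> garr G \<Longrightarrow> semi_inner_space (\<H> x)"
  using fib_S fib_S_semi gdom_unit[OF grpd] by blast+

lemma hinner_0_iff:
  assumes "x \<in> garr G" "v \<in> hcar (\<H> x)"
  shows "hinner (\<H> x) v v = 0 \<longleftrightarrow> v = hzero (\<H> x)"
proof
  assume "hinner (\<H> x) v v = 0"
  then show "v = hzero (\<H> x)"
    using fibS[OF assms(1)] assms(2) unfolding hilbert_space_def by blast
qed (use hilbert_space_hzero[OF fibS[OF assms(1)]] in simp)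

lemma F0_iff:
  "f \<in> \<F> \<longleftrightarrow> f \<in> extensional (garr G) \<and> continuous_along (gtop G) (bun S) (gdom G) f \<and>
     compactin Q (coset_supp f) \<and> equivariant_section f"
  by (auto simp: ind_F0_def continuous_map_total_top_iff[OF bundle_S cont_dom] equivariant_section_def
      PiE_iff)

lemma F0_D:
  assumes "f \<in> \<F>"
  shows "f \<in> extensional (garr G)" "continuous_along (gtop G) (bun S) (gdom G) f"
    "compactin Q (coset_supp f)" "equivariant_section f"
    and "x \<in> garr G \<Longrightarrow> f x \<in> hcar (\<H> x)"
  using assms by (auto simp: F0_iff equivariant_section_def)

lemma act_ginv_unitary:
  assumes h: "h \<in> H" and xh: "(x, h) \<in> gcomposable G"
  shows "hunitary (\<H> x) (\<H> (gmult G x h)) (act S (ginv G h))"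
proof -
  have "gdom G (ginv G h) = gdom G x" "grng G (ginv G h) = gdom G (gmult G x h)"
    using xh gdom_gmult[OF grpd xh] grng_ginv[OF grpd H_arr[OF h]] gdom_ginv[OF grpd H_arr[OF h]]
    by (simp_all add: gcomposable_def)
  then show ?thesis using act_unitary[OF H_inv[OF h]] by simp
qed

lemma hinner_translate:
  assumes f: "equivariant_section f" and g: "equivariant_section g"
    and x: "x \<in> garr G" and h: "h \<in> H" and xh: "(x, h) \<in> gcomposable G"
  shows "hinner (\<H> (gmult G x h)) (f (gmult G x h)) (g (gmult G x h))
      = hinner (\<H> x) (f x) (g x)"
  using act_ginv_unitary[OF h xh] f g x h xh by (simp add: equivariant_section_def hunitary_def)

lemma some_elem_coset:
  assumes "x \<in> garr G" shows "some_elem (q x) \<in> q x"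
proof (rule some_elem_nonempty)
  show "q x \<noteq> {}" using self_in_coset[OF assms] by (simp add: ex_in_conv[symmetric]) (rule exI)
qed

lemma coset_fun_coset:
  assumes f: "equivariant_section f" and g: "equivariant_section g" and x: "x \<in> garr G"
  shows "coset_fun f g (q x) = hinner (\<H> x) (f x) (g x)"
proof -
  obtain h where h: "h \<in> H" "(x, h) \<in> gcomposable G" and e: "some_elem (q x) = gmult G x h"
    by (rule coset_memE[OF x some_elem_coset[OF x]])
  show ?thesis unfolding coset_fun_def Let_def e by (rule hinner_translate[OF f g x h])
qed

lemma closedin_coset_supp:
  assumes f: "equivariant_section f"
  shows "closedin Q (coset_supp f)"
proof (rule closedin_coset_image)
  fix x h assume x: "x \<in> nonzero_set f" and h: "h \<in> H" and xh: "(x, h) \<in> gcomposable G"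
  have fx: "y \<in> garr G \<Longrightarrow> f y \<in> hcar (\<H> y)" for y
    using f by (simp add: equivariant_section_def)
  have arr: "x \<in> garr G" "gmult G x h \<in> garr G" using x gmult_arr[OF grpd xh] by auto
  have "hinner (\<H> x) (f x) (f x) \<noteq> 0"
    using x hinner_0_iff[OF arr(1) fx[OF arr(1)]] by simp
  then show "gmult G x h \<in> nonzero_set f"
    using hinner_translate[OF f f arr(1) h xh] hinner_0_iff[OF arr(2) fx[OF arr(2)]] arr by auto
qed auto

lemma compactin_coset_supp:
  assumes f: "equivariant_section f" and K: "compactin Q K"
    and sub: "coset_supp f \<subseteq> K"
  shows "compactin Q (coset_supp f)"
  by (rule closed_compactin[OF K sub closedin_coset_supp[OF f]])

lemma off_coset_supp:
  assumes "x \<in> garr G" "q x \<notin> coset_supp f"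
  shows "f x = hzero (\<H> x)"
  using assms closure_of_subset[of "nonzero_set f" "gtop G"] by (auto simp: garr_def)

text \<open>The function lives on the coset support of \<open>f\<close>, which is compact by the definition of \<open>\<F>\<^sub>0\<close> and
  closed by \<open>closedin_coset_supp\<close>; continuity descends along the quotient map.\<close>

lemma coset_fun_Cc:
  assumes f: "f \<in> \<F>" and g: "g \<in> \<F>"
  shows "coset_fun f g \<in> Cc Q"
proof (rule Cc_if_vanishing_off_compact)
  note F = F0_D[OF f] and Gg = F0_D[OF g]
  have "continuous_map (gtop G) euclidean (\<lambda>x. hinner (\<H> x) (f x) (g x))"
    by (rule continuous_along_hinner[OF bundle_S cont_dom F(2) Gg(2)])
  then have "continuous_map (gtop G) euclidean (coset_fun f g \<circ> q)"
    by (rule continuous_map_eq) (simp add: coset_fun_coset[OF F(4) Gg(4)] topspace_gtop)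
  then show "continuous_map Q euclidean (coset_fun f g)"
    by (rule continuous_compose_quotient_map[OF quotient_map_coset])
  show "compactin Q (coset_supp f)" "closedin Q (coset_supp f)"
    using F(3) closedin_coset_supp[OF F(4)] .
  fix A assume A: "A \<in> topspace Q" "A \<notin> coset_supp f"
  then obtain x where x: "x \<in> garr G" "A = q x" by (auto simp: topspace_coset_top)
  have fx: "f x = hzero (\<H> x)" using off_coset_supp[OF x(1), of f] A x(2) by simp
  note V = fibS[OF x(1)]
  have "hinner (\<H> x) (hzero (\<H> x)) (g x)
      = cnj (hinner (\<H> x) (g x) (hzero (\<H> x)))"
    by (rule semi_inner_spaceD(5)[OF fibS_semi[OF x(1)] hilbert_space_hzero(1)[OF V] Gg(5)[OF x(1)]])
  then show "coset_fun f g A = 0"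
    using hilbert_space_hzero(3)[OF V Gg(5)[OF x(1)]] fx
    by (simp add: x(2) coset_fun_coset[OF F(4) Gg(4) x(1)])
qed

lemma mu_radon: "u \<in> gunits G \<Longrightarrow> radon_measure Q (mu u)"
  and mu_support: "u \<in> gunits G \<Longrightarrow> measure_support Q (mu u) = coset_rng_fibre G H u"
  and mu_continuous: "\<phi> \<in> Cc Q \<Longrightarrow> continuous_map X euclidean (\<lambda>u. LINT A|mu u. \<phi> A)"
  using equivariant by (simp_all add: full_equivariant_system_def)

lemma coset_fun_integrable:
  "f \<in> \<F> \<Longrightarrow> g \<in> \<F> \<Longrightarrow> u \<in> gunits G \<Longrightarrow> integrable (mu u) (coset_fun f g)"
  by (rule radon_integrable_Cc[OF mu_radon coset_fun_Cc])

lemma zero_F0: "(\<lambda>x\<in>garr G. hzero (\<H> x)) \<in> \<F>" (is "?z \<in> _")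
  unfolding F0_iff
proof (intro conjI)
  have "continuous_along (gtop G) (bun S) (gdom G) (\<lambda>x. hzero (\<H> x))"
    by (rule continuous_along_zero[OF bundle_S cont_dom])
  then show "continuous_along (gtop G) (bun S) (gdom G) ?z"
    by (rule continuous_along_cong) (simp add: topspace_gtop)
  have "nonzero_set ?z = {}" by auto
  then show "compactin Q (coset_supp ?z)" by simp
  show "equivariant_section ?z"
    unfolding equivariant_section_def
  proof (intro conjI ballI impI)
    show "?z x \<in> hcar (\<H> x)" if "x \<in> garr G" for x
      using hilbert_space_hzero(1)[OF fibS[OF that]] that by simp
    fix x h assume x: "x \<in> garr G" and h: "h \<in> H" and xh: "(x, h) \<in> gcomposable G"
    note xharr = gmult_arr[OF grpd xh]
    note U = act_ginv_unitary[OF h xh]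
    let ?v = "act S (ginv G h) (hzero (\<H> x))"
    have z: "hzero (\<H> x) \<in> hcar (\<H> x)"
      by (rule hilbert_space_hzero(1)[OF fibS[OF x]])
    have "?v \<in> hcar (\<H> (gmult G x h))"
      using U z by (auto simp: hunitary_def hlinear_def)
    moreover have "hinner (\<H> (gmult G x h)) ?v ?v = 0"
      using U z hilbert_space_hzero(3)[OF fibS[OF x] z] by (simp add: hunitary_def)
    ultimately have "?v = hzero (\<H> (gmult G x h))"
      using hinner_0_iff[OF xharr] by blast
    then show "?z (gmult G x h) = act S (ginv G h) (?z x)" using x xharr by simp
  qed
qed simp

lemma sec_add_F0:
  assumes f: "f \<in> \<F>" and g: "g \<in> \<F>"
  shows "sec_add G S f g \<in> \<F>" (is "?s \<in> _")
proof -
  note F = F0_D[OF f] and Gg = F0_D[OF g]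
  have "continuous_along (gtop G) (bun S) (gdom G) (\<lambda>x. hadd (\<H> x) (f x) (g x))"
    by (rule continuous_along_hadd[OF bundle_S cont_dom F(2) Gg(2)])
  then have cont: "continuous_along (gtop G) (bun S) (gdom G) ?s"
    by (rule continuous_along_cong) (simp add: topspace_gtop sec_add_def)
  have eq: "equivariant_section ?s"
    unfolding equivariant_section_def
  proof (intro conjI ballI impI)
    show "?s x \<in> hcar (\<H> x)" if "x \<in> garr G" for x
      using semi_inner_spaceD(1)[OF fibS_semi[OF that] F(5)[OF that] Gg(5)[OF that]] that
      by (simp add: sec_add_def)
    fix x h assume x: "x \<in> garr G" and h: "h \<in> H" and xh: "(x, h) \<in> gcomposable G"
    have "act S (ginv G h) (hadd (\<H> x) (f x) (g x))
        = hadd (\<H> (gmult G x h)) (act S (ginv G h) (f x)) (act S (ginv G h) (g x))"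
      using act_ginv_unitary[OF h xh] F(5)[OF x] Gg(5)[OF x] by (simp add: hunitary_def hlinear_def)
    then show "?s (gmult G x h) = act S (ginv G h) (?s x)"
      using F(4) Gg(4) x h xh gmult_arr[OF grpd xh] by (simp add: sec_add_def equivariant_section_def)
  qed
  have "nonzero_set ?s \<subseteq> nonzero_set f \<union> nonzero_set g"
  proof
    fix x assume x: "x \<in> nonzero_set ?s"
    show "x \<in> nonzero_set f \<union> nonzero_set g"
    proof (rule ccontr)
      assume "x \<notin> nonzero_set f \<union> nonzero_set g"
      then have "f x = hzero (\<H> x)" "g x = hzero (\<H> x)" using x by auto
      moreover have "hadd (\<H> x) v (hzero (\<H> x)) = v"
        if "v \<in> hcar (\<H> x)" for v
      proof -
        have "complex_vector_space (\<H> x)"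
          using fibS[of x] x by (simp only: hilbert_space_def mem_Collect_eq)
        then show ?thesis using that unfolding complex_vector_space_def by blast
      qed
      ultimately have "?s x = hzero (\<H> x)"
        using x F(5)[of x] by (simp add: sec_add_def)
      then show False using x by simp
    qed
  qed
  then have "gtop G closure_of nonzero_set ?s
      \<subseteq> gtop G closure_of nonzero_set f \<union> gtop G closure_of nonzero_set g"
    unfolding closure_of_Un[symmetric] by (rule closure_of_mono)
  then have "coset_supp ?s \<subseteq> coset_supp f \<union> coset_supp g"
    unfolding image_Un[symmetric] by (rule image_mono)
  then have "compactin Q (coset_supp ?s)"
    by (rule compactin_coset_supp[OF eq compactin_Un[OF F(3) Gg(3)]])
  then show ?thesis using cont eq by (simp add: F0_iff sec_add_def)
qed

lemma sec_scale_F0: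
  assumes f: "f \<in> \<F>"
  shows "sec_scale G S a f \<in> \<F>" (is "?s \<in> _")
proof -
  note F = F0_D[OF f]
  have "continuous_along (gtop G) (bun S) (gdom G) (\<lambda>x. hscale (\<H> x) a (f x))"
    by (rule continuous_along_hscale[OF bundle_S cont_dom F(2)])
  then have cont: "continuous_along (gtop G) (bun S) (gdom G) ?s"
    by (rule continuous_along_cong) (simp add: topspace_gtop sec_scale_def)
  have car: "?s x \<in> hcar (\<H> x)" if "x \<in> garr G" for x
    using semi_inner_spaceD(2)[OF fibS_semi[OF that] F(5)[OF that]] that
    by (simp add: sec_scale_def)
  have eq: "equivariant_section ?s"
    unfolding equivariant_section_def
  proof (intro conjI ballI impI car)
    fix x h assume x: "x \<in> garr G" and h: "h \<in> H" and xh: "(x, h) \<in> gcomposable G"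
    have "act S (ginv G h) (hscale (\<H> x) a (f x))
        = hscale (\<H> (gmult G x h)) a (act S (ginv G h) (f x))"
      using act_ginv_unitary[OF h xh] F(5)[OF x] by (simp add: hunitary_def hlinear_def)
    then show "?s (gmult G x h) = act S (ginv G h) (?s x)"
      using F(4) x h xh gmult_arr[OF grpd xh] by (simp add: sec_scale_def equivariant_section_def)
  qed
  have "nonzero_set ?s \<subseteq> nonzero_set f"
  proof
    fix x assume x: "x \<in> nonzero_set ?s"
    then have arr: "x \<in> garr G" by simp
    show "x \<in> nonzero_set f"
    proof (rule ccontr)
      assume "x \<notin> nonzero_set f"
      then have "hinner (\<H> x) (f x) (f x) = 0"
        using hinner_0_iff[OF arr F(5)[OF arr]] arr by simp
      then have "hinner (\<H> x) (?s x) (?s x) = 0"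
        using arr F(5)[OF arr] by (simp add: sec_scale_def semi_inner_expand[OF fibS_semi[OF arr]])
      then show False using hinner_0_iff[OF arr car[OF arr]] x by simp
    qed
  qed
  then have "coset_supp ?s \<subseteq> coset_supp f"
    by (intro image_mono closure_of_mono)
  then have "compactin Q (coset_supp ?s)"
    by (rule compactin_coset_supp[OF eq F(3)])
  then show ?thesis using cont eq by (simp add: F0_iff sec_scale_def)
qed

lemma coset_fun_sec:
  assumes f: "f \<in> \<F>" and g: "g \<in> \<F>" and k: "k \<in> \<F>"
    and A: "A \<in> topspace Q"
  shows "coset_fun (sec_add G S f g) k A = coset_fun f k A + coset_fun g k A"
    and "coset_fun (sec_scale G S a f) g A = a * coset_fun f g A"
    and "coset_fun f g A = cnj (coset_fun g f A)"
    and "0 \<le> Re (coset_fun f f A)"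
proof -
  obtain x where x: "x \<in> garr G" "A = q x" using A by (auto simp: topspace_coset_top)
  note V = fibS_semi[OF x(1)] and F = F0_D(5)[OF f x(1)] and Gg = F0_D(5)[OF g x(1)] and K = F0_D(5)[OF k x(1)]
  note eqs = F0_D(4)[OF f] F0_D(4)[OF g] F0_D(4)[OF k] F0_D(4)[OF sec_add_F0[OF f g]] F0_D(4)[OF sec_scale_F0[OF f]]
  show "coset_fun (sec_add G S f g) k A = coset_fun f k A + coset_fun g k A"
    unfolding x(2) coset_fun_coset[OF eqs(4,3) x(1)] coset_fun_coset[OF eqs(1,3) x(1)]
      coset_fun_coset[OF eqs(2,3) x(1)]
    using semi_inner_spaceD(3)[OF V F Gg K] x(1) by (simp add: sec_add_def)
  show "coset_fun (sec_scale G S a f) g A = a * coset_fun f g A"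
    unfolding x(2) coset_fun_coset[OF eqs(5,2) x(1)] coset_fun_coset[OF eqs(1,2) x(1)]
    using semi_inner_spaceD(4)[OF V F Gg] x(1) by (simp add: sec_scale_def)
  show "coset_fun f g A = cnj (coset_fun g f A)"
    unfolding x(2) coset_fun_coset[OF eqs(1,2) x(1)] coset_fun_coset[OF eqs(2,1) x(1)]
    by (rule semi_inner_spaceD(5)[OF V F Gg])
  show "0 \<le> Re (coset_fun f f A)"
    unfolding x(2) coset_fun_coset[OF eqs(1,1) x(1)] by (rule semi_inner_spaceD(6)[OF V F])
qed

lemma ind_F0_semi_inner:
  assumes u: "u \<in> gunits G"
  shows "semi_inner_space (ind_F0_space G H mu S u)"
proof -
  have sp: "space (mu u) = topspace Q" by (rule radon_space[OF mu_radon[OF u]])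
  note int = coset_fun_integrable[OF _ _ u]
  have add_eq: "ind_ip G mu S (sec_add G S f g) k u = ind_ip G mu S f k u + ind_ip G mu S g k u"
    if "f \<in> \<F>" "g \<in> \<F>" "k \<in> \<F>" for f g k
  proof -
    have "(LINT A|mu u. coset_fun (sec_add G S f g) k A) = (LINT A|mu u. coset_fun f k A + coset_fun g k A)"
      by (rule Bochner_Integration.integral_cong[OF refl]) (simp add: sp coset_fun_sec(1)[OF that])
    then show ?thesis using int that by (simp add: ind_ip_eq)
  qed
  have scale_eq: "ind_ip G mu S (sec_scale G S a f) g u = a * ind_ip G mu S f g u"
    if "f \<in> \<F>" "g \<in> \<F>" for a f g
  proof -
    have "(LINT A|mu u. coset_fun (sec_scale G S a f) g A) = (LINT A|mu u. a * coset_fun f g A)"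
      by (rule Bochner_Integration.integral_cong[OF refl]) (simp add: sp coset_fun_sec(2)[OF that that(1)])
    then show ?thesis by (simp add: ind_ip_eq)
  qed
  have herm: "ind_ip G mu S f g u = cnj (ind_ip G mu S g f u)"
    if "f \<in> \<F>" "g \<in> \<F>" for f g
    unfolding ind_ip_eq Bochner_Integration.integral_cnj[symmetric]
    by (rule Bochner_Integration.integral_cong[OF refl]) (unfold sp, rule coset_fun_sec(3)[OF that that(1)])
  have pos: "0 \<le> Re (ind_ip G mu S f f u)" if "f \<in> \<F>" for f
    unfolding ind_ip_eq integral_Re[OF int[OF that that], symmetric]
    by (rule Bochner_Integration.integral_nonneg) (unfold sp, rule coset_fun_sec(4)[OF that that that])
  show ?thesis
    unfolding semi_inner_space_def ind_F0_space_def hspace.simps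
    by (intro conjI ballI allI sec_add_F0 sec_scale_F0 add_eq scale_eq herm pos)
qed

text \<open>The function \<open>u \<mapsto> \<langle>f, f\<rangle>(u)\<close> is continuous, and it vanishes off the compact set of ranges of the
  cosets in the support of \<open>f\<close>.\<close>

lemma ind_F0_bounded:
  assumes f: "f \<in> \<F>"
  shows "\<exists>B. \<forall>u\<in>gunits G. hnorm (ind_F0_space G H mu S u) f \<le> B"
proof -
  let ?\<Phi> = "\<lambda>u. LINT A|mu u. coset_fun f f A"
  define r where "r = (\<lambda>A. grng G (some_elem A))"
  have r_coset: "r (q x) = grng G x" if "x \<in> garr G" for x
    unfolding r_def by (rule coset_mem_grng[OF that some_elem_coset[OF that]])
  have "continuous_map (gtop G) X (r \<circ> q)"
    by (rule continuous_map_eq[OF continuous_map_grng(1)[OF top_groupoid]])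
       (simp add: r_coset topspace_gtop)
  then have r_cont: "continuous_map Q X r"
    by (rule continuous_compose_quotient_map[OF quotient_map_coset])
  note F = F0_D[OF f]
  have "compactin X (r ` coset_supp f)" by (rule image_compactin[OF F(3) r_cont])
  then have "compact (?\<Phi> ` r ` coset_supp f)"
    using image_compactin[OF _ mu_continuous[OF coset_fun_Cc[OF f f]]] by simp
  then have "bounded (?\<Phi> ` r ` coset_supp f)" by (rule compact_imp_bounded)
  then obtain B where "\<forall>z\<in>?\<Phi> ` r ` coset_supp f. cmod z \<le> B"
    unfolding bounded_iff by (elim exE)
  then have B: "cmod (?\<Phi> u) \<le> B" if "u \<in> r ` coset_supp f" for u
    using imageI[OF that, of ?\<Phi>] by (rule bspec)
  have "hnorm (ind_F0_space G H mu S u) f \<le> sqrt \<bar>B\<bar>" if u: "u \<in> gunits G" for u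
  proof -
    have "Re (?\<Phi> u) \<le> \<bar>B\<bar>"
    proof (cases "u \<in> r ` coset_supp f")
      case True
      then show ?thesis using B[of u] complex_Re_le_cmod[of "?\<Phi> u"] by linarith
    next
      case False
      have "?\<Phi> u = 0"
      proof (rule radon_integral_zero[OF mu_radon[OF u]])
        show "continuous_map Q euclidean (coset_fun f f)" using coset_fun_Cc[OF f f] by (simp add: Cc_def)
        fix A assume "A \<in> measure_support Q (mu u)"
        then obtain x where x: "x \<in> garr G" "A = q x" "grng G x = u"
          by (auto simp: mu_support[OF u] coset_rng_fibre_def)
        have "q x \<notin> coset_supp f"
        proof
          assume "q x \<in> coset_supp f"
          then have "r (q x) \<in> r ` coset_supp f" by (rule imageI)
          then show False using False r_coset[OF x(1)] x(3) by simp
        qed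
        then have "f x = hzero (\<H> x)" by (rule off_coset_supp[OF x(1)])
        then show "coset_fun f f A = 0"
          using hinner_0_iff[OF x(1) F(5)[OF x(1)]] by (simp add: x(2) coset_fun_coset[OF F(4,4) x(1)])
      qed
      then show ?thesis by simp
    qed
    then show ?thesis by (simp add: hnorm_def ind_F0_space_def ind_ip_eq)
  qed
  then show ?thesis by blast
qed

text \<open>Every coset \<open>xH\<close> lies in the support of \<open>\<mu>\<close> at \<open>r(x)\<close>, so a section of norm zero vanishes at \<open>x\<close>.\<close>

lemma ind_F0_separated:
  assumes f: "f \<in> \<F>" and g: "g \<in> \<F>"
    and 0: "\<And>u. u \<in> gunits G \<Longrightarrow>
         hnorm (ind_F0_space G H mu S u) (hdiff (ind_F0_space G H mu S u) f g) = 0"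
  shows "f = g"
proof (rule extensionalityI[OF F0_D(1)[OF f] F0_D(1)[OF g]])
  fix x assume x: "x \<in> garr G"
  let ?k = "sec_add G S f (sec_scale G S (-1) g)"
  define u where "u = grng G x"
  have u: "u \<in> gunits G" unfolding u_def by (rule grng_unit[OF grpd x])
  have k: "?k \<in> \<F>" by (intro sec_add_F0 sec_scale_F0 f g)
  have "hnorm (ind_F0_space G H mu S u) ?k = 0"
    using 0[OF u] by (simp add: hdiff_def ind_F0_space_def)
  then have int0: "(LINT A|mu u. coset_fun ?k ?k A) = 0"
    using hnorm_eq_0_iff[OF ind_F0_semi_inner[OF u], of ?k] k by (simp add: ind_F0_space_def ind_ip_eq)
  have "q x \<in> measure_support Q (mu u)"
    unfolding mu_support[OF u] coset_rng_fibre_def using x u_def by blast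
  then have "Re (coset_fun ?k ?k (q x)) = 0"
    using radon_integral_nonzero[OF mu_radon[OF u] coset_fun_Cc[OF k k]] coset_fun_sec(4)[OF k k k] int0
    by blast
  moreover have kx: "?k x = hdiff (\<H> x) (f x) (g x)"
    using x by (simp add: sec_add_def sec_scale_def hdiff_def)
  ultimately have "Re (hinner (\<H> x) (hdiff (\<H> x) (f x) (g x))
      (hdiff (\<H> x) (f x) (g x))) = 0"
    by (simp add: coset_fun_coset[OF F0_D(4)[OF k] F0_D(4)[OF k] x])
  moreover have kc: "hdiff (\<H> x) (f x) (g x) \<in> hcar (\<H> x)"
    by (rule hdiff_in_hcar[OF fibS_semi[OF x] F0_D(5)[OF f x] F0_D(5)[OF g x]])
  ultimately have "hnorm (\<H> x) (hdiff (\<H> x) (f x) (g x)) = 0"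
    by (simp add: hnorm_def)
  then have "hdiff (\<H> x) (f x) (g x) = hzero (\<H> x)"
    using hnorm_eq_0_iff[OF fibS_semi[OF x] kc] hinner_0_iff[OF x kc] by simp
  then show "f x = g x"
    by (rule hilbert_space_hdiff_eq_zero[OF fibS[OF x] F0_D(5)[OF f x] F0_D(5)[OF g x]])
qed

lemma induced_module:
  assumes "gunits G \<noteq> {}" shows "induced_module G H mu S"
  by unfold_locales
     (use assms zero_F0 ind_F0_semi_inner ind_F0_bounded ind_F0_separated in blast)+

end

section \<open>Transporting bundles along fibrewise bijections\<close>

text \<open>If the distance to every generating section of \<open>E'\<close> pulls back to the distance to a section of
  \<open>E\<close>, then tubes pull back to tubes.\<close>

lemma continuous_map_total_top_transport:
  assumes K: "\<And>u v. u \<in> topspace X \<Longrightarrow> v \<in> hcar (fib E u) \<Longrightarrow> K u v \<in> hcar (fib E' u)"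
    and pull: "\<And>\<xi>'. \<xi>' \<in> sec E' \<Longrightarrow> \<exists>\<xi>\<in>sec E. \<forall>u\<in>topspace X. \<forall>v\<in>hcar (fib E u).
      fdist E' u (K u v) (\<xi>' u) = fdist E u v (\<xi> u)"
    and push: "\<And>\<xi>. \<xi> \<in> sec E \<Longrightarrow> \<exists>\<xi>'\<in>sec E'. \<forall>u\<in>topspace X. \<forall>v\<in>hcar (fib E u).
      fdist E' u (K u v) (\<xi>' u) = fdist E u v (\<xi> u)"
  shows "continuous_map (total_top X E) (total_top X E') (\<lambda>(u, v). (u, K u v))"
proof -
  have top: "z \<in> topspace (total_top X E) \<longleftrightarrow> (\<exists>V \<xi> \<epsilon>. openin X V \<and> \<xi> \<in> sec E \<and> \<epsilon> > 0 \<and> z \<in> tube E V \<xi> \<epsilon>)"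
    for z by (auto simp: total_top_def)
  show ?thesis
    unfolding total_top_def[of X E']
  proof (rule continuous_on_generated_topo)
    fix U assume "U \<in> {tube E' V \<xi> \<epsilon> | V \<xi> \<epsilon>. openin X V \<and> \<xi> \<in> sec E' \<and> \<epsilon> > 0}"
    then obtain V \<xi>' \<epsilon> where V: "openin X V" and \<xi>': "\<xi>' \<in> sec E'" and \<epsilon>: "\<epsilon> > 0"
      and U: "U = tube E' V \<xi>' \<epsilon>" by blast
    obtain \<xi> where \<xi>: "\<xi> \<in> sec E" and eq: "\<And>u v. u \<in> topspace X \<Longrightarrow> v \<in> hcar (fib E u) \<Longrightarrow>
        fdist E' u (K u v) (\<xi>' u) = fdist E u v (\<xi> u)"
      using pull[OF \<xi>'] by (elim bexE) simp
    have VX: "u \<in> topspace X" if "u \<in> V" for u using openin_subset[OF V] that by blast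
    have sub: "tube E V \<xi> \<epsilon> \<subseteq> topspace (total_top X E)"
      using V \<xi> \<epsilon> unfolding top subset_iff by blast
    have car: "v \<in> hcar (fib E u)" if "(u, v) \<in> topspace (total_top X E)" for u v
      using that unfolding top by (auto simp: tube_def)
    have "(\<lambda>(u, v). (u, K u v)) -` U \<inter> topspace (total_top X E) = tube E V \<xi> \<epsilon>"
    proof (intro Set.equalityI subsetI)
      fix z assume z: "z \<in> (\<lambda>(u, v). (u, K u v)) -` U \<inter> topspace (total_top X E)"
      obtain u v where uv: "z = (u, v)" by (cases z)
      have "u \<in> V" "fdist E' u (K u v) (\<xi>' u) < \<epsilon>"
        using z by (simp_all add: U uv tube_def)
      moreover have "v \<in> hcar (fib E u)" using z car uv by blast
      ultimately show "z \<in> tube E V \<xi> \<epsilon>" using eq[OF VX] by (simp add: uv tube_def)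
    next
      fix z assume z: "z \<in> tube E V \<xi> \<epsilon>"
      obtain u v where uv: "z = (u, v)" by (cases z)
      have u: "u \<in> V" and v: "v \<in> hcar (fib E u)" using z by (simp_all add: uv tube_def)
      have "(u, K u v) \<in> U" using z eq[OF VX[OF u] v] K[OF VX[OF u] v] by (simp add: U uv tube_def)
      then show "z \<in> (\<lambda>(u, v). (u, K u v)) -` U \<inter> topspace (total_top X E)"
        using z sub uv by auto
    qed
    moreover have "openin (total_top X E) (tube E V \<xi> \<epsilon>)"
      unfolding total_top_def using V \<xi> \<epsilon> by (intro topology_generated_by_Basis) blast
    ultimately show "openin (total_top X E) ((\<lambda>(u, v). (u, K u v)) -` U \<inter> topspace (total_top X E))"
      by simp
  next
    show "(\<lambda>(u, v). (u, K u v)) ` topspace (total_top X E)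
        \<subseteq> \<Union>{tube E' V \<xi> \<epsilon> | V \<xi> \<epsilon>. openin X V \<and> \<xi> \<in> sec E' \<and> \<epsilon> > 0}"
    proof (rule image_subsetI)
      fix z assume "z \<in> topspace (total_top X E)"
      then obtain V \<xi> \<epsilon> where V: "openin X V" and \<xi>: "\<xi> \<in> sec E" and \<epsilon>: "\<epsilon> > 0" and z: "z \<in> tube E V \<xi> \<epsilon>"
        unfolding top by blast
      obtain u v where uv: "z = (u, v)" by (cases z)
      have u: "u \<in> V" and v: "v \<in> hcar (fib E u)" using z by (simp_all add: uv tube_def)
      have uX: "u \<in> topspace X" using openin_subset[OF V] u by blast
      obtain \<xi>' where \<xi>': "\<xi>' \<in> sec E'" and eq: "\<And>u v. u \<in> topspace X \<Longrightarrow> v \<in> hcar (fib E u) \<Longrightarrow>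
          fdist E' u (K u v) (\<xi>' u) = fdist E u v (\<xi> u)"
        using push[OF \<xi>] by (elim bexE) simp
      have "(u, K u v) \<in> tube E' V \<xi>' \<epsilon>"
        using z eq[OF uX v] K[OF uX v] by (simp add: uv tube_def)
      moreover have "tube E' V \<xi>' \<epsilon> \<in> {tube E' V \<xi> \<epsilon> | V \<xi> \<epsilon>. openin X V \<and> \<xi> \<in> sec E' \<and> \<epsilon> > 0}"
        using V \<xi>' \<epsilon> by blast
      ultimately show "(case z of (u, v) \<Rightarrow> (u, K u v))
          \<in> \<Union>{tube E' V \<xi> \<epsilon> | V \<xi> \<epsilon>. openin X V \<and> \<xi> \<in> sec E' \<and> \<epsilon> > 0}"
        by (auto simp: uv)
    qed
  qed
qed

text \<open>Fibrewise isometries preserve the distances by which locally uniform approximation is defined.\<close>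

lemma loc_unif_closure_transport:
  assumes J: "\<And>u. u \<in> topspace X \<Longrightarrow> antiunitary (F u) (F' u) (J u)"
    and F: "\<And>u. u \<in> topspace X \<Longrightarrow> semi_inner_space (F u)"
    and A: "A \<subseteq> (\<Pi>\<^sub>E u\<in>topspace X. hcar (F u))"
  shows "loc_unif_closure X F' ((\<lambda>\<xi>. \<lambda>u\<in>topspace X. J u (\<xi> u)) ` A)
    = (\<lambda>\<xi>. \<lambda>u\<in>topspace X. J u (\<xi> u)) ` loc_unif_closure X F A" (is "?L = ?c ` ?R")
proof -
  have dist: "hnorm (F' u) (hdiff (F' u) (?c \<xi> u) (?c \<eta> u)) = hnorm (F u) (hdiff (F u) (\<xi> u) (\<eta> u))"
    if "\<xi> \<in> (\<Pi>\<^sub>E u\<in>topspace X. hcar (F u))" "\<eta> \<in> (\<Pi>\<^sub>E u\<in>topspace X. hcar (F u))" "u \<in> topspace X"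
    for \<xi> \<eta> u
    using antiunitary_hnorm_hdiff[OF J[OF that(3)] F[OF that(3)] PiE_mem[OF that(1,3)] PiE_mem[OF that(2,3)]]
      that(3) by simp
  have iff: "?c \<xi> \<in> ?L \<longleftrightarrow> \<xi> \<in> ?R" if \<xi>: "\<xi> \<in> (\<Pi>\<^sub>E u\<in>topspace X. hcar (F u))" for \<xi>
  proof -
    have c\<xi>: "?c \<xi> \<in> (\<Pi>\<^sub>E u\<in>topspace X. hcar (F' u))"
      using \<xi> antiunitaryD(4)[OF J] by (auto simp: PiE_mem)
    have "(\<exists>V \<eta>. openin X V \<and> u \<in> V \<and> \<eta> \<in> ?c ` A \<and> (\<forall>v\<in>V. hnorm (F' v) (hdiff (F' v) (?c \<xi> v) (\<eta> v)) < \<epsilon>))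
      \<longleftrightarrow> (\<exists>V \<eta>. openin X V \<and> u \<in> V \<and> \<eta> \<in> A \<and> (\<forall>v\<in>V. hnorm (F v) (hdiff (F v) (\<xi> v) (\<eta> v)) < \<epsilon>))" for u \<epsilon>
    proof -
      have "(\<forall>v\<in>V. hnorm (F' v) (hdiff (F' v) (?c \<xi> v) (?c \<eta> v)) < \<epsilon>)
          \<longleftrightarrow> (\<forall>v\<in>V. hnorm (F v) (hdiff (F v) (\<xi> v) (\<eta> v)) < \<epsilon>)" if "openin X V" "\<eta> \<in> A" for V \<eta>
      proof (rule ball_cong[OF refl])
        fix v assume "v \<in> V"
        then have "v \<in> topspace X" using openin_subset[OF that(1)] by blast
        moreover have "\<eta> \<in> (\<Pi>\<^sub>E u\<in>topspace X. hcar (F u))" using A that(2) by blast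
        ultimately show "hnorm (F' v) (hdiff (F' v) (?c \<xi> v) (?c \<eta> v)) < \<epsilon>
            \<longleftrightarrow> hnorm (F v) (hdiff (F v) (\<xi> v) (\<eta> v)) < \<epsilon>"
          by (simp only: dist[OF \<xi>])
      qed
      note eq = this
      show ?thesis
      proof
        assume "\<exists>V \<eta>. openin X V \<and> u \<in> V \<and> \<eta> \<in> ?c ` A
          \<and> (\<forall>v\<in>V. hnorm (F' v) (hdiff (F' v) (?c \<xi> v) (\<eta> v)) < \<epsilon>)"
        then obtain V \<eta>' where V: "openin X V" "u \<in> V" and "\<eta>' \<in> ?c ` A"
          and less: "\<forall>v\<in>V. hnorm (F' v) (hdiff (F' v) (?c \<xi> v) (\<eta>' v)) < \<epsilon>"
          by (elim exE conjE)
        then obtain \<eta> where \<eta>: "\<eta> \<in> A" "\<eta>' = ?c \<eta>" by (elim imageE)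
        show "\<exists>V \<eta>. openin X V \<and> u \<in> V \<and> \<eta> \<in> A \<and> (\<forall>v\<in>V. hnorm (F v) (hdiff (F v) (\<xi> v) (\<eta> v)) < \<epsilon>)"
          using V \<eta>(1) less[unfolded \<eta>(2) eq[OF V(1) \<eta>(1)]] by (intro exI conjI)
      next
        assume "\<exists>V \<eta>. openin X V \<and> u \<in> V \<and> \<eta> \<in> A \<and> (\<forall>v\<in>V. hnorm (F v) (hdiff (F v) (\<xi> v) (\<eta> v)) < \<epsilon>)"
        then obtain V \<eta> where V: "openin X V" "u \<in> V" and \<eta>: "\<eta> \<in> A"
          and less: "\<forall>v\<in>V. hnorm (F v) (hdiff (F v) (\<xi> v) (\<eta> v)) < \<epsilon>"
          by (elim exE conjE)
        show "\<exists>V \<eta>. openin X V \<and> u \<in> V \<and> \<eta> \<in> ?c ` A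
          \<and> (\<forall>v\<in>V. hnorm (F' v) (hdiff (F' v) (?c \<xi> v) (\<eta> v)) < \<epsilon>)"
          using V imageI[OF \<eta>, of ?c] less[folded eq[OF V(1) \<eta>]] by (intro exI conjI)
      qed
    qed
    then show ?thesis unfolding loc_unif_closure_def using \<xi> c\<xi> by simp
  qed
  show ?thesis
  proof (intro Set.equalityI subsetI)
    fix \<xi>' assume \<xi>': "\<xi>' \<in> ?L"
    then have \<xi>'_car: "\<xi>' \<in> (\<Pi>\<^sub>E u\<in>topspace X. hcar (F' u))" by (simp add: loc_unif_closure_def)
    define \<xi> where "\<xi> = (\<lambda>u\<in>topspace X. inv_into (hcar (F u)) (J u) (\<xi>' u))"
    have im: "\<xi>' u \<in> J u ` hcar (F u)" if "u \<in> topspace X" for u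
      using \<xi>'_car that antiunitaryD(2)[OF J[OF that]] by (auto simp: PiE_mem)
    have \<xi>: "\<xi> \<in> (\<Pi>\<^sub>E u\<in>topspace X. hcar (F u))"
      unfolding \<xi>_def using im by (auto intro: inv_into_into)
    have "?c \<xi> = \<xi>'"
    proof (rule extensionalityI[of _ "topspace X"])
      show "\<xi>' \<in> extensional (topspace X)" using \<xi>'_car by (simp add: PiE_iff)
      show "?c \<xi> u = \<xi>' u" if "u \<in> topspace X" for u
        using that f_inv_into_f[OF im[OF that]] by (simp add: \<xi>_def)
    qed simp
    then show "\<xi>' \<in> ?c ` ?R" using iff[OF \<xi>] \<xi>' by blast
  next
    fix \<xi>' assume "\<xi>' \<in> ?c ` ?R"
    then obtain \<xi> where \<xi>: "\<xi> \<in> ?R" "\<xi>' = ?c \<xi>" by blast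
    then show "\<xi>' \<in> ?L" using iff[of \<xi>] by (simp add: loc_unif_closure_def)
  qed
qed

text \<open>Since the sections of the dual bundle are by definition the images of those of \<open>E\<close>, both directions
  of the Riesz map are transports.\<close>

lemma continuous_map_hfun:
  assumes fibE: "\<And>u. u \<in> topspace X \<Longrightarrow> inner_space (fib E u)"
    and secE: "sec E \<subseteq> (\<Pi>\<^sub>E u\<in>topspace X. hcar (fib E u))"
    and fibE': "fib E' = (\<lambda>u. hdual (fib E u))"
    and secE': "sec E' = {(\<lambda>u\<in>topspace X. hfun (fib E u) (\<xi> u)) | \<xi>. \<xi> \<in> sec E}"
  shows "continuous_map (total_top X E) (total_top X E') (\<lambda>(u, v). (u, hfun (fib E u) v))"
    and "continuous_map (total_top X E') (total_top X E) (\<lambda>(u, \<phi>). (u, hriesz (fib E u) \<phi>))"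
proof -
  have anti: "antiunitary (fib E u) (hdual (fib E u)) (hfun (fib E u))" if "u \<in> topspace X" for u
    by (rule antiunitary_hfun[OF fibE[OF that]])
  have semi: "semi_inner_space (fib E u)" if "u \<in> topspace X" for u
    using fibE[OF that] by (simp add: inner_space_def)
  have dist: "fdist E' u (hfun (fib E u) v) ((\<lambda>u\<in>topspace X. hfun (fib E u) (\<xi> u)) u)
      = fdist E u v (\<xi> u)"
    if "\<xi> \<in> sec E" "u \<in> topspace X" "v \<in> hcar (fib E u)" for \<xi> u v
    using antiunitary_hnorm_hdiff[OF anti[OF that(2)] semi[OF that(2)] that(3)
        PiE_mem[OF subsetD[OF secE that(1)] that(2)]] that(2)
    by (simp add: fibE')
  have sec_mem: "(\<lambda>u\<in>topspace X. hfun (fib E u) (\<xi> u)) \<in> sec E'" if "\<xi> \<in> sec E" for \<xi>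
    unfolding secE' using that by blast
  show "continuous_map (total_top X E) (total_top X E') (\<lambda>(u, v). (u, hfun (fib E u) v))"
  proof (rule continuous_map_total_top_transport)
    show "hfun (fib E u) v \<in> hcar (fib E' u)" if "u \<in> topspace X" "v \<in> hcar (fib E u)" for u v
      using antiunitaryD(4)[OF anti[OF that(1)] that(2)] by (simp add: fibE')
    show "\<exists>\<xi>\<in>sec E. \<forall>u\<in>topspace X. \<forall>v\<in>hcar (fib E u).
      fdist E' u (hfun (fib E u) v) (\<xi>' u) = fdist E u v (\<xi> u)"
      if \<xi>': "\<xi>' \<in> sec E'" for \<xi>'
    proof -
      obtain \<xi> where "\<xi> \<in> sec E" "\<xi>' = (\<lambda>u\<in>topspace X. hfun (fib E u) (\<xi> u))"
        using \<xi>' unfolding secE' by blast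
      then show ?thesis using dist by (intro bexI[of _ \<xi>]) simp_all
    qed
    show "\<exists>\<xi>'\<in>sec E'. \<forall>u\<in>topspace X. \<forall>v\<in>hcar (fib E u).
      fdist E' u (hfun (fib E u) v) (\<xi>' u) = fdist E u v (\<xi> u)"
      if "\<xi> \<in> sec E" for \<xi>
      using dist[OF that] by (intro bexI[OF _ sec_mem[OF that]]) blast
  qed
  have dist': "fdist E u (hriesz (fib E u) \<phi>) (\<xi> u)
      = fdist E' u \<phi> ((\<lambda>u\<in>topspace X. hfun (fib E u) (\<xi> u)) u)"
    if \<xi>: "\<xi> \<in> sec E" and u: "u \<in> topspace X" and \<phi>: "\<phi> \<in> hcar (fib E' u)" for \<xi> u \<phi>
  proof -
    obtain v where v: "v \<in> hcar (fib E u)" "\<phi> = hfun (fib E u) v"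
      using \<phi> antiunitaryD(2)[OF anti[OF u]] by (auto simp: fibE')
    show ?thesis using dist[OF \<xi> u v(1)] hriesz_hfun[OF fibE[OF u] v(1)] by (simp add: v(2))
  qed
  show "continuous_map (total_top X E') (total_top X E) (\<lambda>(u, \<phi>). (u, hriesz (fib E u) \<phi>))"
  proof (rule continuous_map_total_top_transport)
    show "hriesz (fib E u) \<phi> \<in> hcar (fib E u)" if u: "u \<in> topspace X" and \<phi>: "\<phi> \<in> hcar (fib E' u)" for u \<phi>
    proof -
      obtain v where v: "v \<in> hcar (fib E u)" "\<phi> = hfun (fib E u) v"
        using \<phi> antiunitaryD(2)[OF anti[OF u]] by (auto simp: fibE')
      then show ?thesis using hriesz_hfun[OF fibE[OF u] v(1)] by simp
    qed
    show "\<exists>\<xi>'\<in>sec E'. \<forall>u\<in>topspace X. \<forall>\<phi>\<in>hcar (fib E' u).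
      fdist E u (hriesz (fib E u) \<phi>) (\<xi> u) = fdist E' u \<phi> (\<xi>' u)"
      if "\<xi> \<in> sec E" for \<xi>
      using dist'[OF that] by (intro bexI[OF _ sec_mem[OF that]]) blast
    show "\<exists>\<xi>\<in>sec E. \<forall>u\<in>topspace X. \<forall>\<phi>\<in>hcar (fib E' u).
      fdist E u (hriesz (fib E u) \<phi>) (\<xi> u) = fdist E' u \<phi> (\<xi>' u)"
      if \<xi>': "\<xi>' \<in> sec E'" for \<xi>'
    proof -
      obtain \<xi> where "\<xi> \<in> sec E" "\<xi>' = (\<lambda>u\<in>topspace X. hfun (fib E u) (\<xi> u))"
        using \<xi>' unfolding secE' by blast
      then show ?thesis using dist' by (intro bexI[of _ \<xi>]) simp_all
    qed
  qed
qed

section \<open>Conjugating the inducing data\<close>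

text \<open>With a nonempty unit space the supremum norm is a genuine supremum.\<close>

locale conjugate_induction = inducing_data G H lamH mu S
  for G :: "'g groupoid" and H :: "'g set" and lamH :: "'g \<Rightarrow> 'g measure"
    and mu :: "'g \<Rightarrow> 'g set measure" and S :: "('g, 'v) grep" +
  assumes nonempty: "gunits G \<noteq> {}"
begin

abbreviation "S' \<equiv> conj_rep (grestrict G H) S"

definition conj_sec :: "('g \<Rightarrow> 'v) \<Rightarrow> 'g \<Rightarrow> 'v \<Rightarrow> complex" where
  "conj_sec f = (\<lambda>x\<in>garr G. hfun (\<H> x) (f x))"

abbreviation "J \<equiv> conj_sec"
abbreviation "JC s \<equiv> (\<lambda>n. conj_sec (s n))"
abbreviation "JF \<equiv> \<lambda>A. (\<lambda>F. (\<lambda>s n. conj_sec (s n)) ` F) ` A"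

lemma fib_S': "rfib S' u = hdual (rfib S u)"
  by (simp add: conj_rep_def)

lemma sec_S': "sec (bun S') = {(\<lambda>u\<in>topspace X. hfun (rfib S u) (\<xi> u)) | \<xi>. \<xi> \<in> sec (bun S)}"
  by (simp add: conj_rep_def gunits_restrict topspace_X)

lemma act_S': "act S' h \<phi> = hfun (rfib S (grng G h)) (act S h (hriesz (\<H> h) \<phi>))"
  by (simp add: conj_rep_def grng_restrict)

lemma fibS_inner: "x \<in> garr G \<Longrightarrow> inner_space (\<H> x)"
  by (rule hilbert_space_imp_inner_space[OF fibS])

lemma fibS_anti: "x \<in> garr G \<Longrightarrow>
    antiunitary (\<H> x) (hdual (\<H> x)) (hfun (\<H> x))"
  by (rule antiunitary_hfun[OF fibS_inner])

lemma fibS_riesz: "x \<in> garr G \<Longrightarrow> v \<in> hcar (\<H> x) \<Longrightarrow>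
    hriesz (\<H> x) (hfun (\<H> x) v) = v"
  by (rule hriesz_hfun[OF fibS_inner])

lemma fibS_act:
  assumes x: "x \<in> garr G" and h: "h \<in> H" and xh: "(x, h) \<in> gcomposable G"
    and v: "v \<in> hcar (\<H> x)"
  shows "act S' (ginv G h) (hfun (\<H> x) v)
      = hfun (\<H> (gmult G x h)) (act S (ginv G h) v)"
    and "act S (ginv G h) v \<in> hcar (\<H> (gmult G x h))"
proof -
  have "gdom G (ginv G h) = gdom G x" "grng G (ginv G h) = gdom G (gmult G x h)"
    using xh gdom_gmult[OF grpd xh] grng_ginv[OF grpd H_arr[OF h]] gdom_ginv[OF grpd H_arr[OF h]]
    by (simp_all add: gcomposable_def)
  then show "act S' (ginv G h) (hfun (\<H> x) v)
      = hfun (\<H> (gmult G x h)) (act S (ginv G h) v)"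
    by (simp add: act_S' fibS_riesz[OF x v])
  show "act S (ginv G h) v \<in> hcar (\<H> (gmult G x h))"
    using act_ginv_unitary[OF h xh] v by (auto simp: hunitary_def hlinear_def)
qed

lemma bundle_conj_continuous:
  "continuous_map (total_top X (bun S)) (total_top X (bun S')) (\<lambda>(u, v). (u, hfun (rfib S u) v))"
  "continuous_map (total_top X (bun S')) (total_top X (bun S)) (\<lambda>(u, \<phi>). (u, hriesz (rfib S u) \<phi>))"
proof -
  have 1: "\<And>u. u \<in> topspace X \<Longrightarrow> inner_space (rfib S u)"
    by (simp add: topspace_X hilbert_space_imp_inner_space[OF fib_S])
  have 2: "sec (bun S) \<subseteq> (\<Pi>\<^sub>E u\<in>topspace X. hcar (rfib S u))"
    using bundle_S by (simp add: hilbert_bundle_def)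
  have 3: "rfib S' = (\<lambda>u. hdual (rfib S u))" by (simp add: fib_S' fun_eq_iff)
  show "continuous_map (total_top X (bun S)) (total_top X (bun S')) (\<lambda>(u, v). (u, hfun (rfib S u) v))"
    by (rule continuous_map_hfun(1)[OF 1 2 3 sec_S'])
  show "continuous_map (total_top X (bun S')) (total_top X (bun S)) (\<lambda>(u, \<phi>). (u, hriesz (rfib S u) \<phi>))"
    by (rule continuous_map_hfun(2)[OF 1 2 3 sec_S'])
qed

lemma conj_sec_supp:
  assumes "\<And>x. x \<in> garr G \<Longrightarrow> f x \<in> hcar (\<H> x)"
  shows "{x \<in> garr G. J f x \<noteq> hzero (rfib S' (gdom G x))} = nonzero_set f"
  using hfun_eq_hzero_iff[OF fibS assms] by (auto simp: conj_sec_def fib_S')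

lemma ind_F0_S'_iff:
  "g \<in> ind_F0 G H S' \<longleftrightarrow> g \<in> (\<Pi>\<^sub>E x\<in>garr G. hcar (hdual (\<H> x))) \<and>
     continuous_map (gtop G) (total_top X (bun S')) (\<lambda>x. (gdom G x, g x)) \<and>
     compactin Q (q ` (gtop G closure_of {x \<in> garr G. g x \<noteq> hzero (rfib S' (gdom G x))})) \<and>
     (\<forall>x\<in>garr G. \<forall>h\<in>H. (x, h) \<in> gcomposable G \<longrightarrow> g (gmult G x h) = act S' (ginv G h) (g x))"
  by (simp add: ind_F0_def fib_S')

lemma conj_sec_F0:
  assumes f: "f \<in> \<F>" shows "J f \<in> ind_F0 G H S'"
  unfolding ind_F0_S'_iff
proof (intro conjI ballI impI)
  note F = F0_D[OF f]
  show "J f \<in> (\<Pi>\<^sub>E x\<in>garr G. hcar (hdual (\<H> x)))"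
    using antiunitaryD(4)[OF fibS_anti F(5)] by (auto simp: conj_sec_def)
  have "continuous_map (gtop G) (total_top X (bun S)) (\<lambda>x. (gdom G x, f x))"
    using F(2) continuous_map_total_top_iff[OF bundle_S cont_dom] by blast
  then have "continuous_map (gtop G) (total_top X (bun S'))
      ((\<lambda>(u, v). (u, hfun (rfib S u) v)) \<circ> (\<lambda>x. (gdom G x, f x)))"
    by (rule continuous_map_compose) (rule bundle_conj_continuous(1))
  then show "continuous_map (gtop G) (total_top X (bun S')) (\<lambda>x. (gdom G x, J f x))"
    by (rule continuous_map_eq) (simp add: conj_sec_def topspace_gtop)
  show "compactin Q (q ` (gtop G closure_of {x \<in> garr G. J f x \<noteq> hzero (rfib S' (gdom G x))}))"
    using F(3) conj_sec_supp[OF F(5)] by simp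
  fix x h assume x: "x \<in> garr G" and h: "h \<in> H" and xh: "(x, h) \<in> gcomposable G"
  have "f (gmult G x h) = act S (ginv G h) (f x)"
    using F(4) x h xh by (simp add: equivariant_section_def)
  then show "J f (gmult G x h) = act S' (ginv G h) (J f x)"
    using x gmult_arr[OF grpd xh] by (simp add: conj_sec_def fibS_act(1)[OF x h xh F(5)[OF x]])
qed

text \<open>The inverse of \<open>J\<close> is the pointwise Riesz map.\<close>

lemma conj_sec_surj:
  assumes g: "g \<in> ind_F0 G H S'" obtains f where "f \<in> \<F>" "J f = g"
proof -
  define f where "f = (\<lambda>x\<in>garr G. hriesz (\<H> x) (g x))"
  note g = g[unfolded ind_F0_S'_iff]
  have rep: "f x \<in> hcar (\<H> x)" "hfun (\<H> x) (f x) = g x"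
    if x: "x \<in> garr G" for x
  proof -
    have "g x \<in> hfun (\<H> x) ` hcar (\<H> x)"
      unfolding antiunitaryD(2)[OF fibS_anti[OF x]] by (rule PiE_mem[OF conjunct1[OF g] x])
    then obtain v where v: "v \<in> hcar (\<H> x)" "g x = hfun (\<H> x) v" by blast
    then have "f x = v" using x by (simp add: f_def fibS_riesz)
    then show "f x \<in> hcar (\<H> x)" "hfun (\<H> x) (f x) = g x"
      using v by simp_all
  qed
  have Jf: "J f = g"
    by (rule extensionalityI[of _ "garr G"]) (use g rep in \<open>auto simp: conj_sec_def PiE_iff\<close>)
  have "f \<in> \<F>"
    unfolding F0_iff equivariant_section_def
  proof (intro conjI ballI impI rep(1))
    show "f \<in> extensional (garr G)" by (simp add: f_def)
    have "continuous_map (gtop G) (total_top X (bun S))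
        ((\<lambda>(u, \<phi>). (u, hriesz (rfib S u) \<phi>)) \<circ> (\<lambda>x. (gdom G x, g x)))"
      by (rule continuous_map_compose[OF _ bundle_conj_continuous(2)]) (use g in blast)
    then have "continuous_map (gtop G) (total_top X (bun S)) (\<lambda>x. (gdom G x, f x))"
      by (rule continuous_map_eq) (simp add: f_def topspace_gtop)
    then show "continuous_along (gtop G) (bun S) (gdom G) f"
      using continuous_map_total_top_iff[OF bundle_S cont_dom] by blast
    show "compactin Q (coset_supp f)" using g conj_sec_supp[of f] rep(1) Jf by simp
    fix x h assume x: "x \<in> garr G" and h: "h \<in> H" and xh: "(x, h) \<in> gcomposable G"
    note xharr = gmult_arr[OF grpd xh]
    have "g (gmult G x h) = act S' (ginv G h) (g x)" using g x h xh by blast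
    also have "\<dots> = hfun (\<H> (gmult G x h)) (act S (ginv G h) (f x))"
      using fibS_act(1)[OF x h xh rep(1)[OF x]] rep(2)[OF x] by simp
    finally show "f (gmult G x h) = act S (ginv G h) (f x)"
      using xharr fibS_riesz[OF xharr fibS_act(2)[OF x h xh rep(1)[OF x]]] by (simp add: f_def)
  qed
  then show thesis using that Jf by blast
qed

lemma conj_sec_inj: "inj_on J (\<F>)"
proof (rule inj_onI)
  fix f g assume f: "f \<in> \<F>" and g: "g \<in> \<F>" and eq: "J f = J g"
  show "f = g"
  proof (rule extensionalityI[OF F0_D(1)[OF f] F0_D(1)[OF g]])
    fix x assume x: "x \<in> garr G"
    show "f x = g x"
      using fun_cong[OF eq, of x] x inj_onD[OF antiunitaryD(3)[OF fibS_anti[OF x]] _ F0_D(5)[OF f x] F0_D(5)[OF g x]]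
      by (simp add: conj_sec_def)
  qed
qed

text \<open>At each \<open>x\<close> the map \<open>v \<mapsto> f\<^sub>v\<close> is antiunitary; the inner product is the integral of these
  pointwise identities over \<open>G/H\<close>, and conjugation commutes with integration.\<close>

lemma conj_sec_antiunitary:
  assumes u: "u \<in> gunits G"
  shows "antiunitary (ind_F0_space G H mu S u) (ind_F0_space G H mu S' u) J"
  unfolding antiunitary_def
proof (intro conjI ballI allI)
  show "bij_betw J (hcar (ind_F0_space G H mu S u)) (hcar (ind_F0_space G H mu S' u))"
    unfolding bij_betw_def ind_F0_space_def hspace.simps
    using conj_sec_inj conj_sec_F0 conj_sec_surj by (auto simp: image_iff) metis
  fix f assume "f \<in> hcar (ind_F0_space G H mu S u)"
  then have f: "f \<in> \<F>" by (simp add: ind_F0_space_def)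
  show "J (hscale (ind_F0_space G H mu S u) a f) = hscale (ind_F0_space G H mu S' u) (cnj a) (J f)" for a
    using antiunitaryD(6)[OF fibS_anti F0_D(5)[OF f]]
    by (auto simp: ind_F0_space_def conj_sec_def sec_scale_def fib_S' fun_eq_iff)
  fix g assume "g \<in> hcar (ind_F0_space G H mu S u)"
  then have g: "g \<in> \<F>" by (simp add: ind_F0_space_def)
  show "J (hadd (ind_F0_space G H mu S u) f g) = hadd (ind_F0_space G H mu S' u) (J f) (J g)"
    using antiunitaryD(5)[OF fibS_anti F0_D(5)[OF f] F0_D(5)[OF g]]
    by (auto simp: ind_F0_space_def conj_sec_def sec_add_def fib_S' fun_eq_iff)
  have "(LINT A|mu u. (let x = some_elem A in hinner (rfib S' (gdom G x)) (J f x) (J g x)))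
      = (LINT A|mu u. cnj (let x = some_elem A in hinner (\<H> x) (f x) (g x)))"
  proof (rule Bochner_Integration.integral_cong[OF refl])
    fix A assume "A \<in> space (mu u)"
    then obtain y where y: "y \<in> garr G" "A = q y"
      by (auto simp: radon_space[OF mu_radon[OF u]] topspace_coset_top)
    have x: "some_elem A \<in> garr G" unfolding y(2) by (rule coset_mem_arr[OF y(1) some_elem_coset[OF y(1)]])
    show "(let x = some_elem A in hinner (rfib S' (gdom G x)) (J f x) (J g x))
        = cnj (let x = some_elem A in hinner (\<H> x) (f x) (g x))"
      using antiunitaryD(7)[OF fibS_anti[OF x] F0_D(5)[OF f x] F0_D(5)[OF g x]] x
      by (simp add: Let_def conj_sec_def fib_S')
  qed
  then show "hinner (ind_F0_space G H mu S' u) (J f) (J g) = cnj (hinner (ind_F0_space G H mu S u) f g)"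
    by (simp add: ind_F0_space_def ind_ip_def)
qed

sublocale A: induced_module G H mu S
  by (rule induced_module[OF nonempty])

lemma F0'_eq: "ind_F0 G H S' = J ` A.F0"
  using conj_sec_F0 conj_sec_surj by (auto simp: image_iff) metis

lemma nu'_eq:
  assumes "u \<in> gunits G" "f \<in> A.F0"
  shows "hnorm (ind_F0_space G H mu S' u) (J f) = A.nu u f"
  using antiunitary_hnorm[OF conj_sec_antiunitary[OF assms(1)]] assms(2) by simp

lemma nu'_hdiff:
  assumes "u \<in> gunits G" "f \<in> A.F0" "g \<in> A.F0"
  shows "hnorm (ind_F0_space G H mu S' u) (hdiff (ind_F0_space G H mu S' u) (J f) (J g)) = A.nu u (A.dif f g)"
  using antiunitary_hnorm_hdiff[OF conj_sec_antiunitary[OF assms(1)] A.F0_semi_inner[OF assms(1)]] assms(2,3)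
  by simp

sublocale B: induced_module G H mu S'
proof
  show "gunits G \<noteq> {}" by (rule nonempty)
  show "ind_F0 G H S' \<noteq> {}" using A.F0_nonempty by (simp add: F0'_eq)
  show "semi_inner_space (ind_F0_space G H mu S' u)" if "u \<in> gunits G" for u
    by (rule antiunitary_semi_inner_space[OF conj_sec_antiunitary[OF that] A.F0_semi_inner[OF that]])
  show "\<exists>B. \<forall>u\<in>gunits G. hnorm (ind_F0_space G H mu S' u) g \<le> B" if g: "g \<in> ind_F0 G H S'" for g
  proof -
    obtain f where f: "f \<in> A.F0" "J f = g" using conj_sec_surj[OF g] by blast
    then show ?thesis using A.F0_bounded[OF f(1)] nu'_eq[OF _ f(1)] by simp
  qed
  show "g = g'" if g: "g \<in> ind_F0 G H S'" and g': "g' \<in> ind_F0 G H S'" and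
    0: "\<And>u. u \<in> gunits G \<Longrightarrow>
         hnorm (ind_F0_space G H mu S' u) (hdiff (ind_F0_space G H mu S' u) g g') = 0" for g g'
  proof -
    obtain f where f: "f \<in> A.F0" "J f = g" using conj_sec_surj[OF g] by blast
    obtain f' where f': "f' \<in> A.F0" "J f' = g'" using conj_sec_surj[OF g'] by blast
    have "A.nu u (A.dif f f') = 0" if "u \<in> gunits G" for u
      using 0[OF that] nu'_hdiff[OF that f(1) f'(1)] f(2) f'(2) by simp
    then have "f = f'" by (intro A.F0_separated f f') simp
    then show ?thesis using f(2) f'(2) by simp
  qed
qed

lemma d'_eq: "f \<in> A.F0 \<Longrightarrow> g \<in> A.F0 \<Longrightarrow> B.d (J f) (J g) = A.d f g"
  using nu'_hdiff by (simp add: A.d_eq_SUP B.d_eq_SUP conj_sec_F0)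

lemma JC_Cs: "s \<in> A.Cs \<Longrightarrow> JC s \<in> B.Cs"
  unfolding A.Cs_iff B.Cs_iff by (simp add: conj_sec_F0 d'_eq)

lemma JC_surj:
  assumes "t \<in> B.Cs" obtains s where "s \<in> A.Cs" "JC s = t"
proof -
  define s where "s = (\<lambda>n. inv_into A.F0 J (t n))"
  have t: "t n \<in> J ` A.F0" for n using B.Cs_nth[OF assms] by (simp add: F0'_eq)
  have s: "s n \<in> A.F0" and Js: "J (s n) = t n" for n
    using inv_into_into[OF t] f_inv_into_f[OF t] by (simp_all add: s_def)
  have "s \<in> A.Cs"
    using assms s unfolding A.Cs_iff B.Cs_iff by (simp flip: Js add: d'_eq)
  then show thesis using that Js by blast
qed

lemma B_Cs_eq: "B.Cs = (\<lambda>s. JC s) ` A.Cs"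
  using JC_Cs JC_surj by (auto simp: image_iff) metis

lemma JC_inj: "inj_on (\<lambda>s. JC s) A.Cs"
proof (rule inj_onI)
  fix s t assume s: "s \<in> A.Cs" and t: "t \<in> A.Cs" and "JC s = JC t"
  then have "J (s n) = J (t n)" for n by (rule_tac fun_cong)
  then show "s = t"
    using inj_onD[OF conj_sec_inj _ A.Cs_nth[OF s] A.Cs_nth[OF t]] by blast
qed

lemma JC_antiunitary:
  assumes u: "u \<in> gunits G"
  shows "antiunitary (A.C u) (B.C u) (\<lambda>s. JC s)"
  unfolding antiunitary_def A.C_simps B.C_simps
proof (intro conjI ballI allI)
  note JD = antiunitaryD[OF conj_sec_antiunitary[OF u], unfolded A.V0_simps B.V0_simps]
  show "bij_betw (\<lambda>s. JC s) A.Cs B.Cs" using JC_inj by (simp add: bij_betw_def B_Cs_eq)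
  fix s assume s: "s \<in> A.Cs"
  show "JC (\<lambda>n. sec_scale G S a (s n)) = (\<lambda>n. sec_scale G S' (cnj a) (JC s n))" for a
    using JD(6)[OF A.Cs_nth[OF s]] by simp
  fix t assume t: "t \<in> A.Cs"
  show "JC (\<lambda>n. sec_add G S (s n) (t n)) = (\<lambda>n. sec_add G S' (JC s n) (JC t n))"
    using JD(5)[OF A.Cs_nth[OF s] A.Cs_nth[OF t]] by simp
  show "hinner (B.C u) (JC s) (JC t) = cnj (hinner (A.C u) s t)"
  proof (rule LIMSEQ_unique[OF B.ip_tendsto[OF JC_Cs[OF s] JC_Cs[OF t] u]])
    show "(\<lambda>n. ind_ip G mu S' (JC s n) (JC t n) u) \<longlonglongrightarrow> cnj (hinner (A.C u) s t)"
      using tendsto_cnj[OF A.ip_tendsto[OF s t u]] JD(7)[OF A.Cs_nth[OF s] A.Cs_nth[OF t]] by simp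
  qed
qed

lemma cls_JC:
  assumes s: "s \<in> A.Cs" shows "B.cls (JC s) = (\<lambda>s. JC s) ` A.cls s"
proof -
  have "(\<lambda>n. B.d (JC s n) (JC t n)) = (\<lambda>n. A.d (s n) (t n))" if "t \<in> A.Cs" for t
    using d'_eq[OF A.Cs_nth[OF s] A.Cs_nth[OF that]] by simp
  then show ?thesis
    unfolding A.cls_eq[OF s] B.cls_eq[OF JC_Cs[OF s]] B_Cs_eq by auto
qed

text \<open>A point of the fibre is a set of classes of Cauchy sequences, so \<open>J\<close> acts on it by taking images
  twice. This avoids choosing representatives.\<close>

lemma pt_JC:
  assumes u: "u \<in> gunits G" and s: "s \<in> A.Cs"
  shows "B.pt u (JC s) = JF (A.pt u s)"
proof -
  have "B.dC u (JC t) (JC s) = A.dC u t s" if "t \<in> A.Cs" for t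
    using antiunitary_hnorm_hdiff[OF JC_antiunitary[OF u] A.C_semi_inner[OF u], of t s] that s by simp
  then have "{t' \<in> B.Cs. B.dC u t' (JC s) = 0}
      = (\<lambda>s. JC s) ` {t \<in> A.Cs. A.dC u t s = 0}"
    unfolding B_Cs_eq by auto
  note eq = this
  show ?thesis
    unfolding A.pt_eq[OF u s] B.pt_eq[OF u JC_Cs[OF s]] eq image_image
    by (rule image_cong[OF refl]) (simp add: cls_JC)
qed

lemma ind_null_JF:
  assumes u: "u \<in> gunits G"
  shows "ind_null G H mu S' u = JF (ind_null G H mu S u)"
proof -
  have "hnorm (B.C u) (JC t) = hnorm (A.C u) t" if "t \<in> A.Cs" for t
    using antiunitary_hnorm[OF JC_antiunitary[OF u], of t] that by simp
  then have "{t' \<in> B.Cs. hnorm (B.C u) t' = 0} = (\<lambda>s. JC s) ` {t \<in> A.Cs. hnorm (A.C u) t = 0}"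
    unfolding B_Cs_eq by auto
  note eq = this
  show ?thesis
    unfolding A.ind_null_eq[OF u] B.ind_null_eq[OF u] eq image_image
    by (rule image_cong[OF refl]) (simp add: cls_JC)
qed

text \<open>The operations of both fibres are those of Cauchy sequences, on which \<open>J\<close> is antiunitary.\<close>

lemma JF_antiunitary:
  assumes u: "u \<in> gunits G"
  shows "antiunitary (A.V u) (B.V u) JF"
  unfolding antiunitary_def A.hcar_ind_fib[OF u] ball_simps
proof (intro conjI ballI allI)
  note CD = antiunitaryD[OF JC_antiunitary[OF u], unfolded A.C_simps B.C_simps]
  note Jpt = pt_JC[OF u, symmetric]
  have dist: "B.dC u (JC s) (JC t) = A.dC u s t"
    if "s \<in> A.Cs" "t \<in> A.Cs" for s t
    using antiunitary_hnorm_hdiff[OF JC_antiunitary[OF u] A.C_semi_inner[OF u], of s t] that by simp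
  show "bij_betw JF (A.pt u ` A.Cs) (hcar (B.V u))"
    unfolding bij_betw_def
  proof
    show "inj_on JF (A.pt u ` A.Cs)"
    proof (rule inj_onI)
      fix P R assume "P \<in> A.pt u ` A.Cs" "R \<in> A.pt u ` A.Cs" and eq: "JF P = JF R"
      then obtain s t where s: "s \<in> A.Cs" "P = A.pt u s" and t: "t \<in> A.Cs" "R = A.pt u t" by blast
      have "B.pt u (JC s) = B.pt u (JC t)" using eq by (simp only: s(2) t(2) pt_JC[OF u s(1)] pt_JC[OF u t(1)])
      then show "P = R"
        unfolding s(2) t(2) B.pt_eq_iff[OF u JC_Cs[OF s(1)] JC_Cs[OF t(1)]] A.pt_eq_iff[OF u s(1) t(1)]
        by (simp only: dist[OF s(1) t(1)])
    qed
    have "JF ` A.pt u ` A.Cs = B.pt u ` (\<lambda>s. JC s) ` A.Cs"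
      unfolding image_image by (rule image_cong[OF refl Jpt])
    then show "JF ` A.pt u ` A.Cs = hcar (B.V u)"
      unfolding B.hcar_ind_fib[OF u] B_Cs_eq .
  qed
  fix s assume s: "s \<in> A.Cs"
  show "JF (hscale (A.V u) a (A.pt u s)) = hscale (B.V u) (cnj a) (JF (A.pt u s))" for a
    unfolding A.hscale_ind_fib[OF u s] Jpt[OF A.scale_Cs[OF s]] Jpt[OF s]
      B.hscale_ind_fib[OF u JC_Cs[OF s]]
    using CD(6)[OF s] by simp
  fix t assume t: "t \<in> A.Cs"
  show "JF (hadd (A.V u) (A.pt u s) (A.pt u t)) = hadd (B.V u) (JF (A.pt u s)) (JF (A.pt u t))"
    unfolding A.hadd_ind_fib[OF u s t] Jpt[OF A.add_Cs[OF s t]] Jpt[OF s] Jpt[OF t]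
      B.hadd_ind_fib[OF u JC_Cs[OF s] JC_Cs[OF t]]
    using CD(5)[OF s t] by simp
  show "hinner (B.V u) (JF (A.pt u s)) (JF (A.pt u t)) = cnj (hinner (A.V u) (A.pt u s) (A.pt u t))"
    unfolding A.hinner_ind_fib[OF u s t] Jpt[OF s] Jpt[OF t]
      B.hinner_ind_fib[OF u JC_Cs[OF s] JC_Cs[OF t]]
    by (rule CD(7)[OF s t])
qed

end

context conjugate_induction
begin

section \<open>Intertwining and continuity\<close>

lemma mem_fib_Cs:
  assumes u: "u \<in> gunits G" and A: "A \<in> hcar (A.V u)" "F \<in> A" "s \<in> F"
  shows "s \<in> A.Cs"
proof -
  obtain r where r: "r \<in> A.Cs" "A = A.pt u r" using A(1) unfolding A.hcar_ind_fib[OF u] by blast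
  obtain t where "t \<in> A.Cs" "F = A.cls t" using A(2) unfolding r(2) A.pt_eq[OF u r(1)] by blast
  then show ?thesis using A(3) by (simp add: A.cls_eq)
qed

text \<open>The arrows \<open>x\<^sup>-\<^sup>1 y\<close> and \<open>y\<close> have the same source, so both values lie in one fibre of \<open>\<sigma>\<close>, where
  the Riesz map is isometric.\<close>

lemma translate_distance_conj:
  assumes x: "x \<in> garr G" and f: "f \<in> A.F0" and g: "g \<in> A.F0"
    and K: "K \<in> coset_rng_fibre G H (grng G x)"
  shows "(let y = some_elem K; V = rfib S' (gdom G y)
            in (hnorm V (hdiff V (J f (gmult G (ginv G x) y)) (J g y)))\<^sup>2)
       = (let y = some_elem K; V = \<H> y
            in (hnorm V (hdiff V (f (gmult G (ginv G x) y)) (g y)))\<^sup>2)"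
proof -
  obtain z where z: "z \<in> garr G" "K = q z" "grng G z = grng G x"
    using K unfolding coset_rng_fibre_def by blast
  define y where "y = some_elem K"
  define w where "w = gmult G (ginv G x) y"
  have yz: "y \<in> q z" unfolding y_def z(2) by (rule some_elem_coset[OF z(1)])
  have y: "y \<in> garr G" by (rule coset_mem_arr[OF z(1) yz])
  have xy: "(ginv G x, y) \<in> gcomposable G"
    using coset_mem_grng[OF z(1) yz] z(3) gdom_ginv[OF grpd x]
    by (intro gcomposableI[OF grpd] ginv_arr[OF grpd x] y) simp
  have w: "w \<in> garr G" "gdom G w = gdom G y"
    unfolding w_def by (rule gmult_arr[OF grpd xy], rule gdom_gmult[OF grpd xy])
  have "f w \<in> hcar (\<H> y)" using F0_D(5)[OF f w(1)] w(2) by simp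
  then have "hnorm (rfib S' (gdom G y)) (hdiff (rfib S' (gdom G y)) (J f w) (J g y))
      = hnorm (\<H> y) (hdiff (\<H> y) (f w) (g y))"
    using antiunitary_hnorm_hdiff[OF fibS_anti[OF y] fibS_semi[OF y] _ F0_D(5)[OF g y]] w y
    by (simp add: conj_sec_def fib_S')
  then show ?thesis by (simp add: Let_def y_def[symmetric] w_def[symmetric])
qed

lemma ind_translates_JF:
  assumes x: "x \<in> garr G" and A: "A \<in> hcar (A.V (gdom G x))" and B: "B \<in> hcar (A.V (grng G x))"
  shows "ind_translates G H mu S' x (JF A) (JF B) \<longleftrightarrow> ind_translates G H mu S x A B"
  unfolding ind_translates_def bex_simps
proof (intro bex_cong refl)
  fix F s F' t assume "F \<in> A" "s \<in> F" "F' \<in> B" "t \<in> F'"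
  then have s: "s \<in> A.Cs" and t: "t \<in> A.Cs"
    using mem_fib_Cs[OF gdom_unit[OF grpd x] A] mem_fib_Cs[OF grng_unit[OF grpd x] B] by blast+
  have "(LINT C:coset_rng_fibre G H (grng G x)|mu (grng G x).
           (let y = some_elem C; V = rfib S' (gdom G y)
            in (hnorm V (hdiff V (JC s n (gmult G (ginv G x) y)) (JC t n y)))\<^sup>2))
      = (LINT C:coset_rng_fibre G H (grng G x)|mu (grng G x).
           (let y = some_elem C; V = \<H> y
            in (hnorm V (hdiff V (s n (gmult G (ginv G x) y)) (t n y)))\<^sup>2))" for n
    unfolding set_lebesgue_integral_def
  proof (rule Bochner_Integration.integral_cong[OF refl])
    fix K
    show "indicator (coset_rng_fibre G H (grng G x)) K *\<^sub>R
           (let y = some_elem K; V = rfib S' (gdom G y)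
            in (hnorm V (hdiff V (JC s n (gmult G (ginv G x) y)) (JC t n y)))\<^sup>2)
        = (indicator (coset_rng_fibre G H (grng G x)) K :: real) *\<^sub>R
           (let y = some_elem K; V = \<H> y
            in (hnorm V (hdiff V (s n (gmult G (ginv G x) y)) (t n y)))\<^sup>2)"
      using translate_distance_conj[OF x A.Cs_nth[OF s] A.Cs_nth[OF t], of K]
      by (cases "K \<in> coset_rng_fibre G H (grng G x)") simp_all
  qed
  then show "(\<lambda>n. LINT C:coset_rng_fibre G H (grng G x)|mu (grng G x).
           (let y = some_elem C; V = rfib S' (gdom G y)
            in (hnorm V (hdiff V (JC s n (gmult G (ginv G x) y)) (JC t n y)))\<^sup>2)) \<longlonglongrightarrow> 0 \<longleftrightarrow>
        (\<lambda>n. LINT C:coset_rng_fibre G H (grng G x)|mu (grng G x).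
           (let y = some_elem C; V = \<H> y
            in (hnorm V (hdiff V (s n (gmult G (ginv G x) y)) (t n y)))\<^sup>2)) \<longlonglongrightarrow> 0"
    by (simp only:)
qed

lemma ind_act_in_fib:
  assumes x: "x \<in> garr G"
  shows "ind_act G H mu S x A \<in> hcar (A.V (grng G x))"
proof (cases "\<exists>!B. B \<in> hcar (A.V (grng G x)) \<and> ind_translates G H mu S x A B")
  case True
  from theI'[OF True] True show ?thesis by (simp add: ind_act_def Let_def)
next
  case False
  then show ?thesis
    unfolding ind_act_def Let_def A.hzero_ind_fib[OF grng_unit[OF grpd x]] if_not_P[OF False]
    by (intro A.ind_null_in_fib grng_unit[OF grpd x])
qed

text \<open>The translate of a class is characterised by a limit of integrals of squared fibre distances,
  which conjugation leaves unchanged; so both its existence and its value carry over.\<close>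

lemma ind_act_JF:
  assumes x: "x \<in> garr G" and A: "A \<in> hcar (A.V (gdom G x))"
  shows "ind_act G H mu S' x (JF A) = JF (ind_act G H mu S x A)"
proof -
  define r where "r = grng G x"
  have r: "r \<in> gunits G" unfolding r_def by (rule grng_unit[OF grpd x])
  let ?P = "\<lambda>B. B \<in> hcar (A.V r) \<and> ind_translates G H mu S x A B"
  let ?P' = "\<lambda>B. B \<in> hcar (B.V r) \<and> ind_translates G H mu S' x (JF A) B"
  note JD = antiunitaryD[OF JF_antiunitary[OF r]]
  have P'_JF: "?P' (JF B) \<longleftrightarrow> ?P B" if "B \<in> hcar (A.V r)" for B
    using ind_translates_JF[OF x A, folded r_def, OF that] JD(4)[OF that] that by simp
  have P'_D: "\<exists>B. ?P B \<and> B' = JF B" if "?P' B'" for B'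
  proof -
    have "B' \<in> JF ` hcar (A.V r)" using that JD(2) by simp
    then obtain B where "B \<in> hcar (A.V r)" "B' = JF B" by (elim imageE)
    then show ?thesis using P'_JF[of B] that by (intro exI[of _ B]) simp
  qed
  show ?thesis
  proof (cases "\<exists>!B. ?P B")
    case True
    define B where "B = (THE B. ?P B)"
    have B: "?P B" unfolding B_def by (rule theI'[OF True])
    have uniq: "B' = B" if "?P B'" for B' unfolding B_def by (rule the1_equality[OF True that, symmetric])
    have P'B: "?P' (JF B)" using P'_JF[of B] B by simp
    have uniq': "B' = JF B" if B': "?P' B'" for B'
    proof -
      from P'_D[OF B'] obtain B1 where B1: "?P B1 \<and> B' = JF B1" ..
      show ?thesis unfolding conjunct2[OF B1] uniq[OF conjunct1[OF B1]] ..
    qed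
    have ex': "\<exists>!B'. ?P' B'" by (rule ex1I[of ?P', OF P'B uniq'])
    have "(THE B'. ?P' B') = JF B" by (rule the_equality[of ?P', OF P'B uniq'])
    then show ?thesis
      unfolding ind_act_def Let_def r_def[symmetric] if_P[OF True] if_P[OF ex'] B_def .
  next
    case False
    have not': "\<not> (\<exists>!B'. ?P' B')"
    proof
      assume ex': "\<exists>!B'. ?P' B'"
      define B' where "B' = (THE B'. ?P' B')"
      have B': "?P' B'" unfolding B'_def by (rule theI'[OF ex'])
      have uniq: "B'' = B'" if "?P' B''" for B''
        unfolding B'_def by (rule the1_equality[OF ex' that, symmetric])
      from P'_D[OF B'] obtain B where "?P B \<and> B' = JF B" ..
      then have B: "?P B" "B' = JF B" by blast+
      have "B1 = B" if B1: "?P B1" for B1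
      proof (rule inj_onD[OF JD(3)])
        show "B1 \<in> hcar (A.V r)" "B \<in> hcar (A.V r)" using B1 B(1) by simp_all
        show "JF B1 = JF B" using uniq[of "JF B1"] P'_JF[of B1] B1 B(2) by simp
      qed
      then have "\<exists>!B. ?P B" by (intro ex1I[of ?P, OF B(1)])
      then show False using False by contradiction
    qed
    show ?thesis
      unfolding ind_act_def Let_def r_def[symmetric] if_not_P[OF False] if_not_P[OF not']
        A.hzero_ind_fib[OF r] B.hzero_ind_fib[OF r]
      by (rule ind_null_JF[OF r])
  qed
qed

lemma ind_fib_inner: "u \<in> gunits G \<Longrightarrow> inner_space (A.V u)"
  by (rule A.inner_space_ind_fib)

lemma ind_fib_semi: "u \<in> gunits G \<Longrightarrow> semi_inner_space (A.V u)"
  using ind_fib_inner by (simp add: inner_space_def)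

text \<open>The generating sections \<open>t\<^sub>F\<close> correspond under \<open>J\<close>, hence so do their locally uniform limits.\<close>

lemma sec_ind_bundle_conj:
  "sec (ind_bundle G H mu S') = (\<lambda>\<xi>. \<lambda>u\<in>topspace X. JF (\<xi> u)) ` sec (ind_bundle G H mu S)"
proof -
  let ?c = "\<lambda>\<xi>. \<lambda>u\<in>topspace X. JF (\<xi> u)"
  let ?TA = "{(\<lambda>u\<in>gunits G. ind_t G H mu S F u) | F. F \<in> ind_F G H mu S}"
  let ?TB = "{(\<lambda>u\<in>gunits G. ind_t G H mu S' F u) | F. F \<in> ind_F G H mu S'}"
  have TA: "?TA = (\<lambda>s. \<lambda>u\<in>gunits G. A.pt u s) ` A.Cs"
    unfolding A.ind_F_eq by blast
  have "?TB = (\<lambda>t. \<lambda>u\<in>gunits G. B.pt u t) ` B.Cs"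
    unfolding B.ind_F_eq by blast
  also have "\<dots> = ?c ` ?TA"
    unfolding B_Cs_eq TA image_image topspace_X
    by (intro image_cong refl) (simp add: pt_JC restrict_def fun_eq_iff)
  finally have TB: "?TB = ?c ` ?TA" .
  have "?TA \<subseteq> (\<Pi>\<^sub>E u\<in>topspace X. hcar (A.V u))"
    unfolding TA topspace_X using A.hcar_ind_fib by auto
  then have "loc_unif_closure X B.V (?c ` ?TA) = ?c ` loc_unif_closure X A.V ?TA"
    by (intro loc_unif_closure_transport) (simp_all add: topspace_X JF_antiunitary ind_fib_semi)
  then show ?thesis by (simp add: ind_bundle_def TB)
qed

definition conj_intertwiner :: "'g \<Rightarrow> ((nat \<Rightarrow> 'g \<Rightarrow> 'v) set set \<Rightarrow> complex) \<Rightarrow>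
    (nat \<Rightarrow> 'g \<Rightarrow> 'v \<Rightarrow> complex) set set" where
  "conj_intertwiner u = JF \<circ> hriesz (A.V u)"

lemma conj_intertwiner_unitary:
  "u \<in> gunits G \<Longrightarrow> hunitary (hdual (A.V u)) (B.V u) (conj_intertwiner u)"
  unfolding conj_intertwiner_def
  by (rule antiunitary_imp_hunitary_hdual[OF ind_fib_inner JF_antiunitary])

lemma conj_intertwiner_hfun:
  "u \<in> gunits G \<Longrightarrow> A \<in> hcar (A.V u) \<Longrightarrow> conj_intertwiner u (hfun (A.V u) A) = JF A"
  by (simp add: conj_intertwiner_def hriesz_hfun[OF ind_fib_inner])

lemma hcar_hdual: "hcar (hdual V) = hfun V ` hcar V"
  by (simp add: hdual_def)

lemma conj_intertwiner_hdiff: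
  assumes u: "u \<in> gunits G" and A: "A \<in> hcar (A.V u)" and \<phi>: "\<phi> \<in> hcar (hdual (A.V u))"
  shows "hnorm (B.V u) (hdiff (B.V u) (conj_intertwiner u \<phi>) (JF A))
    = hnorm (hdual (A.V u)) (hdiff (hdual (A.V u)) \<phi> (hfun (A.V u) A))"
proof -
  obtain B where B: "B \<in> hcar (A.V u)" "\<phi> = hfun (A.V u) B" using \<phi> unfolding hcar_hdual by blast
  have "hnorm (B.V u) (hdiff (B.V u) (JF B) (JF A)) = hnorm (A.V u) (hdiff (A.V u) B A)"
    by (rule antiunitary_hnorm_hdiff[OF JF_antiunitary[OF u] ind_fib_semi[OF u] B(1) A])
  also have "\<dots> = hnorm (hdual (A.V u)) (hdiff (hdual (A.V u)) (hfun (A.V u) B) (hfun (A.V u) A))"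
    by (rule antiunitary_hnorm_hdiff[OF antiunitary_hfun[OF ind_fib_inner[OF u]] ind_fib_semi[OF u] B(1) A, symmetric])
  finally show ?thesis by (simp only: B(2) conj_intertwiner_hfun[OF u B(1)])
qed

abbreviation "conj_ind \<equiv> conj_rep G (ind_rep G H mu S)"
abbreviation "ind_conj \<equiv> ind_rep G H mu S'"

lemma conj_intertwiner_continuous:
  "continuous_map (total_top X (bun conj_ind)) (total_top X (bun ind_conj)) (\<lambda>(u, \<phi>). (u, conj_intertwiner u \<phi>))"
proof -
  let ?E = "bun conj_ind" and ?E' = "bun ind_conj"
  have fibE: "fib ?E u = hdual (A.V u)" and fibE': "fib ?E' u = B.V u" for u
    by (simp_all add: conj_rep_def ind_rep_def ind_bundle_def)
  have secE: "sec ?E = {(\<lambda>u\<in>gunits G. hfun (A.V u) (\<xi> u)) | \<xi>. \<xi> \<in> sec (ind_bundle G H mu S)}"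
    by (simp add: conj_rep_def ind_rep_def ind_bundle_def)
  have secE': "sec ?E' = (\<lambda>\<xi>. \<lambda>u\<in>gunits G. JF (\<xi> u)) ` sec (ind_bundle G H mu S)"
    unfolding ind_rep_def grep.simps sec_ind_bundle_conj topspace_X ..
  have car: "\<xi> u \<in> hcar (A.V u)" if "\<xi> \<in> sec (ind_bundle G H mu S)" "u \<in> gunits G" for \<xi> u
  proof -
    have "\<xi> \<in> (\<Pi>\<^sub>E u\<in>topspace X. hcar (A.V u))"
      using that(1) by (simp add: ind_bundle_def loc_unif_closure_def)
    then show ?thesis by (rule PiE_mem) (simp add: topspace_X that(2))
  qed
  have dist: "\<forall>u\<in>topspace X. \<forall>\<phi>\<in>hcar (fib ?E u).
      fdist ?E' u (conj_intertwiner u \<phi>) ((\<lambda>u\<in>gunits G. JF (\<xi> u)) u)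
      = fdist ?E u \<phi> ((\<lambda>u\<in>gunits G. hfun (A.V u) (\<xi> u)) u)"
    if "\<xi> \<in> sec (ind_bundle G H mu S)" for \<xi>
    unfolding fibE fibE' topspace_X
    by (intro ballI) (simp only: restrict_apply' conj_intertwiner_hdiff[OF _ car[OF that]])
  show ?thesis
  proof (rule continuous_map_total_top_transport)
    show "conj_intertwiner u \<phi> \<in> hcar (fib ?E' u)" if "u \<in> topspace X" "\<phi> \<in> hcar (fib ?E u)" for u \<phi>
      using conj_intertwiner_unitary[of u] that unfolding fibE fibE' topspace_X
      by (auto simp: hunitary_def hlinear_def)
    show "\<exists>\<xi>\<in>sec ?E. \<forall>u\<in>topspace X. \<forall>\<phi>\<in>hcar (fib ?E u).
      fdist ?E' u (conj_intertwiner u \<phi>) (\<xi>' u) = fdist ?E u \<phi> (\<xi> u)"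
      if \<xi>': "\<xi>' \<in> sec ?E'" for \<xi>'
    proof -
      obtain \<xi> where \<xi>: "\<xi> \<in> sec (ind_bundle G H mu S)" "\<xi>' = (\<lambda>u\<in>gunits G. JF (\<xi> u))"
        using \<xi>' unfolding secE' by (elim imageE)
      have "(\<lambda>u\<in>gunits G. hfun (A.V u) (\<xi> u)) \<in> sec ?E" unfolding secE using \<xi>(1) by blast
      then show ?thesis unfolding \<xi>(2) by (rule bexI[rotated]) (rule dist[OF \<xi>(1)])
    qed
    show "\<exists>\<xi>'\<in>sec ?E'. \<forall>u\<in>topspace X. \<forall>\<phi>\<in>hcar (fib ?E u).
      fdist ?E' u (conj_intertwiner u \<phi>) (\<xi>' u) = fdist ?E u \<phi> (\<eta> u)"
      if \<eta>: "\<eta> \<in> sec ?E" for \<eta>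
    proof -
      obtain \<xi> where \<xi>: "\<xi> \<in> sec (ind_bundle G H mu S)" "\<eta> = (\<lambda>u\<in>gunits G. hfun (A.V u) (\<xi> u))"
        using \<eta> unfolding secE by blast
      have "(\<lambda>u\<in>gunits G. JF (\<xi> u)) \<in> sec ?E'" unfolding secE' using \<xi>(1) by (rule imageI)
      then show ?thesis unfolding \<xi>(2) by (rule bexI[rotated]) (rule dist[OF \<xi>(1)])
    qed
  qed
qed

lemma conj_ind_equivalent: "unitarily_equivalent G conj_ind ind_conj"
proof -
  have fibs: "rfib conj_ind u = hdual (A.V u)" "rfib ind_conj u = B.V u" for u
    by (simp_all add: conj_rep_def ind_rep_def ind_bundle_def)
  have acts: "act conj_ind x \<phi> = hfun (A.V (grng G x)) (ind_act G H mu S x (hriesz (A.V (gdom G x)) \<phi>))"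
    "act ind_conj x = ind_act G H mu S' x" for x \<phi>
    by (simp_all add: conj_rep_def ind_rep_def ind_bundle_def)
  have "conj_intertwiner \<in> Mor G conj_ind ind_conj"
    unfolding Mor_def mem_Collect_eq fibs
  proof (intro conjI ballI conj_intertwiner_continuous)
    fix u assume "u \<in> gunits G"
    note U = conj_intertwiner_unitary[OF this]
    have "hnorm (B.V u) (conj_intertwiner u \<phi>) \<le> 1 * hnorm (hdual (A.V u)) \<phi>"
      if "\<phi> \<in> hcar (hdual (A.V u))" for \<phi>
      using U that by (simp add: hunitary_def hnorm_def)
    then show "hbounded (hdual (A.V u)) (B.V u) (conj_intertwiner u)"
      using U unfolding hbounded_def hunitary_def by blast
  next
    fix x \<phi> assume x: "x \<in> garr G" and "\<phi> \<in> hcar (hdual (A.V (gdom G x)))"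
    then obtain A where A: "A \<in> hcar (A.V (gdom G x))" and \<phi>: "\<phi> = hfun (A.V (gdom G x)) A"
      unfolding hcar_hdual by (elim imageE)
    note d = gdom_unit[OF grpd x] and r = grng_unit[OF grpd x]
    have "conj_intertwiner (grng G x) (act conj_ind x \<phi>) = JF (ind_act G H mu S x A)"
      unfolding acts \<phi> hriesz_hfun[OF ind_fib_inner[OF d] A]
      by (rule conj_intertwiner_hfun[OF r ind_act_in_fib[OF x]])
    also have "\<dots> = act ind_conj x (conj_intertwiner (gdom G x) \<phi>)"
      unfolding acts \<phi> conj_intertwiner_hfun[OF d A] by (rule ind_act_JF[OF x A, symmetric])
    finally show "conj_intertwiner (grng G x) (act conj_ind x \<phi>)
      = act ind_conj x (conj_intertwiner (gdom G x) \<phi>)" .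
  qed
  then show ?thesis
    unfolding unitarily_equivalent_def fibs
    by (rule bexI[rotated]) (intro ballI conj_intertwiner_unitary)
qed

end

lemma total_top_empty: "topspace X = {} \<Longrightarrow> topspace (total_top X E) = {}"
  using openin_subset by (fastforce simp: total_top_def tube_def)

text \<open>Over an empty unit space the supremum norm degenerates, but then both total spaces are empty.\<close>

lemma unitarily_equivalent_if_no_units:
  assumes "gunits G = {}" shows "unitarily_equivalent G P R"
proof -
  have arr: "garr G = {}" using assms by (auto simp: gunits_def)
  then have X: "topspace (gunit_top G) = {}" by (simp add: gunit_top_def garr_def)
  have "(\<lambda>u v. undefined) \<in> Mor G P R"
    using total_top_empty[OF X, of "bun P"] total_top_empty[OF X, of "bun R"]
    by (simp add: Mor_def assms arr continuous_map_def)
  then show ?thesis unfolding unitarily_equivalent_def using assms by blast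
qed

theorem theorem3p9:
  fixes G :: "'g groupoid" and H :: "'g set"
    and lam lamH :: "'g \<Rightarrow> 'g measure" and mu :: "'g \<Rightarrow> 'g set measure"
    and \<sigma> :: "('g, 'v) grep"
  assumes "topological_groupoid G"
    and "second_countable (gtop G)" and "locally_compact_space (gtop G)"
    and "Hausdorff_space (gtop G)"
    and "haar_system G lam"
    and "wide_subgroupoid G H" and "closedin (gtop G) H"
    and "haar_system (grestrict G H) lamH"
    and "full_equivariant_system G H mu"
    and "unitary_rep (grestrict G H) \<sigma>"
  shows "unitarily_equivalent G
           (conj_rep G (ind_rep G H mu \<sigma>))
           (ind_rep G H mu (conj_rep (grestrict G H) \<sigma>))"
proof (cases "gunits G = {}")
  case True
  then show ?thesis by (rule unitarily_equivalent_if_no_units)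
next
  case False
  interpret conjugate_induction G H lamH mu \<sigma>
    by unfold_locales (fact assms False)+
  show ?thesis by (rule conj_ind_equivalent)
qed

end
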